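(* There is a polynomial $p$ such that the following holds. Let $n,k,d$ be positive integers with $k\le n$ and $d\le n$, let $\sigma>0$, let $\mu_1,\ldots,\mu_n\in[0,1]^d$ be arbitrary, and let $\mathcal{X}=\{x_1,\ldots,x_n\}\subseteq\mathbb{R}^d$, where $x_i=\mu_i+g_i$ and $g_1,\ldots,g_n$ are independent $d$-dimensional Gaussian random vectors with mean $0$ whose coordinates are independent with standard deviation $\sigma$. Then for every choice of initial centers, the expected number of iterations of the $k$-means method on $\mathcal{X}$ is at most $p\bigl(n^{\sqrt{k}},1/\sigma\bigr)$.
   Context: The $k$-means method on a finite point set $\mathcal{X}\subseteq\mathbb{R}^d$ with $k$ clusters: (1) select initial cluster centers $c_1,\ldots,c_k\in\mathbb{R}^d$; (2) assign every $x\in\mathcal{X}$ to the cluster $C_i$ whose center $c_i$ is closest to $x$; (3) set $c_i=\frac{1}{|C_i|}\sum_{x\in C_i}x$ for every $i$; (4) if the clusters or the centers have changed, go to (2), otherwise terminate. An iteration is one execution of steps (2)–(3); the running time is the number of iterations. The paper's standing assumptions are $k\le n$ and $d\le n$. *)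

theory Defs
  imports "HOL-Probability.Probability"
begin

text \<open>Points and centers in R^d are represented as functions nat => real; only
coordinates j < d are relevant. A point set of n points is an indexed family
X :: nat => nat => real (point p, coordinate j), p < n. Centers C :: nat => nat => real,
center i (i < k), coordinate j.\<close>

definition sqdist :: "nat \<Rightarrow> (nat \<Rightarrow> real) \<Rightarrow> (nat \<Rightarrow> real) \<Rightarrow> real" where
  "sqdist d x c = (\<Sum>j<d. (x j - c j)^2)"

definition assign :: "nat \<Rightarrow> nat \<Rightarrow> (nat \<Rightarrow> nat \<Rightarrow> real) \<Rightarrow> (nat \<Rightarrow> real) \<Rightarrow> nat" where
  "assign d k C x = (LEAST i. i < k \<and> (\<forall>j<k. sqdist d x (C i) \<le> sqdist d x (C j)))"

definition kmeans_step ::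
  "nat \<Rightarrow> nat \<Rightarrow> nat \<Rightarrow> (nat \<Rightarrow> nat \<Rightarrow> real) \<Rightarrow> (nat \<Rightarrow> nat \<Rightarrow> real) \<Rightarrow> (nat \<Rightarrow> nat \<Rightarrow> real)" where
  "kmeans_step n d k X C = (\<lambda>i j.
     let S = {p. p < n \<and> assign d k C (X p) = i}
     in if S = {} then C i j else (\<Sum>p\<in>S. X p j) / real (card S))"

definition kmeans_centers ::
  "nat \<Rightarrow> nat \<Rightarrow> nat \<Rightarrow> (nat \<Rightarrow> nat \<Rightarrow> real) \<Rightarrow> (nat \<Rightarrow> nat \<Rightarrow> real) \<Rightarrow> nat \<Rightarrow> (nat \<Rightarrow> nat \<Rightarrow> real)" where
  "kmeans_centers n d k X C0 t = (kmeans_step n d k X ^^ t) C0"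

text \<open>Step (4): the method stops after iteration t iff neither the clusters formed in
iteration t nor the centers computed in iteration t differ from those of iteration t-1.
In iteration 1 the clusters are newly created, so the method cannot stop before t = 2.
Clusters of iteration t are assign d k (kmeans_centers ... (t-1)).\<close>
definition kmeans_stops_after ::
  "nat \<Rightarrow> nat \<Rightarrow> nat \<Rightarrow> (nat \<Rightarrow> nat \<Rightarrow> real) \<Rightarrow> (nat \<Rightarrow> nat \<Rightarrow> real) \<Rightarrow> nat \<Rightarrow> bool" where
  "kmeans_stops_after n d k X C0 t \<longleftrightarrow>
     2 \<le> t \<and>
     (\<forall>i<k. \<forall>j<d. kmeans_centers n d k X C0 t i j = kmeans_centers n d k X C0 (t - 1) i j) \<and>
     (\<forall>p<n. assign d k (kmeans_centers n d k X C0 (t - 1)) (X p)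
             = assign d k (kmeans_centers n d k X C0 (t - 2)) (X p))"

definition kmeans_iterations ::
  "nat \<Rightarrow> nat \<Rightarrow> nat \<Rightarrow> (nat \<Rightarrow> nat \<Rightarrow> real) \<Rightarrow> (nat \<Rightarrow> nat \<Rightarrow> real) \<Rightarrow> enat" where
  "kmeans_iterations n d k X C0 =
     (if \<exists>t. kmeans_stops_after n d k X C0 t
      then enat (LEAST t. kmeans_stops_after n d k X C0 t) else \<infinity>)"

definition poly2 :: "(nat \<Rightarrow> nat \<Rightarrow> real) \<Rightarrow> nat \<Rightarrow> real \<Rightarrow> real \<Rightarrow> real" where
  "poly2 c D x y = (\<Sum>i\<le>D. \<Sum>j\<le>D. c i j * x ^ i * y ^ j)"

end

theory Submission
  imports Defs
begin

text \<open>
  The potential (sum of squared distances of the points to their centers) drops in every iteration, by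
  the gains of the reassigned points plus the weighted squared movements of the centers. It suffices to
  show that, except with probability of order (A \<theta>)^4 for a polynomial A in n^{sqrt k} and 1/\<sigma>, every
  window of O(k) consecutive iterations decreases the potential by at least (\<sigma> \<theta>^2)^2; summing over
  the scales \<theta> = 2^{-i}/A then bounds the expectation.

  If the drop is smaller, every reassigned point is close to the bisector of the two centers involved, and
  a cluster whose size changes has its center determined, up to a small error, by the reassigned points
  alone. If in some iteration a cluster exchanges more than order d sqrt k points, round the centers in
  its component of the exchange graph to a net; the exchanged points then satisfy so many nearly
  independent constraints that a union bound excludes this. Otherwise every cluster exchanges only order
  d sqrt k points, and a cluster that takes three different values in the window yields a linear relation among
  so few points that a union bound over n^{O(d sqrt k)} relations applies. If finally every cluster takes at
  most two values, each point moves according to a fixed rule that becomes periodic with period two, which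
  contradicts the strict decrease of the potential. In dimension one a single linear relation is not
  unlikely enough; there the leftmost active cluster gives a direct argument.
\<close>

section \<open>Clusters, centers and the potential\<close>

text \<open>A drop of (\<sigma> \<theta>^2)^2 per window allows of order \<theta>^-4 iterations, so
  failure must have probability of order \<theta>^4 for all dyadic scales to contribute equally;
  about n^2 scales suffice because of the deterministic bound 2^(n k) + 2. Two thresholds are used:
  centers move by at most \<sigma> \<theta>^2, but count as close within \<sigma> \<theta>, so the
  bisector of centers that are not close confines a point to a slab of width proportional to
  \<theta>. The square root of k balances two union bounds. Relations among R points: n^O(R) choices
  against \<theta>^(2 d), that is n^O(R / d) per factor \<theta>. A cluster with more than R
  exchanges: n^O(k d) choices against a power of \<theta> of order R or more, that is n^O(k d / R)
  per factor. They meet at R of order d sqrt k. Two obstacles remain. The exponent of 1 / \<sigma>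
  must not grow with k, which dictates how centers are rounded. The initial centers are arbitrary,
  so a cluster that was never nonempty has an uncontrolled center; windows in which some cluster
  becomes nonempty for the first time are discarded, at most k of them.\<close>

definition centroid :: "(nat \<Rightarrow> nat \<Rightarrow> real) \<Rightarrow> nat set \<Rightarrow> nat \<Rightarrow> real" where
  "centroid X B l = (\<Sum>p\<in>B. X p l) / real (card B)"

lemma sqdist_nonneg: "0 \<le> sqdist d x y"
  unfolding sqdist_def by (intro sum_nonneg) auto

lemma sqdist_commute: "sqdist d x y = sqdist d y x"
  unfolding sqdist_def by (intro sum.cong) (auto simp: power2_commute)

lemma sqdist_eq_0_iff: "sqdist d x y = 0 \<longleftrightarrow> (\<forall>l<d. x l = y l)"
  unfolding sqdist_def by (subst sum_nonneg_eq_0_iff) auto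

lemma sqdist_cong: "(\<And>l. l < d \<Longrightarrow> x l = x' l) \<Longrightarrow> (\<And>l. l < d \<Longrightarrow> y l = y' l) \<Longrightarrow> sqdist d x y = sqdist d x' y'"
  unfolding sqdist_def by (intro sum.cong) auto

lemma sqdist_coord: "l < d \<Longrightarrow> (x l - y l)\<^sup>2 \<le> sqdist d x y"
  unfolding sqdist_def by (rule member_le_sum) auto

lemma sqdist_coord_le: "l < d \<Longrightarrow> 0 \<le> w \<Longrightarrow> sqdist d x y \<le> w\<^sup>2 \<Longrightarrow> \<bar>x l - y l\<bar> \<le> w"
  using sqdist_coord[of l d x y] power2_le_imp_le[of "\<bar>x l - y l\<bar>" w] by (simp add: order_trans)

lemma sqdist_triangle: 
  assumes "0 \<le> a" "0 \<le> b" "sqdist d x y \<le> a\<^sup>2" "sqdist d y z \<le> b\<^sup>2"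
  shows "sqdist d x z \<le> (a + b)\<^sup>2"
proof -
  have e: "sqdist d u v = (L2_set (\<lambda>l. u l - v l) {..<d})\<^sup>2" for u v
    unfolding sqdist_def L2_set_def by (simp add: sum_nonneg)
  have a: "L2_set (\<lambda>l. x l - y l) {..<d} \<le> a" using assms(1,3) unfolding e by (rule power2_le_imp_le[rotated])
  have b: "L2_set (\<lambda>l. y l - z l) {..<d} \<le> b" using assms(2,4) unfolding e by (rule power2_le_imp_le[rotated])
  have "L2_set (\<lambda>l. x l - z l) {..<d} = L2_set (\<lambda>l. (x l - y l) + (y l - z l)) {..<d}" by simp
  also have "\<dots> \<le> a + b" using L2_set_triangle_ineq[of "\<lambda>l. x l - y l" "\<lambda>l. y l - z l" "{..<d}"] a b by linarith
  finally show ?thesis unfolding e[of x z] by (intro power_mono) (auto simp: L2_set_nonneg)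
qed

text \<open>Anti-concentration works in one coordinate at a time; this selects a coordinate in which
  two far centers differ. The factor d, in place of its square root, costs only a
  polynomial.\<close>

lemma sqdist_big_coord:
  assumes "0 \<le> \<delta>" "\<delta>\<^sup>2 < sqdist d x y" "0 < d"
  shows "\<exists>l<d. \<delta> / real d < \<bar>x l - y l\<bar>"
proof (rule ccontr)
  assume "\<not> ?thesis"
  then have h: "\<bar>x l - y l\<bar> \<le> \<delta> / real d" if "l < d" for l using that by auto
  have "sqdist d x y \<le> (\<Sum>l<d. (\<delta> / real d)\<^sup>2)"
    unfolding sqdist_def
  proof (rule sum_mono)
    fix l assume "l \<in> {..<d}"
    then show "(x l - y l)\<^sup>2 \<le> (\<delta> / real d)\<^sup>2"
      using h[of l] power_mono[of "\<bar>x l - y l\<bar>" "\<delta> / real d" 2] by simp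
  qed
  also have "\<dots> = \<delta>\<^sup>2 / real d" using assms by (simp add: power_divide power2_eq_square)
  also have "\<dots> \<le> \<delta>\<^sup>2" using assms by (simp add: divide_le_eq mult_le_cancel_left1)
  finally show False using assms by simp
qed

text \<open>The parallel axis identity: deviations from the mean sum to zero, so the mixed term
  vanishes in every coordinate. It is the source of the movement term in
  \<open>pot_drop\<close>.\<close>

lemma sum_sqdist_centroid:
  assumes "finite B" "B \<noteq> {}"
  shows "(\<Sum>p\<in>B. sqdist d (X p) e) = (\<Sum>p\<in>B. sqdist d (X p) (centroid X B)) + real (card B) * sqdist d (centroid X B) e"
proof -
  have c: "real (card B) * centroid X B l = (\<Sum>p\<in>B. X p l)" for l
    using assms by (simp add: centroid_def)
  have "(\<Sum>p\<in>B. (X p l - e l)\<^sup>2) = (\<Sum>p\<in>B. (X p l - centroid X B l)\<^sup>2) + real (card B) * (centroid X B l - e l)\<^sup>2" for l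
  proof -
    let ?m = "centroid X B l"
    have "(\<Sum>p\<in>B. (X p l - e l)\<^sup>2) = (\<Sum>p\<in>B. (X p l - ?m)\<^sup>2 + 2 * (?m - e l) * (X p l - ?m) + (?m - e l)\<^sup>2)"
      by (intro sum.cong) (auto simp: power2_eq_square algebra_simps)
    also have "\<dots> = (\<Sum>p\<in>B. (X p l - ?m)\<^sup>2) + 2 * (?m - e l) * (\<Sum>p\<in>B. X p l - ?m) + real (card B) * (?m - e l)\<^sup>2"
      by (simp add: sum.distrib sum_distrib_left)
    also have "(\<Sum>p\<in>B. X p l - ?m) = 0" using c[of l] by (simp add: sum_subtractf)
    finally show ?thesis by simp
  qed
  then have "(\<Sum>l<d. \<Sum>p\<in>B. (X p l - e l)\<^sup>2) = (\<Sum>l<d. (\<Sum>p\<in>B. (X p l - centroid X B l)\<^sup>2) + real (card B) * (centroid X B l - e l)\<^sup>2)"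
    by simp
  moreover have swap: "(\<Sum>p\<in>B. \<Sum>l<d. f p l) = (\<Sum>l<d. \<Sum>p\<in>B. f p l)" for f :: "nat \<Rightarrow> nat \<Rightarrow> real"
    by (rule sum.swap)
  ultimately show ?thesis unfolding sqdist_def swap
    by (simp add: sum.distrib sum_distrib_left)
qed

text \<open>The centroid is the only minimizer of the sum of squared distances. Later this forbids
  that a whole cluster prefers the center of another one.\<close>

lemma all_closer_imp_centroid:
  assumes "finite B" "B \<noteq> {}" "\<And>p. p \<in> B \<Longrightarrow> sqdist d (X p) e \<le> sqdist d (X p) (centroid X B)" "l < d"
  shows "e l = centroid X B l"
proof -
  have "(\<Sum>p\<in>B. sqdist d (X p) e) \<le> (\<Sum>p\<in>B. sqdist d (X p) (centroid X B))" using assms by (intro sum_mono)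
  then have "real (card B) * sqdist d (centroid X B) e \<le> 0"
    using sum_sqdist_centroid[OF assms(1,2), of d X e] by simp
  then have "sqdist d (centroid X B) e = 0"
    using assms sqdist_nonneg[of d "centroid X B" e] by (auto simp: mult_le_0_iff card_gt_0_iff)
  then show ?thesis using assms(4) unfolding sqdist_eq_0_iff by auto
qed

lemma sum_box_le:
  fixes X :: "nat \<Rightarrow> nat \<Rightarrow> real"
  assumes "\<And>p. p \<in> B \<Longrightarrow> \<bar>X p l\<bar> \<le> D" "0 \<le> D"
  shows "\<bar>centroid X B l\<bar> \<le> D"
proof (cases "card B = 0")
  case False
  have "\<bar>\<Sum>p\<in>B. X p l\<bar> \<le> real (card B) * D"
    using sum_abs[of "\<lambda>p. X p l" B] sum_bounded_above[of B "\<lambda>p. \<bar>X p l\<bar>" D, OF assms(1)] by linarith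
  then show ?thesis using False unfolding centroid_def by (simp add: divide_le_eq mult.commute)
qed (simp add: centroid_def assms)

lemma assign_props:
  assumes "0 < k"
  shows "assign d k C x < k"
    and "j < k \<Longrightarrow> sqdist d x (C (assign d k C x)) \<le> sqdist d x (C j)"
    and "j < k \<Longrightarrow> sqdist d x (C j) \<le> sqdist d x (C (assign d k C x)) \<Longrightarrow> assign d k C x \<le> j"
proof -
  let ?P = "\<lambda>i. i < k \<and> (\<forall>j<k. sqdist d x (C i) \<le> sqdist d x (C j))"
  have "\<exists>i. ?P i"
  proof -
    let ?S = "(\<lambda>i. sqdist d x (C i)) ` {..<k}"
    have "Min ?S \<in> ?S" using assms by (intro Min_in) auto
    then obtain i where "i < k" "sqdist d x (C i) = Min ?S" by auto
    then show ?thesis by (intro exI[of _ i]) auto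
  qed
  then have P: "?P (assign d k C x)" unfolding assign_def by (rule LeastI_ex)
  then show "assign d k C x < k" by auto
  show "j < k \<Longrightarrow> sqdist d x (C (assign d k C x)) \<le> sqdist d x (C j)" using P by auto
  assume "j < k" "sqdist d x (C j) \<le> sqdist d x (C (assign d k C x))"
  then have "?P j" using P by (meson order_trans)
  then show "assign d k C x \<le> j" unfolding assign_def by (rule Least_le)
qed

lemma assign_cong:
  assumes "\<And>i l. i < k \<Longrightarrow> l < d \<Longrightarrow> C i l = C' i l"
  shows "assign d k C x = assign d k C' x"
proof -
  have "sqdist d x (C i) = sqdist d x (C' i)" if "i < k" for i using assms that by (intro sqdist_cong) auto
  then have "(\<lambda>i. i < k \<and> (\<forall>j<k. sqdist d x (C i) \<le> sqdist d x (C j))) = (\<lambda>i. i < k \<and> (\<forall>j<k. sqdist d x (C' i) \<le> sqdist d x (C' j)))"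
    by (intro ext) auto
  then show ?thesis unfolding assign_def by simp
qed

locale kmeans =
  fixes n d k :: nat and X C0 :: "nat \<Rightarrow> nat \<Rightarrow> real"
  assumes npos: "0 < n" and dpos: "0 < d" and kpos: "0 < k" and kn: "k \<le> n" and dn: "d \<le> n"
begin

definition cen :: "nat \<Rightarrow> nat \<Rightarrow> nat \<Rightarrow> real" where "cen t = kmeans_centers n d k X C0 t"
text \<open>Time t assigns with respect to the centers of time t-1; at time 0 nothing is assigned.\<close>
definition asg :: "nat \<Rightarrow> nat \<Rightarrow> nat" where "asg t p = assign d k (cen (t - 1)) (X p)"
definition cl :: "nat \<Rightarrow> nat \<Rightarrow> nat set" where "cl t i = (if t = 0 then {} else {p. p < n \<and> asg t p = i})"
text \<open>Taken after both steps of iteration t: \<open>asg t\<close> comes from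
  \<open>cen (t - 1)\<close>, while \<open>cen t\<close> are the new centers. Truncated subtraction
  makes \<open>asg 0\<close> equal to \<open>asg 1\<close>, so \<open>pot 0\<close> measures
  distances to the arbitrary initial centers and has no useful bound; the estimates start from
  \<open>pot 1\<close>.\<close>

definition pot :: "nat \<Rightarrow> real" where "pot t = (\<Sum>p<n. sqdist d (X p) (cen t (asg t p)))"

lemma asg_lt: "asg t p < k" unfolding asg_def using assign_props(1)[OF kpos] .

lemma asg_le: "j < k \<Longrightarrow> sqdist d (X p) (cen t (asg (Suc t) p)) \<le> sqdist d (X p) (cen t j)"
  unfolding asg_def using assign_props(2)[OF kpos] by simp

lemma asg_tie: "j < k \<Longrightarrow> sqdist d (X p) (cen t j) \<le> sqdist d (X p) (cen t (asg (Suc t) p)) \<Longrightarrow> asg (Suc t) p \<le> j"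
  unfolding asg_def using assign_props(3)[OF kpos] by simp

lemma finite_cl [simp]: "finite (cl t i)" unfolding cl_def by auto
lemma cl_sub: "cl t i \<subseteq> {..<n}" unfolding cl_def by auto
lemma cl_card: "card (cl t i) \<le> n" using card_mono[OF _ cl_sub[of t i]] by simp
lemma mem_cl: "0 < t \<Longrightarrow> p \<in> cl t i \<longleftrightarrow> p < n \<and> asg t p = i" unfolding cl_def by auto

lemma cen_0: "cen 0 = C0" unfolding cen_def kmeans_centers_def by simp

lemma cen_Suc: "cen (Suc t) i = (if cl (Suc t) i = {} then cen t i else centroid X (cl (Suc t) i))"
proof
  fix l
  have "{p. p < n \<and> assign d k (cen t) (X p) = i} = cl (Suc t) i" unfolding cl_def asg_def by auto
  then show "cen (Suc t) i l = (if cl (Suc t) i = {} then cen t i else centroid X (cl (Suc t) i)) l"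
    unfolding centroid_def cen_def kmeans_centers_def
    by (simp add: kmeans_step_def Let_def del: Collect_empty_eq empty_Collect_eq)
qed

lemma cen_nonempty: "cl t i \<noteq> {} \<Longrightarrow> cen t i = centroid X (cl t i)"
  by (cases t) (auto simp: cen_Suc cl_def)

lemma sum_clusters: "0 < t \<Longrightarrow> (\<Sum>p<n. f p (asg t p)) = (\<Sum>i<k. \<Sum>p\<in>cl t i. f p i)" for f :: "nat \<Rightarrow> nat \<Rightarrow> real"
proof -
  assume t: "0 < t"
  have "(\<Sum>p<n. f p (asg t p)) = (\<Sum>i<k. \<Sum>p\<in>{p\<in>{..<n}. asg t p = i}. f p (asg t p))"
    by (rule sum.group[symmetric]) (auto simp: asg_lt)
  also have "\<dots> = (\<Sum>i<k. \<Sum>p\<in>cl t i. f p i)" using t by (intro sum.cong) (auto simp: mem_cl)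
  finally show ?thesis .
qed

definition gain :: "nat \<Rightarrow> nat \<Rightarrow> real" where
  "gain t p = sqdist d (X p) (cen t (asg t p)) - sqdist d (X p) (cen t (asg (Suc t) p))"

lemma gain_nonneg: "0 \<le> gain t p" unfolding gain_def using asg_le[OF asg_lt] by simp

text \<open>Compare both potentials with the sum for the new assignment and the old centers:
  reassigning accounts for the gains, and the parallel axis identity in each nonempty cluster for
  the movements.\<close>

lemma pot_drop:
  "pot t - pot (Suc t) = (\<Sum>p<n. gain t p) + (\<Sum>i<k. real (card (cl (Suc t) i)) * sqdist d (cen (Suc t) i) (cen t i))"
proof -
  have cl: "(\<Sum>p\<in>cl (Suc t) i. sqdist d (X p) (cen t i)) = (\<Sum>p\<in>cl (Suc t) i. sqdist d (X p) (cen (Suc t) i))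
     + real (card (cl (Suc t) i)) * sqdist d (cen (Suc t) i) (cen t i)" for i
  proof (cases "cl (Suc t) i = {}")
    case True then show ?thesis by simp
  next
    case False
    then have c: "cen (Suc t) i = centroid X (cl (Suc t) i)" by (simp add: cen_Suc)
    show ?thesis unfolding c by (rule sum_sqdist_centroid[OF finite_cl False])
  qed
  have "pot t = (\<Sum>p<n. gain t p) + (\<Sum>p<n. sqdist d (X p) (cen t (asg (Suc t) p)))"
    unfolding pot_def gain_def by (simp add: sum_subtractf)
  also have "(\<Sum>p<n. sqdist d (X p) (cen t (asg (Suc t) p))) = (\<Sum>i<k. \<Sum>p\<in>cl (Suc t) i. sqdist d (X p) (cen t i))"
    by (rule sum_clusters) simp
  also have "\<dots> = (\<Sum>i<k. \<Sum>p\<in>cl (Suc t) i. sqdist d (X p) (cen (Suc t) i)) + (\<Sum>i<k. real (card (cl (Suc t) i)) * sqdist d (cen (Suc t) i) (cen t i))"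
    unfolding cl by (simp add: sum.distrib)
  also have "(\<Sum>i<k. \<Sum>p\<in>cl (Suc t) i. sqdist d (X p) (cen (Suc t) i)) = pot (Suc t)"
    unfolding pot_def by (rule sum_clusters[symmetric]) simp
  finally show ?thesis by simp
qed

lemma pot_Suc_le: "pot (Suc t) \<le> pot t"
proof -
  have "0 \<le> pot t - pot (Suc t)" unfolding pot_drop
    by (intro add_nonneg_nonneg sum_nonneg mult_nonneg_nonneg gain_nonneg sqdist_nonneg) auto
  then show ?thesis by simp
qed

lemma pot_mono: "t \<le> t' \<Longrightarrow> pot t' \<le> pot t"
  by (induction rule: dec_induct) (auto intro: order_trans[OF pot_Suc_le])

lemma pot_nonneg: "0 \<le> pot t" unfolding pot_def by (intro sum_nonneg sqdist_nonneg)

section \<open>Termination and the exponential deterministic bound\<close>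

definition same_centers :: "nat \<Rightarrow> nat \<Rightarrow> bool" where
  "same_centers t t' \<longleftrightarrow> (\<forall>i<k. \<forall>l<d. cen t i l = cen t' i l)"

lemma pot_strict: "\<not> same_centers (Suc t) t \<Longrightarrow> pot (Suc t) < pot t"
proof -
  assume "\<not> same_centers (Suc t) t"
  then obtain i l where il: "i < k" "l < d" "cen (Suc t) i l \<noteq> cen t i l" unfolding same_centers_def by auto
  then have ne: "cl (Suc t) i \<noteq> {}" by (auto simp: cen_Suc split: if_splits)
  have "sqdist d (cen (Suc t) i) (cen t i) \<noteq> 0" using il unfolding sqdist_eq_0_iff by auto
  then have "0 < real (card (cl (Suc t) i)) * sqdist d (cen (Suc t) i) (cen t i)"
    using ne sqdist_nonneg[of d "cen (Suc t) i" "cen t i"] by (simp add: card_gt_0_iff)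
  also have "\<dots> \<le> (\<Sum>i<k. real (card (cl (Suc t) i)) * sqdist d (cen (Suc t) i) (cen t i))"
    using il by (intro member_le_sum mult_nonneg_nonneg sqdist_nonneg) auto
  also have "\<dots> \<le> pot t - pot (Suc t)" unfolding pot_drop using sum_nonneg[of "{..<n}" "gain t"] gain_nonneg by simp
  finally show ?thesis by simp
qed

text \<open>The stopping test compares clusters as well as centers. Equal centers at t and t + 1
  make the assignments of iterations t + 1 and t + 2 agree, so the test succeeds only one iteration
  later, at t + 2.\<close>

lemma same_centers_stops: "same_centers (Suc t) t \<Longrightarrow> kmeans_stops_after n d k X C0 (t + 2)"
proof -
  assume s: "same_centers (Suc t) t"
  have a: "asg (Suc (Suc t)) p = asg (Suc t) p" for p
    unfolding asg_def using s unfolding same_centers_def by (intro assign_cong) auto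
  then have "cl (Suc (Suc t)) i = cl (Suc t) i" for i unfolding cl_def by auto
  then have "cen (Suc (Suc t)) i l = cen (Suc t) i l" for i l
    by (simp add: cen_Suc)
  with a show ?thesis unfolding kmeans_stops_after_def
    by (simp add: asg_def flip: cen_def)
qed

text \<open>A cluster that becomes empty keeps the centroid of its last nonempty value as its center.\<close>
fun last_cl :: "nat \<Rightarrow> nat \<Rightarrow> nat set" where
  "last_cl 0 i = {}"
| "last_cl (Suc t) i = (if cl (Suc t) i = {} then last_cl t i else cl (Suc t) i)"

lemma last_cl_sub: "last_cl t i \<subseteq> {..<n}" by (induction t) (auto dest: subsetD[OF cl_sub])
lemma last_cl_cl: "cl t i \<noteq> {} \<Longrightarrow> last_cl t i = cl t i" by (cases t) (auto simp: cl_def)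

lemma cen_last: "cen t i = (if last_cl t i = {} then C0 i else centroid X (last_cl t i))"
  by (induction t) (auto simp: cen_0 cen_Suc)

lemma last_cl_mono: "t \<le> t' \<Longrightarrow> last_cl t i \<noteq> {} \<Longrightarrow> last_cl t' i \<noteq> {}"
  by (induction rule: dec_induct) auto

text \<open>By \<open>cen_last\<close> all centers are functions of these k sets, the empty set
  standing for a center that still has its initial value. Hence there are at most 2^(n k)
  states.\<close>

definition state :: "nat \<Rightarrow> nat \<Rightarrow> nat set" where "state t = (\<lambda>i\<in>{..<k}. last_cl t i)"

lemma state_same: "state t = state t' \<Longrightarrow> same_centers t t'"
proof -
  assume "state t = state t'"
  then have "i < k \<Longrightarrow> last_cl t i = last_cl t' i" for i unfolding state_def by (auto dest!: fun_cong[of _ _ i])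
  then show ?thesis unfolding same_centers_def by (auto simp: cen_last)
qed

text \<open>The index is shifted because \<open>pot t\<close> also depends on the assignment made
  with the previous centers, whereas \<open>pot (Suc t)\<close> is a function of the centers at time
  t alone.\<close>

lemma pot_eq_same: "same_centers t t' \<Longrightarrow> pot (Suc t) = pot (Suc t')"
proof -
  assume s: "same_centers t t'"
  have a: "asg (Suc t) p = asg (Suc t') p" for p
    unfolding asg_def using s unfolding same_centers_def by (intro assign_cong) auto
  then have c: "cl (Suc t) i = cl (Suc t') i" for i unfolding cl_def by auto
  have "cen (Suc t) i l = cen (Suc t') i l" if "i < k" "l < d" for i l
    using s that c by (auto simp: cen_Suc same_centers_def)
  then show ?thesis unfolding pot_def a
    by (intro sum.cong sqdist_cong) (auto simp: asg_lt)
qed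

text \<open>As long as the centers change the potential falls strictly, so no state recurs; the
  pigeonhole principle applies to 2^(n k) + 1 times.\<close>

lemma exists_stop: "\<exists>t \<le> 2 ^ (n * k) + 2. kmeans_stops_after n d k X C0 t"
proof (rule ccontr)
  assume no: "\<not> ?thesis"
  have ns: "\<not> same_centers (Suc t) t" if "t \<le> 2 ^ (n * k)" for t
    using no same_centers_stops[of t] that by auto
  have lt: "pot t' < pot t" if "t < t'" "t' \<le> Suc (2 ^ (n * k))" for t t'
    using that
  proof (induction rule: strict_inc_induct)
    case (base i) then show ?case using pot_strict[OF ns[of i]] by simp
  next
    case (step i) then show ?case using pot_strict[OF ns[of i]] by force
  qed
  have "inj_on state {..2 ^ (n * k)}"
  proof (rule linorder_inj_onI)
    fix t t' :: nat assume t: "t < t'" "t \<in> {..2 ^ (n * k)}" "t' \<in> {..2 ^ (n * k)}"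
    show "state t \<noteq> state t'"
    proof
      assume "state t = state t'"
      then have "pot (Suc t) = pot (Suc t')" by (intro pot_eq_same state_same)
      then show False using lt[of "Suc t" "Suc t'"] t by simp
    qed
  qed auto
  moreover have "state ` {..2 ^ (n * k)} \<subseteq> PiE {..<k} (\<lambda>_. Pow {..<n})"
    using subsetD[OF last_cl_sub] unfolding state_def by auto
  ultimately have "card {..2 ^ (n * k)::nat} \<le> card (PiE {..<k} (\<lambda>_. Pow {..<n}))"
    by (intro card_inj_on_le) (auto intro: finite_PiE)
  also have "\<dots> = 2 ^ (n * k)" by (simp add: card_PiE card_Pow power_mult)
  finally show False by simp
qed

text \<open>Besides termination this provides the crude cap that is charged on events too unlikely
  to need a finer bound, and the range of times at which some center still changes.\<close>

lemma iterations_enat: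
  "\<exists>T. kmeans_iterations n d k X C0 = enat T \<and> T \<le> 2 ^ (n * k) + 2 \<and> (\<forall>t. t + 2 < T \<longrightarrow> \<not> same_centers (Suc t) t)"
proof -
  obtain t where t: "t \<le> 2 ^ (n * k) + 2" "kmeans_stops_after n d k X C0 t" using exists_stop by auto
  let ?T = "LEAST t. kmeans_stops_after n d k X C0 t"
  have "?T \<le> t" using t by (intro Least_le)
  moreover have "\<not> same_centers (Suc s) s" if "s + 2 < ?T" for s
    using same_centers_stops[of s] not_less_Least[OF that] by auto
  ultimately show ?thesis using t unfolding kmeans_iterations_def by (intro exI[of _ ?T]) auto
qed

end

section \<open>Short drops of the potential\<close>

text \<open>Excludes exact coincidences of probability zero. One coordinate is enough to tell
  centers apart; the second clause keeps centroids away from the initial centers, which may sit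
  anywhere.\<close>

definition null_free :: "nat \<Rightarrow> nat \<Rightarrow> (nat \<Rightarrow> nat \<Rightarrow> real) \<Rightarrow> (nat \<Rightarrow> nat \<Rightarrow> real) \<Rightarrow> bool" where
  "null_free n k X C0 \<longleftrightarrow>
    (\<forall>B B'. B \<subseteq> {..<n} \<longrightarrow> B' \<subseteq> {..<n} \<longrightarrow> B \<noteq> {} \<longrightarrow> B' \<noteq> {} \<longrightarrow> B \<noteq> B' \<longrightarrow> centroid X B 0 \<noteq> centroid X B' 0) \<and>
    (\<forall>B i. B \<subseteq> {..<n} \<longrightarrow> B \<noteq> {} \<longrightarrow> i < k \<longrightarrow> centroid X B 0 \<noteq> C0 i 0)"

text \<open>The relations to be excluded are of this form: the vector of a difference of two centroids, or of two
  quotients (gained minus lost points) / (change of the size) of the same cluster.\<close>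
definition svec :: "nat \<Rightarrow> nat \<Rightarrow> (nat \<Rightarrow> real) set" where
  "svec n R = (let small = {G. G \<subseteq> {..<n} \<and> card G \<le> R}; nz = {a::int. a \<noteq> 0 \<and> \<bar>a\<bar> \<le> int n} in
    (\<lambda>(G, L, a, G', L', b). \<lambda>p. (indicat_real G p - indicat_real L p) / real_of_int a
        - (indicat_real G' p - indicat_real L' p) / real_of_int b)
     ` (small \<times> small \<times> nz \<times> small \<times> small \<times> nz))"

definition lin :: "nat \<Rightarrow> (nat \<Rightarrow> nat \<Rightarrow> real) \<Rightarrow> (nat \<Rightarrow> real) \<Rightarrow> nat \<Rightarrow> real" where
  "lin n X v l = (\<Sum>p<n. v p * X p l)"

definition one_relation :: "nat \<Rightarrow> nat \<Rightarrow> nat \<Rightarrow> real \<Rightarrow> (nat \<Rightarrow> nat \<Rightarrow> real) \<Rightarrow> bool" where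
  "one_relation n d R \<tau> X \<longleftrightarrow> (\<exists>v\<in>svec n R. (\<exists>p<n. v p \<noteq> 0) \<and> (\<forall>l<d. \<bar>lin n X v l\<bar> \<le> \<tau>))"

text \<open>Linear independence is expressed by a nonzero 2 x 2 minor, because the probability bound
  eliminates one entry with this very minor and needs a lower bound for it.\<close>

definition two_relations :: "nat \<Rightarrow> nat \<Rightarrow> nat \<Rightarrow> real \<Rightarrow> (nat \<Rightarrow> nat \<Rightarrow> real) \<Rightarrow> bool" where
  "two_relations n d R \<tau> X \<longleftrightarrow> (\<exists>v\<in>svec n R. \<exists>v'\<in>svec n R. (\<exists>p<n. \<exists>q<n. v p * v' q \<noteq> v q * v' p) \<and>
      (\<forall>l<d. \<bar>lin n X v l\<bar> \<le> \<tau> \<and> \<bar>lin n X v' l\<bar> \<le> \<tau>))"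

text \<open>The normal is scaled to maximum norm 1 with one entry equal to 1. That entry is left
  alone when the others are rounded to a net, and it supplies a coordinate with coefficient 1 in
  which each point is confined.\<close>

definition crowded_slab :: "nat \<Rightarrow> nat \<Rightarrow> nat \<Rightarrow> real \<Rightarrow> (nat \<Rightarrow> nat \<Rightarrow> real) \<Rightarrow> bool" where
  "crowded_slab n d s \<tau> X \<longleftrightarrow> (\<exists>P u b l0. P \<subseteq> {..<n} \<and> card P = s \<and> l0 < d \<and> u l0 = 1 \<and> (\<forall>l<d. \<bar>u l\<bar> \<le> 1) \<and>
      (\<forall>p\<in>P. \<bar>(\<Sum>l<d. u l * X p l) - b\<bar> \<le> \<tau>))"

lemma svecI:
  assumes "G \<subseteq> {..<n}" "card G \<le> R" "L \<subseteq> {..<n}" "card L \<le> R" "a \<noteq> 0" "\<bar>a\<bar> \<le> int n"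
    "G' \<subseteq> {..<n}" "card G' \<le> R" "L' \<subseteq> {..<n}" "card L' \<le> R" "b \<noteq> 0" "\<bar>b\<bar> \<le> int n"
  shows "(\<lambda>p. (indicat_real G p - indicat_real L p) / real_of_int a
        - (indicat_real G' p - indicat_real L' p) / real_of_int b) \<in> svec n R"
  unfolding svec_def Let_def by (rule image_eqI[where x = "(G, L, a, G', L', b)"]) (use assms in auto)

definition cdiff :: "nat set \<Rightarrow> nat set \<Rightarrow> nat \<Rightarrow> real" where
  "cdiff A B p = indicat_real A p / real (card A) - indicat_real B p / real (card B)"

lemma cdiff_svec:
  assumes "A \<subseteq> {..<n}" "card A \<le> R" "B \<subseteq> {..<n}" "card B \<le> R" "A \<noteq> {}" "B \<noteq> {}"
  shows "cdiff A B \<in> svec n R"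
proof -
  have c: "card A \<le> n" "card B \<le> n" using assms card_mono[of "{..<n}"] by (metis card_lessThan finite_lessThan)+
  have p: "0 < card A" "0 < card B" using assms finite_subset[of _ "{..<n}"] by (auto simp: card_gt_0_iff)
  have "(\<lambda>p. (indicat_real A p - indicat_real {} p) / real_of_int (int (card A))
        - (indicat_real B p - indicat_real {} p) / real_of_int (int (card B))) \<in> svec n R"
    by (rule svecI) (use assms c p in auto)
  then show ?thesis unfolding cdiff_def by simp
qed

lemma sum_indicator_subset: "A \<subseteq> {..<n} \<Longrightarrow> (\<Sum>p<n. indicat_real A p * f p) = (\<Sum>p\<in>A. f p)" for n :: nat
  by (rule sum.mono_neutral_cong_right) (auto simp: indicator_def)

lemma lin_cdiff:
  assumes "A \<subseteq> {..<n}" "B \<subseteq> {..<n}"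
  shows "lin n X (cdiff A B) l = centroid X A l - centroid X B l"
proof -
  have "lin n X (cdiff A B) l = (\<Sum>p<n. indicat_real A p * X p l) / real (card A) - (\<Sum>p<n. indicat_real B p * X p l) / real (card B)"
    unfolding lin_def cdiff_def sum_divide_distrib sum_subtractf[symmetric]
    by (intro sum.cong) (auto simp: left_diff_distrib)
  then show ?thesis unfolding centroid_def sum_indicator_subset[OF assms(1)] sum_indicator_subset[OF assms(2)] .
qed

lemma cdiff_nonzero:
  assumes "A \<noteq> B" "finite A" "finite B" "A \<noteq> {}" "B \<noteq> {}"
  shows "\<exists>p\<in>A \<union> B. cdiff A B p \<noteq> 0"
proof -
  obtain p where "p \<in> A \<union> B" "p \<notin> A \<inter> B" using assms by auto
  then show ?thesis using assms by (intro bexI[of _ p]) (auto simp: cdiff_def indicator_def)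
qed

text \<open>Signed incidence matrix of the exchange graph, whose vertices are the clusters and whose
  edges are the reassigned points, directed from \<open>src\<close> to \<open>dst\<close>.\<close>

definition inc :: "(nat \<Rightarrow> nat) \<Rightarrow> (nat \<Rightarrow> nat) \<Rightarrow> nat \<Rightarrow> nat \<Rightarrow> real" where
  "inc src dst j p = (if dst p = j then 1 else 0) - (if src p = j then 1 else 0)"

section \<open>Almost sure distinctness of centers, and the slab between two clusters\<close>

context kmeans begin

abbreviation "nullfree \<equiv> null_free n k X C0"

text \<open>Current nonempty clusters are disjoint and remembered sets were distinct before. The
  remaining case is a new cluster i equal to the set remembered by the now empty cluster j: all its
  points find the center of i at least as near as their own centroid, which is the center of j, so
  both centers agree, which \<open>null_free\<close> forbids.\<close>

lemma last_cl_distinct: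
  assumes "nullfree"
  shows "i < k \<Longrightarrow> j < k \<Longrightarrow> i \<noteq> j \<Longrightarrow> last_cl t i \<noteq> {} \<Longrightarrow> last_cl t j \<noteq> {} \<Longrightarrow> last_cl t i \<noteq> last_cl t j"
proof (induction t arbitrary: i j)
  case 0 then show ?case by simp
next
  case (Suc t)
  have stale: False if ij: "i < k" "j < k" "i \<noteq> j" "cl (Suc t) i \<noteq> {}" "cl (Suc t) j = {}"
      "last_cl t j \<noteq> {}" "cl (Suc t) i = last_cl t j"
      and IH: "last_cl t i \<noteq> {} \<Longrightarrow> last_cl t i \<noteq> last_cl t j" for i j
  proof -
    let ?B = "cl (Suc t) i"
    have cj: "cen t j = centroid X ?B" using ij by (simp add: cen_last)
    have "sqdist d (X p) (cen t i) \<le> sqdist d (X p) (centroid X ?B)" if "p \<in> ?B" for p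
      using asg_le[OF ij(2), of p t] that cj by (auto simp: mem_cl)
    then have e: "cen t i 0 = centroid X ?B 0"
      using all_closer_imp_centroid[OF finite_cl ij(4) _ dpos] by blast
    show False
    proof (cases "last_cl t i = {}")
      case True
      then have "C0 i 0 = centroid X ?B 0" using e by (simp add: cen_last)
      then show False using assms ij cl_sub[of "Suc t" i] unfolding null_free_def by metis
    next
      case False
      then have "centroid X (last_cl t i) 0 = centroid X ?B 0" using e by (simp add: cen_last)
      moreover have "last_cl t i \<noteq> ?B" using IH[OF False] ij by simp
      ultimately show False using assms ij False last_cl_sub[of t i] cl_sub[of "Suc t" i] unfolding null_free_def by metis
    qed
  qed
  show ?case
  proof (cases "cl (Suc t) i = {}"; cases "cl (Suc t) j = {}")
    assume "cl (Suc t) i = {}" "cl (Suc t) j = {}"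
    then show ?thesis using Suc by simp
  next
    assume "cl (Suc t) i \<noteq> {}" "cl (Suc t) j = {}"
    then show ?thesis using stale[of i j] Suc by auto
  next
    assume "cl (Suc t) i = {}" "cl (Suc t) j \<noteq> {}"
    then show ?thesis using stale[of j i] Suc by auto
  next
    assume a: "cl (Suc t) i \<noteq> {}" "cl (Suc t) j \<noteq> {}"
    then show ?thesis using Suc.prems(3) by (auto simp: mem_cl)
  qed
qed

lemma cen_distinct:
  assumes "nullfree" "i < k" "j < k" "i \<noteq> j" "last_cl t i \<noteq> {}" "last_cl t j \<noteq> {}"
  shows "cen t i 0 \<noteq> cen t j 0"
proof -
  have "centroid X (last_cl t i) 0 \<noteq> centroid X (last_cl t j) 0"
    using last_cl_distinct[OF assms] assms(1,5,6) last_cl_sub[of t i] last_cl_sub[of t j]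
    unfolding null_free_def by blast
  then show ?thesis using assms(5,6) by (simp add: cen_last)
qed

text \<open>Otherwise every point of the cluster would find a different center at least as near as
  its own centroid. The point that does not go along is what makes later relations
  nontrivial.\<close>

lemma not_all_move:
  assumes "nullfree" "i < k" "j < k" "i \<noteq> j" "cl t i \<noteq> {}" "last_cl t j \<noteq> {}"
  shows "\<not> cl t i \<subseteq> cl (Suc t) j"
proof
  assume s: "cl t i \<subseteq> cl (Suc t) j"
  have ci: "cen t i = centroid X (cl t i)" using assms(5) by (rule cen_nonempty)
  have "sqdist d (X p) (cen t j) \<le> sqdist d (X p) (centroid X (cl t i))" if "p \<in> cl t i" for p
    using asg_le[OF assms(2), of p t] s that ci by (auto simp: mem_cl)
  then have "cen t j 0 = cen t i 0"
    unfolding ci using all_closer_imp_centroid[OF finite_cl assms(5) _ dpos] by blast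
  moreover have "last_cl t i \<noteq> {}" using assms(5) last_cl_cl by auto
  ultimately show False using cen_distinct[OF assms(1-4) _ assms(6)] by simp
qed

lemma sqdist_diff_lin:
  "sqdist d x c' - sqdist d x c = (\<Sum>l<d. 2 * (c l - c' l) * x l) + (\<Sum>l<d. (c' l)\<^sup>2 - (c l)\<^sup>2)"
  unfolding sqdist_def sum.distrib[symmetric] sum_subtractf[symmetric]
  by (intro sum.cong) (auto simp: power2_eq_square algebra_simps)

text \<open>Points of two clusters with nearby centers lie close to the hyperplane that separated them:
  their affine functional h has one sign on each cluster, and its averages are its values at the centers.\<close>
lemma close_centers_slab:
  assumes ij: "i < k" "j < k" "i \<noteq> j" "cl (Suc t) i \<noteq> {}" and ne: "cen t i 0 \<noteq> cen t j 0"
    and \<delta>: "0 \<le> \<delta>" "sqdist d (cen (Suc t) i) (cen (Suc t) j) \<le> \<delta>\<^sup>2"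
  shows "\<exists>u b l0. l0 < d \<and> u l0 = 1 \<and> (\<forall>l<d. \<bar>u l\<bar> \<le> 1) \<and>
    (\<forall>p\<in>cl (Suc t) i \<union> cl (Suc t) j. \<bar>(\<Sum>l<d. u l * X p l) - b\<bar> \<le> real n * real d * \<delta>)"
proof -
  define a where "a l = 2 * (cen t i l - cen t j l)" for l
  define c where "c = (\<Sum>l<d. (cen t j l)\<^sup>2 - (cen t i l)\<^sup>2)"
  define h where "h x = (\<Sum>l<d. a l * x l) + c" for x
  have h: "h x = sqdist d x (cen t j) - sqdist d x (cen t i)" for x
    unfolding h_def a_def c_def sqdist_diff_lin by simp
  \<comment> \<open>The largest coefficient. Dividing by the signed entry \<open>a l0\<close> at the
    end produces a normal with an entry 1 and all others of modulus at most 1.\<close>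
  define U where "U = Max ((\<lambda>l. \<bar>a l\<bar>) ` {..<d})"
  have "U \<in> (\<lambda>l. \<bar>a l\<bar>) ` {..<d}" unfolding U_def using dpos by (intro Max_in) auto
  then obtain l0 where l0: "l0 < d" "U = \<bar>a l0\<bar>" by auto
  have aU: "\<bar>a l\<bar> \<le> U" if "l < d" for l unfolding U_def using that by (intro Max_ge) auto
  have "a 0 \<noteq> 0" using ne unfolding a_def by simp
  then have U: "0 < U" using aU[of 0] dpos by linarith
  have havg: "real (card (cl (Suc t) m)) * h (cen (Suc t) m) = (\<Sum>p\<in>cl (Suc t) m. h (X p))" if "cl (Suc t) m \<noteq> {}" for m
  proof -
    have cc: "real (card (cl (Suc t) m)) * cen (Suc t) m l = (\<Sum>p\<in>cl (Suc t) m. X p l)" for l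
      using that by (simp add: cen_Suc centroid_def)
    have "(\<Sum>p\<in>cl (Suc t) m. h (X p)) = (\<Sum>l<d. a l * (\<Sum>p\<in>cl (Suc t) m. X p l)) + real (card (cl (Suc t) m)) * c"
      unfolding h_def sum.distrib sum_distrib_left by (subst sum.swap) simp
    also have "\<dots> = real (card (cl (Suc t) m)) * h (cen (Suc t) m)"
      unfolding h_def cc[symmetric] by (simp add: sum_distrib_left algebra_simps)
    finally show ?thesis by simp
  qed
  have hi: "0 \<le> h (X p)" if "p \<in> cl (Suc t) i" for p
    using asg_le[OF ij(2), of p t] that unfolding h by (auto simp: mem_cl)
  have hj: "h (X p) \<le> 0" if "p \<in> cl (Suc t) j" for p
    using asg_le[OF ij(1), of p t] that unfolding h by (auto simp: mem_cl)
  have hci: "0 \<le> h (cen (Suc t) i)"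
  proof -
    have "0 \<le> real (card (cl (Suc t) i)) * h (cen (Suc t) i)" unfolding havg[OF ij(4)] using hi by (rule sum_nonneg)
    then show ?thesis using ij(4) by (simp add: zero_le_mult_iff card_gt_0_iff)
  qed
  \<comment> \<open>An empty cluster keeps its center, and there h is minus a squared
    distance.\<close>
  have hcj: "h (cen (Suc t) j) \<le> 0"
  proof (cases "cl (Suc t) j = {}")
    case True
    then show ?thesis unfolding h by (simp add: cen_Suc sqdist_nonneg sqdist_eq_0_iff[THEN iffD2])
  next
    case False
    have "real (card (cl (Suc t) j)) * h (cen (Suc t) j) \<le> 0" unfolding havg[OF False] using hj by (rule sum_nonpos)
    then show ?thesis using False by (simp add: mult_le_0_iff card_gt_0_iff)
  qed
  have diff: "h (cen (Suc t) i) - h (cen (Suc t) j) \<le> real d * U * \<delta>"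
  proof -
    have "h (cen (Suc t) i) - h (cen (Suc t) j) = (\<Sum>l<d. a l * (cen (Suc t) i l - cen (Suc t) j l))"
      unfolding h_def by (simp add: sum_subtractf algebra_simps)
    also have "\<dots> \<le> (\<Sum>l<d. U * \<delta>)"
    proof (rule sum_mono)
      fix l assume l: "l \<in> {..<d}"
      have "a l * (cen (Suc t) i l - cen (Suc t) j l) \<le> \<bar>a l\<bar> * \<bar>cen (Suc t) i l - cen (Suc t) j l\<bar>"
        using abs_ge_self[of "a l * (cen (Suc t) i l - cen (Suc t) j l)"] by (simp add: abs_mult)
      also have "\<dots> \<le> U * \<delta>" using aU l U sqdist_coord_le[OF _ \<delta>] by (intro mult_mono) auto
      finally show "a l * (cen (Suc t) i l - cen (Suc t) j l) \<le> U * \<delta>" .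
    qed
    finally show ?thesis by simp
  qed
  \<comment> \<open>As h has one sign on a cluster, each value is at most the whole sum, which is
    the cardinality times the value at the center. The values at the two centers have opposite
    signs, so each is bounded by their difference.\<close>
  have each: "\<bar>h (X p)\<bar> \<le> real n * (real d * U * \<delta>)" if p: "p \<in> cl (Suc t) m" and m: "m = i \<or> m = j" for p m
  proof -
    have ne: "cl (Suc t) m \<noteq> {}" using p by auto
    have sg: "(\<forall>q\<in>cl (Suc t) m. 0 \<le> h (X q)) \<or> (\<forall>q\<in>cl (Suc t) m. h (X q) \<le> 0)" using m hi hj by auto
    have "\<bar>h (X p)\<bar> \<le> (\<Sum>q\<in>cl (Suc t) m. \<bar>h (X q)\<bar>)" using p by (intro member_le_sum) auto
    also have "\<dots> = \<bar>\<Sum>q\<in>cl (Suc t) m. h (X q)\<bar>"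
      using sg by (auto simp: sum_nonneg sum_nonpos abs_of_nonpos sum_negf)
    also have "\<dots> = real (card (cl (Suc t) m)) * \<bar>h (cen (Suc t) m)\<bar>" unfolding havg[OF ne, symmetric] by (simp add: abs_mult)
    also have "\<dots> \<le> real n * (real d * U * \<delta>)"
      using cl_card[of "Suc t" m] m hci hcj diff by (intro mult_mono) auto
    finally show ?thesis .
  qed
  show ?thesis
  proof (intro exI[of _ "\<lambda>l. a l / a l0"] exI[of _ "- c / a l0"] exI[of _ l0] conjI ballI allI impI)
    show "l0 < d" using l0 by simp
    show "a l0 / a l0 = 1" using U l0 by simp
    show "\<bar>a l / a l0\<bar> \<le> 1" if "l < d" for l using aU[OF that] U l0 by simp
    fix p assume p: "p \<in> cl (Suc t) i \<union> cl (Suc t) j"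
    have "(\<Sum>l<d. a l / a l0 * X p l) - - c / a l0 = h (X p) / a l0"
      unfolding h_def by (simp add: add_divide_distrib sum_divide_distrib)
    also have "\<bar>\<dots>\<bar> = \<bar>h (X p)\<bar> / U" using l0 by (simp add: abs_divide)
    also have "\<dots> \<le> real n * (real d * U * \<delta>) / U"
      using each[of p i] each[of p j] p less_imp_le[OF U] by (intro divide_right_mono) auto
    also have "\<dots> = real n * real d * \<delta>" using U by simp
    finally show "\<bar>(\<Sum>l<d. a l / a l0 * X p l) - - c / a l0\<bar> \<le> real n * real d * \<delta>" .
  qed
qed

section \<open>The balance between a cluster and its exchanged points\<close>

definition moved :: "nat \<Rightarrow> nat set" where "moved t = {p. p < n \<and> asg t p \<noteq> asg (Suc t) p}"

abbreviation "tinc t \<equiv> inc (asg t) (asg (Suc t))"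

lemma finite_moved [simp]: "finite (moved t)" unfolding moved_def by auto

lemma sum_moved:
  assumes "0 < t"
  shows "(\<Sum>p\<in>moved t. tinc t j p * f p) = (\<Sum>p\<in>cl (Suc t) j. f p) - (\<Sum>p\<in>cl t j. f p)"
proof -
  have "(\<Sum>p\<in>moved t. tinc t j p * f p) = (\<Sum>p<n. tinc t j p * f p)"
    by (rule sum.mono_neutral_left) (auto simp: moved_def inc_def)
  also have "\<dots> = (\<Sum>p<n. indicat_real (cl (Suc t) j) p * f p - indicat_real (cl t j) p * f p)"
    using assms by (intro sum.cong) (auto simp: inc_def indicator_def mem_cl)
  also have "\<dots> = (\<Sum>p\<in>cl (Suc t) j. f p) - (\<Sum>p\<in>cl t j. f p)"
    unfolding sum_subtractf sum_indicator_subset[OF cl_sub] ..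
  finally show ?thesis .
qed

lemma sum_moved_1:
  assumes "0 < t"
  shows "(\<Sum>p\<in>moved t. tinc t j p) = real (card (cl (Suc t) j)) - real (card (cl t j))"
  using sum_moved[OF assms, of j "\<lambda>_. 1"] by simp

context
  fixes t w assumes w: "0 \<le> w" and drop: "pot t - pot (Suc t) \<le> w\<^sup>2" and tpos: "0 < t"
begin

lemma small_gain: "p < n \<Longrightarrow> gain t p \<le> w\<^sup>2"
proof -
  assume p: "p < n"
  have "gain t p \<le> (\<Sum>p<n. gain t p)" using p gain_nonneg by (intro member_le_sum) auto
  also have "\<dots> \<le> pot t - pot (Suc t)" unfolding pot_drop
    by (simp add: sum_nonneg sqdist_nonneg)
  finally show ?thesis using drop by simp
qed

lemma small_move: "i < k \<Longrightarrow> real (card (cl (Suc t) i)) * sqdist d (cen (Suc t) i) (cen t i) \<le> w\<^sup>2"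
proof -
  assume i: "i < k"
  have "real (card (cl (Suc t) i)) * sqdist d (cen (Suc t) i) (cen t i)
    \<le> (\<Sum>i<k. real (card (cl (Suc t) i)) * sqdist d (cen (Suc t) i) (cen t i))"
    using i by (intro member_le_sum mult_nonneg_nonneg sqdist_nonneg) auto
  also have "\<dots> \<le> pot t - pot (Suc t)" unfolding pot_drop by (simp add: sum_nonneg gain_nonneg)
  finally show ?thesis using drop by simp
qed

lemma small_move_coord: "i < k \<Longrightarrow> l < d \<Longrightarrow> \<bar>cen (Suc t) i l - cen t i l\<bar> \<le> w"
proof (cases "cl (Suc t) i = {}")
  case True then show ?thesis using w by (simp add: cen_Suc)
next
  case False
  assume i: "i < k" "l < d"
  have "1 \<le> card (cl (Suc t) i)" using False by (simp add: Suc_le_eq card_gt_0_iff)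
  then have "1 * sqdist d (cen (Suc t) i) (cen t i) \<le> real (card (cl (Suc t) i)) * sqdist d (cen (Suc t) i) (cen t i)"
    by (intro mult_right_mono sqdist_nonneg) auto
  then show ?thesis using small_move[OF i(1)] i w by (intro sqdist_coord_le) auto
qed

text \<open>The difference equals the new cardinality times the movement of the center, since a
  cluster sum is cardinality times center. Divided by the change of size, it expresses the center
  through the exchanged points alone.\<close>

lemma cluster_balance:
  assumes "j < k" "l < d"
  shows "\<bar>(\<Sum>p\<in>moved t. tinc t j p * X p l) - (\<Sum>p\<in>moved t. tinc t j p) * cen t j l\<bar> \<le> real n * w"
proof -
  have c: "real (card (cl t j)) * cen t j l = (\<Sum>p\<in>cl t j. X p l)"
    by (cases "cl t j = {}") (auto simp: cen_nonempty centroid_def)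
  have c': "real (card (cl (Suc t) j)) * cen (Suc t) j l = (\<Sum>p\<in>cl (Suc t) j. X p l)"
    by (cases "cl (Suc t) j = {}") (auto simp: cen_nonempty centroid_def)
  have "(\<Sum>p\<in>moved t. tinc t j p * X p l) - (\<Sum>p\<in>moved t. tinc t j p) * cen t j l
     = real (card (cl (Suc t) j)) * (cen (Suc t) j l - cen t j l)"
    unfolding sum_moved[OF tpos] sum_moved_1[OF tpos] c[symmetric] c'[symmetric] by (simp add: algebra_simps)
  also have "\<bar>\<dots>\<bar> \<le> real n * w"
    unfolding abs_mult using small_move_coord[OF assms] cl_card[of "Suc t" j] by (intro mult_mono) auto
  finally show ?thesis .
qed

end

end

section \<open>One-dimensional instances\<close>

text \<open>Both differences are relations between singletons; a point of one pair outside the other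
  makes them independent.\<close>

lemma two_close_pairs:
  assumes "p < n" "q < n" "p' < n" "q' < n" "p \<noteq> q" "p' \<noteq> q'" "{p, q} \<noteq> {p', q'}"
    and "\<bar>X p 0 - X q 0\<bar> \<le> \<tau>" "\<bar>X p' 0 - X q' 0\<bar> \<le> \<tau>" "1 \<le> R"
  shows "two_relations n 1 R \<tau> X"
proof -
  have c: "centroid X {r} l = X r l" for r l by (simp add: centroid_def)
  have m: "cdiff {p} {q} \<in> svec n R" "cdiff {p'} {q'} \<in> svec n R" using assms by (auto intro!: cdiff_svec)
  have "\<exists>r\<in>{p, q}. r \<notin> {p', q'}" using assms(5-7) by auto
  then obtain r where r: "r \<in> {p, q}" "r \<notin> {p', q'}" by blast
  have "cdiff {p} {q} r * cdiff {p'} {q'} p' \<noteq> cdiff {p} {q} p' * cdiff {p'} {q'} r"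
    using r assms(5,6) by (auto simp: cdiff_def)
  moreover have "r < n" using r assms by auto
  ultimately show ?thesis unfolding two_relations_def
    using m assms by (intro bexI[of _ "cdiff {p} {q}"] bexI[of _ "cdiff {p'} {q'}"] conjI exI[of _ r] exI[of _ p'])
      (auto simp: lin_cdiff c)
qed

context kmeans begin

lemma changed_moved:
  assumes "\<not> same_centers (Suc t) t" "0 < t"
  shows "moved t \<noteq> {}"
proof
  assume "moved t = {}"
  then have "asg (Suc t) p = asg t p" if "p < n" for p using that unfolding moved_def by auto
  then have "cl (Suc t) i = cl t i" for i using assms(2) unfolding cl_def by auto
  then have "cen (Suc t) i = cen t i" for i by (simp add: cen_Suc cen_nonempty)
  then show False using assms(1) unfolding same_centers_def by simp
qed

context
  fixes w :: real assumes d1: "d = 1" and nf: "nullfree" and w: "0 < w"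
    and norel: "\<not> two_relations n 1 1 (10 * real n ^ 2 * w) X"
begin

lemma sqd1: "sqdist d x y = (x 0 - y 0)\<^sup>2" unfolding sqdist_def d1 by simp

text \<open>Consider the leftmost center among the clusters that exchange points. If all exchanges
  were between centers more than \<open>\<delta>\<close> apart, every point exchanged by this
  cluster would lie at least 2 n w to the right of its center, and all of them would be gained or
  all lost; such contributions cannot cancel, contrary to the balance bound n w. So some point
  changes between close centers. As independent close pairs are excluded, its old cluster consists
  of two points, and they get separated.\<close>

lemma iteration_1d:
  assumes t: "t = Suc s" and drop: "pot t - pot (Suc t) \<le> w\<^sup>2" and ns: "\<not> same_centers (Suc t) t"
    and act: "\<And>i. i < k \<Longrightarrow> last_cl (Suc t) i \<noteq> {} \<Longrightarrow> last_cl s i \<noteq> {}"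
  shows "\<exists>x y a b. x < n \<and> y < n \<and> x \<noteq> y \<and> \<bar>X x 0 - X y 0\<bar> \<le> 10 * real n ^ 2 * w \<and> cl t a = {x, y}
    \<and> x \<in> cl (Suc t) b \<and> y \<notin> cl (Suc t) b"
proof -
  have tp: "0 < t" using t by simp
  note dr = less_imp_le[OF w] drop tp
  \<comment> \<open>The factor 5 keeps points near a midpoint at distance (5 n w - n w) / 2 = 2 n w
    from the leftmost center, twice what the balance allows.\<close>
  define \<delta> where "\<delta> = 5 * real n * w"
  have np: "1 \<le> real n" using npos by simp
  have \<delta>: "0 < \<delta>" unfolding \<delta>_def using w npos by simp
  let ?c = "\<lambda>i. cen t i 0"
  let ?S = "asg t ` moved t \<union> asg (Suc t) ` moved t"
  have Sk: "i < k" if "i \<in> ?S" for i using that asg_lt by auto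
  have lastS: "last_cl s i \<noteq> {}" "last_cl t i \<noteq> {}" if iS: "i \<in> ?S" for i
  proof -
    obtain p where p: "p \<in> moved t" "i = asg t p \<or> i = asg (Suc t) p" using iS by blast
    then have "cl t i \<noteq> {} \<or> cl (Suc t) i \<noteq> {}" using tp by (auto simp: mem_cl moved_def)
    then have "last_cl (Suc t) i \<noteq> {}" using last_cl_cl[of t i] by auto
    then show "last_cl s i \<noteq> {}" using act Sk[OF iS] by blast
    then show "last_cl t i \<noteq> {}" using last_cl_mono[of s t i] t by simp
  qed
  have dist: "?c i \<noteq> ?c j" if "i \<in> ?S" "j \<in> ?S" "i \<noteq> j" for i j
    using cen_distinct[OF nf Sk[OF that(1)] Sk[OF that(2)] that(3) lastS(2)[OF that(1)] lastS(2)[OF that(2)]] .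
  have dist_s: "cen s i 0 \<noteq> cen s j 0" if "i \<in> ?S" "j \<in> ?S" "i \<noteq> j" for i j
    using cen_distinct[OF nf Sk[OF that(1)] Sk[OF that(2)] that(3) lastS(1)[OF that(1)] lastS(1)[OF that(2)]] .
  have "?S \<noteq> {}" using changed_moved[OF ns tp] by auto
  then have "\<exists>i\<in>?S. \<forall>j\<in>?S. ?c i \<le> ?c j"
  proof -
    have f: "finite (?c ` ?S)" by simp
    have "Min (?c ` ?S) \<in> ?c ` ?S" using \<open>?S \<noteq> {}\<close> f by (intro Min_in) auto
    then obtain i where "Min (?c ` ?S) = ?c i" "i \<in> ?S" by (rule imageE)
    then show ?thesis using Min_le[OF f] by (metis imageI)
  qed
  then obtain i where i: "i \<in> ?S" "\<And>j. j \<in> ?S \<Longrightarrow> ?c i \<le> ?c j" by blast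
  have right: "?c i < ?c j" if "j \<in> ?S" "j \<noteq> i" for j using i(2)[OF that(1)] dist[OF i(1) that(1)] that by force
  have "\<exists>x\<in>moved t. (?c (asg t x) - ?c (asg (Suc t) x))\<^sup>2 \<le> \<delta>\<^sup>2"
  proof (rule ccontr)
    assume "\<not> ?thesis"
    then have far: "\<delta>\<^sup>2 < (?c (asg t x) - ?c (asg (Suc t) x))\<^sup>2" if "x \<in> moved t" for x using that by force
    have far': "?c i + \<delta> < ?c j" if "x \<in> moved t" "{asg t x, asg (Suc t) x} = {i, j}" "j \<noteq> i" for x j
    proof -
      have "j \<in> ?S" using that by auto
      moreover have "\<delta>\<^sup>2 < (?c j - ?c i)\<^sup>2" using far[OF that(1)] that(2,3)
        by (auto simp: doubleton_eq_iff power2_commute)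
      then have "\<delta> < \<bar>?c j - ?c i\<bar>" using \<delta> by (metis abs_le_square_iff abs_of_pos not_le)
      ultimately show ?thesis using right[of j] that by auto
    qed
    have lost: "?c i + ?c j \<le> 2 * X x 0" if "x \<in> moved t" "asg t x = i" "asg (Suc t) x = j" for x j
    proof -
      have x: "x < n" "j \<noteq> i" using that by (auto simp: moved_def)
      have j: "?c i < ?c j" using that x by (intro right) auto
      have "0 \<le> (X x 0 - ?c i)\<^sup>2 - (X x 0 - ?c j)\<^sup>2"
        using gain_nonneg[of t x] that unfolding gain_def sqd1 by simp
      also have "\<dots> = (?c j - ?c i) * (2 * X x 0 - ?c i - ?c j)" by (simp add: power2_eq_square algebra_simps)
      finally show ?thesis using j by (auto simp: zero_le_mult_iff)
    qed
    have gained: "2 * X x 0 \<le> ?c i + ?c j" if "x \<in> moved t" "asg (Suc t) x = i" "j \<in> ?S" "j \<noteq> i" for x j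
    proof -
      have j: "?c i < ?c j" using that by (intro right) auto
      have "0 \<le> (X x 0 - ?c j)\<^sup>2 - (X x 0 - ?c i)\<^sup>2"
        using asg_le[OF Sk[OF that(3)], of x t] that unfolding sqd1 by simp
      also have "\<dots> = (?c j - ?c i) * (?c i + ?c j - 2 * X x 0)" by (simp add: power2_eq_square algebra_simps)
      finally show ?thesis using j by (auto simp: zero_le_mult_iff)
    qed
    have nw: "w / (5 * real n) \<le> real n * w"
    proof -
      have "w / (5 * real n) \<le> w" using np w by (simp add: divide_le_eq)
      also have "w \<le> real n * w" using np w by simp
      finally show ?thesis .
    qed
    \<comment> \<open>A lost point is not left of the midpoint; a gained one is left of it by at
      most w^2 / (2 \<delta>), because its gain is at most w^2.\<close>
    have all_right: "?c i + 2 * real n * w \<le> X x 0" if x: "x \<in> moved t" "asg t x = i \<or> asg (Suc t) x = i" for x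
    proof -
      have xn: "x < n" "asg t x \<noteq> asg (Suc t) x" using x by (auto simp: moved_def)
      define j where "j = (if asg t x = i then asg (Suc t) x else asg t x)"
      have j: "{asg t x, asg (Suc t) x} = {i, j}" "j \<noteq> i" using x(2) xn unfolding j_def by auto
      note f = far'[OF x(1) j]
      have "?c i + ?c j - 2 * X x 0 \<le> w / (5 * real n)"
      proof (cases "asg t x = i")
        case True
        then have "?c i + ?c j \<le> 2 * X x 0" using lost[OF x(1)] unfolding j_def by simp
        moreover have "0 \<le> w / (5 * real n)" using w by simp
        ultimately show ?thesis by linarith
      next
        case False
        then have jj: "asg t x = j" "asg (Suc t) x = i" using x unfolding j_def by auto
        have "(?c j - ?c i) * (?c i + ?c j - 2 * X x 0) = gain t x"
          unfolding gain_def jj sqd1 by (simp add: power2_eq_square algebra_simps)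
        also have "\<dots> \<le> w\<^sup>2" using small_gain[OF dr xn(1)] .
        finally have g: "(?c j - ?c i) * (?c i + ?c j - 2 * X x 0) \<le> w\<^sup>2" .
        have pos: "0 \<le> ?c i + ?c j - 2 * X x 0" using gained[OF x(1) jj(2), of j] j x(1) jj by auto
        have "\<delta> * (?c i + ?c j - 2 * X x 0) \<le> (?c j - ?c i) * (?c i + ?c j - 2 * X x 0)"
          using f pos by (intro mult_right_mono) auto
        then have "\<delta> * (?c i + ?c j - 2 * X x 0) \<le> w\<^sup>2" using g by simp
        then have "w * (5 * real n * (?c i + ?c j - 2 * X x 0)) \<le> w * w"
          unfolding \<delta>_def by (simp add: power2_eq_square algebra_simps)
        then have "5 * real n * (?c i + ?c j - 2 * X x 0) \<le> w" using w by (simp only: mult_le_cancel_left_pos)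
        then show ?thesis using np by (simp only: pos_le_divide_eq mult.commute)
      qed
      then show ?thesis using f nw unfolding \<delta>_def by (simp add: algebra_simps)
    qed
    \<comment> \<open>The new assignment puts the entering x weakly left of the leaving y. The
      centers that formed \<open>cl t\<close> put y weakly left of x, since otherwise the averages
      of the two clusters would place the center of \<open>?m\<close> weakly left of that of i.
      Hence x and y coincide in position, a null event.\<close>
    have not_both: False if x: "x \<in> moved t" "asg (Suc t) x = i" and y: "y \<in> moved t" "asg t y = i" for x y
    proof -
      have xn: "x < n" "asg t x \<noteq> i" and yn: "y < n" "asg (Suc t) y \<noteq> i" using x y by (auto simp: moved_def)
      let ?j = "asg (Suc t) y" and ?m = "asg t x"
      have "2 * X x 0 \<le> ?c i + ?c ?j" by (rule gained[OF x]) (use y yn in auto)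
      also have "\<dots> \<le> 2 * X y 0" by (rule lost[OF y]) simp
      finally have xy: "X x 0 \<le> X y 0" by simp
      have mS: "?m \<in> ?S" using x by auto
      have iclt: "cl t i \<noteq> {}" "cl t ?m \<noteq> {}" using y yn xn tp by (auto simp: mem_cl)
      let ?ei = "cen s i 0" and ?em = "cen s ?m 0"
      have em: "?ei \<noteq> ?em" using dist_s[OF i(1) mS] xn by auto
      have f: "(?em - ?ei) * (2 * X p 0 - ?ei - ?em) \<le> 0" if "p \<in> cl t i" for p
      proof -
        have "(X p 0 - ?ei)\<^sup>2 \<le> (X p 0 - ?em)\<^sup>2"
          using asg_le[OF Sk[OF mS], of p s] that t unfolding sqd1 by (auto simp: mem_cl)
        then show ?thesis by (simp add: power2_eq_square algebra_simps)
      qed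
      have f': "0 \<le> (?em - ?ei) * (2 * X p 0 - ?ei - ?em)" if "p \<in> cl t ?m" for p
      proof -
        have "(X p 0 - ?em)\<^sup>2 \<le> (X p 0 - ?ei)\<^sup>2"
          using asg_le[OF Sk[OF i(1)], of p s] that t unfolding sqd1 by (auto simp: mem_cl)
        then show ?thesis by (simp add: power2_eq_square algebra_simps)
      qed
      have xm: "x \<in> cl t ?m" and yi: "y \<in> cl t i" using xn yn y tp by (auto simp: mem_cl)
      have "X y 0 \<le> X x 0"
      proof (cases "?ei < ?em")
        case True
        then show ?thesis using f[OF yi] f'[OF xm] by (auto simp: mult_le_0_iff zero_le_mult_iff)
      next
        case False
        then have lt: "?em < ?ei" using em by simp
        let ?h = "(?ei + ?em) / 2"
        have a: "?h \<le> X p 0" if "p \<in> cl t i" for p 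
        proof -
          have "0 \<le> 2 * X p 0 - ?ei - ?em" using f[OF that] lt by (auto simp: mult_le_0_iff)
          then show ?thesis by simp
        qed
        have b: "X p 0 \<le> ?h" if "p \<in> cl t ?m" for p 
        proof -
          have "2 * X p 0 - ?ei - ?em \<le> 0" using f'[OF that] lt by (auto simp: zero_le_mult_iff)
          then show ?thesis by simp
        qed
        have "real (card (cl t i)) * ?h \<le> (\<Sum>p\<in>cl t i. X p 0)" using sum_mono[of "cl t i" "\<lambda>_. ?h" "\<lambda>p. X p 0"] a by simp
        then have "?h \<le> ?c i" using iclt by (simp add: cen_nonempty centroid_def pos_le_divide_eq card_gt_0_iff mult.commute)
        moreover have "(\<Sum>p\<in>cl t ?m. X p 0) \<le> real (card (cl t ?m)) * ?h" using sum_mono[of "cl t ?m" "\<lambda>p. X p 0" "\<lambda>_. ?h"] b by simp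
        then have "?c ?m \<le> ?h" using iclt by (simp add: cen_nonempty centroid_def pos_divide_le_eq card_gt_0_iff mult.commute)
        ultimately show ?thesis using right[OF mS] xn by auto
      qed
      then have "centroid X {x} 0 = centroid X {y} 0" using xy by (simp add: centroid_def)
      moreover have "x \<noteq> y" using x y xn by auto
      ultimately show False using nf xn yn unfolding null_free_def by auto
    qed
    let ?I = "{x \<in> moved t. asg t x = i \<or> asg (Suc t) x = i}"
    have "?I \<noteq> {}" using i(1) by auto
    then obtain x0 where x0: "x0 \<in> ?I" by auto
    have eq: "(\<Sum>p\<in>moved t. tinc t i p * X p 0) - (\<Sum>p\<in>moved t. tinc t i p) * ?c i = (\<Sum>p\<in>?I. tinc t i p * (X p 0 - ?c i))"
    proof -
      have "(\<Sum>p\<in>moved t. tinc t i p * X p 0) - (\<Sum>p\<in>moved t. tinc t i p) * ?c i = (\<Sum>p\<in>moved t. tinc t i p * (X p 0 - ?c i))"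
        by (simp add: sum_distrib_right sum_subtractf right_diff_distrib)
      also have "\<dots> = (\<Sum>p\<in>?I. tinc t i p * (X p 0 - ?c i))"
        by (rule sum.mono_neutral_right) (auto simp: inc_def)
      finally show ?thesis .
    qed
    have sgn: "(\<forall>p\<in>?I. tinc t i p = 1) \<or> (\<forall>p\<in>?I. tinc t i p = -1)"
    proof (cases "\<exists>p\<in>?I. asg t p = i")
      case True
      then have "asg (Suc t) p \<noteq> i" if "p \<in> ?I" for p using that not_both by auto
      then show ?thesis by (intro disjI2) (auto simp: inc_def)
    next
      case False
      then show ?thesis by (intro disjI1) (auto simp: inc_def)
    qed
    have "\<bar>\<Sum>p\<in>?I. tinc t i p * (X p 0 - ?c i)\<bar> = (\<Sum>p\<in>?I. X p 0 - ?c i)"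
    proof -
      have pos: "0 \<le> (\<Sum>p\<in>?I. X p 0 - ?c i)"
      proof (rule sum_nonneg)
        fix p assume "p \<in> ?I"
        then have "?c i + 2 * real n * w \<le> X p 0" using all_right by auto
        moreover have "0 \<le> 2 * real n * w" using w by simp
        ultimately show "0 \<le> X p 0 - ?c i" by linarith
      qed
      show ?thesis using sgn
      proof
        assume "\<forall>p\<in>?I. tinc t i p = 1"
        then have "(\<Sum>p\<in>?I. tinc t i p * (X p 0 - ?c i)) = (\<Sum>p\<in>?I. X p 0 - ?c i)" by (intro sum.cong) auto
        then show ?thesis using pos by simp
      next
        assume "\<forall>p\<in>?I. tinc t i p = -1"
        then have "(\<Sum>p\<in>?I. tinc t i p * (X p 0 - ?c i)) = (\<Sum>p\<in>?I. - (X p 0 - ?c i))" by (intro sum.cong) auto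
        then have "(\<Sum>p\<in>?I. tinc t i p * (X p 0 - ?c i)) = - (\<Sum>p\<in>?I. X p 0 - ?c i)" by (simp only: sum_negf)
        then show ?thesis using pos by simp
      qed
    qed
    moreover have "\<bar>\<Sum>p\<in>?I. tinc t i p * (X p 0 - ?c i)\<bar> \<le> real n * w"
      unfolding eq[symmetric] using cluster_balance[OF dr Sk[OF i(1)] dpos] .
    moreover have "2 * real n * w \<le> (\<Sum>p\<in>?I. X p 0 - ?c i)"
    proof -
      have "2 * real n * w \<le> X x0 0 - ?c i" using all_right[of x0] x0 by auto
      also have "\<dots> \<le> (\<Sum>p\<in>?I. X p 0 - ?c i)"
      proof (rule member_le_sum[OF x0])
        fix p assume "p \<in> ?I - {x0}"
        then have "?c i + 2 * real n * w \<le> X p 0" using all_right by auto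
        moreover have "0 \<le> 2 * real n * w" using w by simp
        ultimately show "0 \<le> X p 0 - ?c i" by linarith
      qed auto
      finally show ?thesis .
    qed
    moreover have "0 < real n * w" using w npos by simp
    ultimately show False by linarith
  qed
  then obtain x where x: "x \<in> moved t" and close: "(?c (asg t x) - ?c (asg (Suc t) x))\<^sup>2 \<le> \<delta>\<^sup>2" by blast
  let ?a = "asg t x" and ?b = "asg (Suc t) x"
  have ab: "?a \<in> ?S" "?b \<in> ?S" "?a \<noteq> ?b" "x < n" using x by (auto simp: moved_def)
  have xa: "x \<in> cl t ?a" using ab tp by (auto simp: mem_cl)
  \<comment> \<open>This provides the second point y, which does not follow x. A third point in the
    old cluster would create another close pair.\<close>
  have nall: "\<not> cl t ?a \<subseteq> cl (Suc t) ?b"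
    using not_all_move[OF nf Sk[OF ab(1)] Sk[OF ab(2)] ab(3)] xa lastS(2)[OF ab(2)] by blast
  then obtain y where y: "y \<in> cl t ?a" "y \<notin> cl (Suc t) ?b" by auto
  have xy: "x \<noteq> y" "y < n" using y ab by (auto simp: mem_cl moved_def cl_def split: if_splits)
  obtain u b l0 where ub: "l0 < d" "u l0 = (1::real)" "\<And>p. p \<in> cl t ?a \<Longrightarrow> \<bar>(\<Sum>l<d. u l * X p l) - b\<bar> \<le> real n * real d * \<delta>"
  proof -
    have ne: "cl (Suc s) ?a \<noteq> {}" using xa t by auto
    have c: "sqdist d (cen (Suc s) ?a) (cen (Suc s) ?b) \<le> \<delta>\<^sup>2" using close unfolding sqd1 t .
    show ?thesis
      using close_centers_slab[OF Sk[OF ab(1)] Sk[OF ab(2)] ab(3) ne dist_s[OF ab(1,2,3)] less_imp_le[OF \<delta>] c] that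
      unfolding t by blast
  qed
  have ub': "\<bar>X p 0 - b\<bar> \<le> real n * \<delta>" if "p \<in> cl t ?a" for p
    using ub(3)[OF that] ub(1,2) unfolding d1 by (simp add: lessThan_Suc)
  have near: "\<bar>X p 0 - X q 0\<bar> \<le> 10 * real n ^ 2 * w" if "p \<in> cl t ?a" "q \<in> cl t ?a" for p q
    using ub'[OF that(1)] ub'[OF that(2)] unfolding \<delta>_def power2_eq_square by (simp add: algebra_simps abs_le_iff)
  have "cl t ?a = {x, y}"
  proof (rule ccontr)
    assume "cl t ?a \<noteq> {x, y}"
    then obtain z where z: "z \<in> cl t ?a" "z \<noteq> x" "z \<noteq> y" using xa y by auto
    have "z < n" using z cl_sub by blast
    then have "two_relations n 1 1 (10 * real n ^ 2 * w) X"
      using ab xy z by (intro two_close_pairs[of x n y x z] near xa y) (auto simp: doubleton_eq_iff)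
    then show False using norel by simp
  qed
  moreover have "x \<in> cl (Suc t) ?b" using ab(4) by (simp add: mem_cl)
  ultimately show ?thesis using ab(4) xy near[OF xa y(1)] y(2) by blast
qed

text \<open>Each of the two iterations exhibits a cluster consisting of a close pair. Only one close
  pair can exist, so both pairs agree, yet the first iteration has just separated it.\<close>

lemma window_1d:
  assumes "\<And>i. i < k \<Longrightarrow> last_cl (s + 3) i \<noteq> {} \<Longrightarrow> last_cl s i \<noteq> {}"
    and "\<not> same_centers (s + 2) (s + 1)" "\<not> same_centers (s + 3) (s + 2)"
  shows "w\<^sup>2 < pot (s + 1) - pot (s + 3)"
proof (rule ccontr)
  assume h: "\<not> ?thesis"
  have e: "s + 1 = Suc s" "s + 2 = Suc (Suc s)" "s + 3 = Suc (Suc (Suc s))" by auto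
  have drop: "pot (Suc s) - pot (Suc (Suc s)) \<le> w\<^sup>2" "pot (Suc (Suc s)) - pot (Suc (Suc (Suc s))) \<le> w\<^sup>2"
    using h pot_Suc_le[of "Suc s"] pot_Suc_le[of "Suc (Suc s)"] unfolding e by linarith+
  have m: "last_cl (s + 2) i \<noteq> {} \<Longrightarrow> last_cl (s + 3) i \<noteq> {}" "last_cl s i \<noteq> {} \<Longrightarrow> last_cl (Suc s) i \<noteq> {}" for i
    using last_cl_mono[of "s + 2" "s + 3" i] last_cl_mono[of s "Suc s" i] by auto
  obtain x y a b where A: "x < n" "y < n" "x \<noteq> y" "\<bar>X x 0 - X y 0\<bar> \<le> 10 * real n ^ 2 * w" "cl (Suc s) a = {x, y}"
      "x \<in> cl (Suc (Suc s)) b" "y \<notin> cl (Suc (Suc s)) b"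
    using iteration_1d[OF refl drop(1)] assms m unfolding e by blast
  obtain x' y' a' where B: "x' < n" "y' < n" "x' \<noteq> y'" "\<bar>X x' 0 - X y' 0\<bar> \<le> 10 * real n ^ 2 * w"
      "cl (Suc (Suc s)) a' = {x', y'}"
    using iteration_1d[OF refl drop(2)] assms m unfolding e by blast
  have "{x, y} = {x', y'}" using two_close_pairs[of x n y x' y' X _ 1] A B norel by blast
  then have "cl (Suc (Suc s)) a' = {x, y}" using B by simp
  then have "x \<in> cl (Suc (Suc s)) a'" "y \<in> cl (Suc (Suc s)) a'" by auto
  then show False using A by (auto simp: mem_cl)
qed

end
end

section \<open>Windows in which every cluster takes at most two values\<close>

text \<open>At time s the token sits at b s and moves to the position that is best for the distances D s;
  the distance of a position only depends on whether the token is there. The token then only ever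
  alternates between the two positions that are best when unoccupied.\<close>
lemma token_two_periodic:
  fixes b :: "nat \<Rightarrow> nat" and D :: "nat \<Rightarrow> nat \<Rightarrow> real"
  assumes best: "\<And>s j. s \<le> 3 \<Longrightarrow> j \<in> b ` {..4} \<Longrightarrow> D s (b (Suc s)) < D s j \<or> (D s (b (Suc s)) = D s j \<and> b (Suc s) \<le> j)"
    and dep: "\<And>s s' j. s \<le> 3 \<Longrightarrow> s' \<le> 3 \<Longrightarrow> j \<in> b ` {..4} \<Longrightarrow> (b s = j \<longleftrightarrow> b s' = j) \<Longrightarrow> D s j = D s' j"
  shows "b 4 = b 2"
proof -
  define lt where "lt s i j \<longleftrightarrow> D s i < D s j \<or> (D s i = D s j \<and> i < j)" for s i j
  have asym: False if "lt s i j" "lt s j i" for s i j using that unfolding lt_def by auto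
  have mem: "b 0 \<in> b ` {..4}" "b 1 \<in> b ` {..4}" "b 2 \<in> b ` {..4}" "b 3 \<in> b ` {..4}" "b 4 \<in> b ` {..4}" by auto
  have cmp: "lt s (b (Suc s)) j" if "s \<le> 3" "j \<in> b ` {..4}" "j \<noteq> b (Suc s)" for s j
    using best[OF that(1,2)] that(3) unfolding lt_def by auto
  have det: "b (Suc s) = b (Suc s')" if "s \<le> 3" "s' \<le> 3" "b s = b s'" for s s'
  proof -
    have m: "b (Suc s) \<in> b ` {..4}" "b (Suc s') \<in> b ` {..4}" using that by auto
    have "D s j = D s' j" if "j \<in> b ` {..4}" for j using dep[of s s' j] that \<open>s \<le> 3\<close> \<open>s' \<le> 3\<close> \<open>b s = b s'\<close> by simp
    then show ?thesis using best[OF that(1) m(2)] best[OF that(2) m(1)] m by force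
  qed
  have d: "b 0 = b 1 \<Longrightarrow> b 1 = b 2" "b 1 = b 2 \<Longrightarrow> b 2 = b 3" "b 2 = b 3 \<Longrightarrow> b 3 = b 4" "b 3 = b 1 \<Longrightarrow> b 4 = b 2"
    using det[of 0 1] det[of 1 2] det[of 2 3] det[of 3 1] by (simp_all add: eval_nat_numeral)
  show ?thesis
  proof (cases "b 0 = b 1 \<or> b 1 = b 2 \<or> b 2 = b 3 \<or> b 3 = b 1")
    case True then show ?thesis using d by auto
  next
    case False
    then have ne: "b 0 \<noteq> b 1" "b 1 \<noteq> b 2" "b 2 \<noteq> b 3" "b 3 \<noteq> b 1" by auto
    have l2: "lt 2 (b 3) (b 1)" using cmp[of 2 "b 1"] mem ne by (simp add: eval_nat_numeral)
    have False
    proof (cases "b 3 = b 0")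
      \<comment> \<open>Times 0 and 2 both compare the unoccupied positions \<open>b 1\<close> and
        \<open>b 3\<close>, and decide differently.\<close>
      case False
      have l0: "lt 0 (b 1) (b 3)" using cmp[of 0 "b 3"] mem ne by simp
      have "D 0 (b 1) = D 2 (b 1)" "D 0 (b 3) = D 2 (b 3)"
        using dep[of 0 2, OF _ _ mem(2)] dep[of 0 2, OF _ _ mem(4)] ne False by simp_all
      then have "lt 0 (b 3) (b 1)" using l2 unfolding lt_def by simp
      then show False using l0 by (rule asym)
    next
      \<comment> \<open>Unoccupied positions would be ranked cyclically: \<open>b 1\<close> before
        \<open>b 2\<close> at time 0, \<open>b 2\<close> before \<open>b 0\<close> at time 1,
        \<open>b 0\<close> before \<open>b 1\<close> at time 2.\<close>
      case True
      have a: "lt 1 (b 2) (b 0)" using cmp[of 1 "b 0"] mem ne True by (simp add: eval_nat_numeral)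
      have c: "lt 0 (b 1) (b 2)" using cmp[of 0 "b 2"] mem ne by simp
      have e: "D 0 (b 1) = D 2 (b 1)" "D 0 (b 2) = D 1 (b 2)" "D 1 (b 0) = D 2 (b 0)"
        using dep[of 0 2, OF _ _ mem(2)] dep[of 0 1, OF _ _ mem(3)] dep[of 1 2, OF _ _ mem(1)] ne True by simp_all
      have v: "D 1 (b 2) < D 2 (b 0) \<or> (D 1 (b 2) = D 2 (b 0) \<and> b 2 < b 0)"
        "D 2 (b 1) < D 1 (b 2) \<or> (D 2 (b 1) = D 1 (b 2) \<and> b 1 < b 2)"
        "D 2 (b 0) < D 2 (b 1) \<or> (D 2 (b 0) = D 2 (b 1) \<and> b 0 < b 1)"
        using a c l2 unfolding lt_def e True by simp_all
      then show False by linarith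
    qed
    then show ?thesis ..
  qed
qed

context kmeans begin

text \<open>Each point is a token among the clusters. If it moves at all, every cluster it visits
  takes one value with it and one without it, which are A and B; so its membership determines the
  value and, through \<open>det\<close>, the center, as \<open>token_two_periodic\<close>
  demands.\<close>

lemma stretch_repeats:
  assumes u: "0 < u"
    and two: "\<And>i. i < k \<Longrightarrow> \<exists>A B. \<forall>t\<in>{u..u+4}. cl t i = A \<or> cl t i = B"
    and det: "\<And>i t t'. i < k \<Longrightarrow> t \<in> {u..u+4} \<Longrightarrow> t' \<in> {u..u+4} \<Longrightarrow> cl t i = cl t' i \<Longrightarrow> cen t i = cen t' i"
  shows "pot (u + 4) = pot (u + 2)"
proof -
  have asg: "asg (u + 4) p = asg (u + 2) p" if p: "p < n" for p
  proof -
    define b where "b s = asg (u + s) p" for s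
    define D where "D s j = sqdist d (X p) (cen (u + s) j)" for s j
    have bk: "j < k" if "j \<in> b ` {..4}" for j using that unfolding b_def by (auto simp: asg_lt)
    show ?thesis
    proof (cases "\<forall>s\<le>4. b s = b 0")
      case True
      have "b 4 = b 0" using True[rule_format, of 4] by simp
      moreover have "b 2 = b 0" using True[rule_format, of 2] by simp
      ultimately show ?thesis unfolding b_def by simp
    next
      case False
      have eqcl: "cl (u + s) j = cl (u + s') j"
        if s: "s \<le> 3" "s' \<le> 3" and j: "j \<in> b ` {..4}" and iff: "b s = j \<longleftrightarrow> b s' = j" for s s' j
      proof -
        obtain A B where AB: "\<forall>t\<in>{u..u+4}. cl t j = A \<or> cl t j = B" using two[OF bk[OF j]] by blast
        have pin: "p \<in> cl (u + r) j \<longleftrightarrow> b r = j" for r using u p unfolding b_def by (simp add: mem_cl)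
        obtain r where r: "r \<le> 4" "b r = j" using j by auto
        have "\<exists>r'\<le>4. b r' \<noteq> j"
        proof (rule ccontr)
          assume h: "\<not> ?thesis"
          then have all: "b s = j" if "s \<le> 4" for s using that by blast
          have "\<forall>s\<le>4. b s = b 0" by (simp add: all)
          then show False using False by blast
        qed
        then obtain r' where r': "r' \<le> 4" "b r' \<noteq> j" by blast
        have "cl (u + r) j = A \<or> cl (u + r) j = B" "cl (u + r') j = A \<or> cl (u + r') j = B"
          "cl (u + s) j = A \<or> cl (u + s) j = B" "cl (u + s') j = A \<or> cl (u + s') j = B"
          using AB r r' s by auto
        then show ?thesis using pin[of r] pin[of r'] pin[of s] pin[of s'] r r' iff by metis
      qed
      have "b 4 = b 2"
      proof (rule token_two_periodic[of b D])
        fix s j assume sj: "s \<le> (3::nat)" "j \<in> b ` {..4}"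
        show "D s (b (Suc s)) < D s j \<or> (D s (b (Suc s)) = D s j \<and> b (Suc s) \<le> j)"
          using asg_le[OF bk[OF sj(2)], of p "u + s"] asg_tie[OF bk[OF sj(2)], where p=p and t="u + s"]
          unfolding D_def b_def by force
      next
        fix s s' j assume h: "s \<le> (3::nat)" "s' \<le> (3::nat)" "j \<in> b ` {..4}" "b s = j \<longleftrightarrow> b s' = j"
        show "D s j = D s' j" unfolding D_def
          using det[OF bk[OF h(3)] _ _ eqcl[OF h]] h(1,2) by simp
      qed
      then show ?thesis unfolding b_def .
    qed
  qed
  have cl: "cl (u + 4) i = cl (u + 2) i" for i using asg unfolding cl_def by auto
  have "cen (u + 4) i = cen (u + 2) i" if "i < k" for i using det[OF that _ _ cl] by simp
  then show ?thesis unfolding pot_def using asg by (intro sum.cong) (auto simp: asg_lt)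
qed

text \<open>A cluster that is empty from the start of the epoch holds an older center, so being
  empty before and after its first filling may mean different centers. Each cluster is filled for
  the first time only once; hence one of k + 1 disjoint blocks of five times contains no such event,
  and there the hypothesis \<open>det\<close> of \<open>stretch_repeats\<close> holds.\<close>

lemma no_long_epoch:
  assumes t0: "0 < t0"
    and two: "\<And>i. i < k \<Longrightarrow> \<exists>A B. \<forall>t\<in>{t0..t0 + 5 * (k + 1)}. cl t i = A \<or> cl t i = B"
  shows "\<exists>u. t0 \<le> u \<and> u + 4 \<le> t0 + 5 * (k + 1) \<and> pot (u + 4) = pot (u + 2)"
proof -
  define rev where "rev i t \<longleftrightarrow> t0 < t \<and> cl t i \<noteq> {} \<and> (\<forall>s. t0 \<le> s \<and> s < t \<longrightarrow> cl s i = {})" for i t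
  have rev1: "rev i t \<Longrightarrow> rev i t' \<Longrightarrow> t = t'" for i t t'
    unfolding rev_def by (metis less_imp_le linorder_neqE_nat)
  have "\<exists>m\<le>k. \<forall>i<k. \<forall>t. t0 + 5 * m < t \<and> t \<le> t0 + 5 * m + 4 \<longrightarrow> \<not> rev i t"
  proof (rule ccontr)
    assume "\<not> ?thesis"
    then have "\<forall>m\<in>{..k}. \<exists>i t. i < k \<and> t0 + 5 * m < t \<and> t \<le> t0 + 5 * m + 4 \<and> rev i t" by fastforce
    then obtain f where f: "\<And>m. m \<le> k \<Longrightarrow> f m < k \<and> (\<exists>t. t0 + 5 * m < t \<and> t \<le> t0 + 5 * m + 4 \<and> rev (f m) t)"
      unfolding Ball_def atMost_iff by metis
    have "inj_on f {..k}"
    proof (rule inj_onI)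
      fix m m' assume m: "m \<in> {..k}" "m' \<in> {..k}" "f m = f m'"
      obtain t where t: "t0 + 5 * m < t" "t \<le> t0 + 5 * m + 4" "rev (f m) t" using f[of m] m by auto
      obtain t' where t': "t0 + 5 * m' < t'" "t' \<le> t0 + 5 * m' + 4" "rev (f m') t'" using f[of m'] m by auto
      have "t = t'" using rev1 t(3) t'(3) m(3) by simp
      then show "m = m'" using t t' by linarith
    qed
    moreover have "f ` {..k} \<subseteq> {..<k}" using f by auto
    ultimately have "card {..k} \<le> card {..<k}" by (intro card_inj_on_le) auto
    then show False by simp
  qed
  then obtain m where m: "m \<le> k" "\<And>i t. i < k \<Longrightarrow> t0 + 5 * m < t \<Longrightarrow> t \<le> t0 + 5 * m + 4 \<Longrightarrow> \<not> rev i t" by blast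
  define u where "u = t0 + 5 * m"
  have u: "t0 \<le> u" "u + 4 \<le> t0 + 5 * (k + 1)" using m(1) unfolding u_def by auto
  have stale: "cen t i = cen s i" if "s \<le> t" "\<And>r. s < r \<Longrightarrow> r \<le> t \<Longrightarrow> cl r i = {} \<or> cen s i = centroid X (cl r i)" for s t i
    using that
  proof (induction rule: dec_induct)
    case (step r)
    then have "cen r i = cen s i" by auto
    then show ?case using step(4)[of "Suc r"] step(1) by (auto simp: cen_Suc)
  qed simp
  have det: "cen t i = cen t' i" if i: "i < k" and tt: "t \<in> {u..u+4}" "t' \<in> {u..u+4}" and eq: "cl t i = cl t' i" for i t t'
  proof (cases "cl t i = {}")
    case False
    then show ?thesis using eq by (simp add: cen_nonempty)
  next
    case e: True
    show ?thesis
    proof (cases "\<exists>s. t0 \<le> s \<and> s \<le> u + 4 \<and> cl s i \<noteq> {}")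
      case False
      have "cen r i = cen t0 i" if "t0 \<le> r" "r \<le> u + 4" for r
        by (rule stale[OF that(1)]) (use False that in auto)
      from this[of t] this[of t'] show ?thesis using tt u by simp
    next
      case True
      define s where "s = (LEAST s. t0 \<le> s \<and> s \<le> u + 4 \<and> cl s i \<noteq> {})"
      have s: "t0 \<le> s" "s \<le> u + 4" "cl s i \<noteq> {}" using LeastI_ex[OF True] unfolding s_def by auto
      have before: "cl r i = {}" if "t0 \<le> r" "r < s" for r
        using not_less_Least[of r "\<lambda>s. t0 \<le> s \<and> s \<le> u + 4 \<and> cl s i \<noteq> {}"] that s(2) unfolding s_def by auto
      have "s \<le> u"
      proof (rule ccontr)
        assume "\<not> s \<le> u"
        then have "rev i s" unfolding rev_def using s u before by auto
        then show False using m(2)[OF i, of s] \<open>\<not> s \<le> u\<close> s(2) unfolding u_def by simp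
      qed
      obtain A B where AB: "\<forall>t\<in>{t0..t0 + 5 * (k + 1)}. cl t i = A \<or> cl t i = B" using two[OF i] by blast
      \<comment> \<open>One of the two values is empty, so every nonempty value from s on is
        \<open>cl s i\<close>, and its centroid stays the center also while the cluster is
        empty.\<close>
      have bs: "cl r i = {} \<or> cl r i = cl s i" if "s \<le> r" "r \<le> u + 4" for r
      proof -
        have "cl r i = A \<or> cl r i = B" "cl s i = A \<or> cl s i = B" "cl t i = A \<or> cl t i = B"
          using AB that s u tt by auto
        then show ?thesis using e s(3) by metis
      qed
      have "cen r i = cen s i" if "s \<le> r" "r \<le> u + 4" for r
      proof (rule stale[OF that(1)])
        fix r' assume "s < r'" "r' \<le> r"
        then show "cl r' i = {} \<or> cen s i = centroid X (cl r' i)" using bs[of r'] that s(3) by (auto simp: cen_nonempty)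
      qed
      from this[of t] this[of t'] show ?thesis using tt \<open>s \<le> u\<close> by simp
    qed
  qed
  have "pot (u + 4) = pot (u + 2)"
  proof (rule stretch_repeats)
    show "0 < u" using t0 u by simp
    show "\<exists>A B. \<forall>t\<in>{u..u+4}. cl t i = A \<or> cl t i = B" if "i < k" for i
      using two[OF that] u by (meson atLeastAtMost_iff order_trans)
  qed (rule det)
  then show ?thesis using u by blast
qed

end

section \<open>Iterations in which every cluster exchanges few points\<close>

context kmeans begin

definition deg :: "nat \<Rightarrow> nat \<Rightarrow> nat" where
  "deg t j = card {p \<in> moved t. asg t p = j \<or> asg (Suc t) p = j}"

definition chg :: "nat \<Rightarrow> nat \<Rightarrow> nat \<Rightarrow> real" where
  "chg t j p = indicat_real (cl (Suc t) j) p - indicat_real (cl t j) p"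

definition bal :: "nat \<Rightarrow> nat \<Rightarrow> int" where
  "bal t j = int (card (cl (Suc t) j)) - int (card (cl t j))"

lemma chg_GL: "chg t j p = indicat_real (cl (Suc t) j - cl t j) p - indicat_real (cl t j - cl (Suc t) j) p"
  unfolding chg_def by (auto simp: indicator_def)

lemma card_GL:
  assumes "0 < t"
  shows "card (cl (Suc t) j - cl t j) \<le> deg t j" "card (cl t j - cl (Suc t) j) \<le> deg t j"
  unfolding deg_def using assms by (auto intro!: card_mono simp: mem_cl moved_def)

lemma lin_chg: "0 < t \<Longrightarrow> lin n X (chg t j) l = (\<Sum>p\<in>moved t. tinc t j p * X p l)"
  unfolding sum_moved lin_def chg_def
  by (simp add: left_diff_distrib sum_subtractf sum_indicator_subset[OF cl_sub])

lemma bal_sum: "0 < t \<Longrightarrow> (\<Sum>p\<in>moved t. tinc t j p) = real_of_int (bal t j)"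
  unfolding sum_moved_1 bal_def by simp

lemma bal_le: "\<bar>bal t j\<bar> \<le> int n"
  using cl_card[of t j] cl_card[of "Suc t" j] unfolding bal_def by linarith

lemma deg_pos_iff: "0 < t \<Longrightarrow> 0 < deg t j \<longleftrightarrow> cl (Suc t) j \<noteq> cl t j"
proof -
  assume t: "0 < t"
  have "0 < deg t j \<longleftrightarrow> {p \<in> moved t. asg t p = j \<or> asg (Suc t) p = j} \<noteq> {}"
    unfolding deg_def by (subst card_gt_0_iff) auto
  also have "\<dots> \<longleftrightarrow> cl (Suc t) j \<noteq> cl t j"
  proof -
    have "p \<in> cl (Suc t) j \<longleftrightarrow> p < n \<and> asg (Suc t) p = j" "p \<in> cl t j \<longleftrightarrow> p < n \<and> asg t p = j" for p
      using t by (simp_all add: mem_cl)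
    note m = this
    show ?thesis
    proof
      assume "{p \<in> moved t. asg t p = j \<or> asg (Suc t) p = j} \<noteq> {}"
      then obtain p where "p < n" "asg t p \<noteq> asg (Suc t) p" "asg t p = j \<or> asg (Suc t) p = j" unfolding moved_def by blast
      then have "p \<in> cl (Suc t) j \<longleftrightarrow> p \<notin> cl t j" by (auto simp: m)
      then show "cl (Suc t) j \<noteq> cl t j" by blast
    next
      assume "cl (Suc t) j \<noteq> cl t j"
      then obtain p where "p \<in> cl (Suc t) j \<longleftrightarrow> p \<notin> cl t j" by blast
      then have "p \<in> {p \<in> moved t. asg t p = j \<or> asg (Suc t) p = j}" unfolding moved_def by (auto simp: m)
      then show "{p \<in> moved t. asg t p = j \<or> asg (Suc t) p = j} \<noteq> {}" by blast
    qed
  qed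
  finally show ?thesis .
qed

lemma chg_nonzero: "0 < t \<Longrightarrow> 0 < deg t j \<Longrightarrow> \<exists>p<n. chg t j p \<noteq> 0"
proof -
  assume t: "0 < t" and "0 < deg t j"
  then have "cl (Suc t) j \<noteq> cl t j" by (simp add: deg_pos_iff)
  then obtain p where p: "p \<in> cl (Suc t) j \<longleftrightarrow> p \<notin> cl t j" by blast
  then have "p < n" using cl_sub[of t j] cl_sub[of "Suc t" j] by auto
  moreover have "chg t j p \<noteq> 0" using p unfolding chg_def by (auto simp: indicator_def)
  ultimately show ?thesis by blast
qed

context
  fixes w :: real and R :: nat
  assumes w: "0 < w" and norel1: "\<not> one_relation n d R (20 * real n ^ 2 * w) X"
begin

lemma nw_le: "real n * w \<le> real n ^ 2 * w"
  using npos w by (simp add: power2_eq_square)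

lemma nw20: "12 * (real n * w) \<le> 20 * real n ^ 2 * w" "0 \<le> real n * w"
proof -
  show "0 \<le> real n * w" using w by simp
  then show "12 * (real n * w) \<le> 20 * real n ^ 2 * w" using nw_le by linarith
qed

text \<open>Without a change of size the center drops out of the balance, and the exchanged points
  alone satisfy a relation. The second quotient of \<open>svec\<close> is filled with empty
  sets.\<close>

lemma light_unbalanced:
  assumes t: "0 < t" and drop: "pot t - pot (Suc t) \<le> w\<^sup>2" and j: "j < k" "deg t j \<le> R" "0 < deg t j"
  shows "bal t j \<noteq> 0"
proof
  assume b: "bal t j = 0"
  have "(\<lambda>p. (indicat_real (cl (Suc t) j - cl t j) p - indicat_real (cl t j - cl (Suc t) j) p) / real_of_int 1
        - (indicat_real {} p - indicat_real {} p) / real_of_int 1) \<in> svec n R"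
    using card_GL[OF t, of j] j npos subsetD[OF cl_sub] by (intro svecI) auto
  then have m: "chg t j \<in> svec n R" by (simp add: chg_GL[abs_def])
  have "\<bar>lin n X (chg t j) l\<bar> \<le> 20 * real n ^ 2 * w" if "l < d" for l
  proof -
    have "\<bar>lin n X (chg t j) l\<bar> \<le> real n * w"
      using cluster_balance[OF less_imp_le[OF w] drop t j(1) that] b unfolding lin_chg[OF t] bal_sum[OF t] by simp
    then show ?thesis using nw20 by linarith
  qed
  then show False using norel1 m chg_nonzero[OF t j(3)] unfolding one_relation_def by blast
qed

text \<open>At both times the center is approximately the signed sum of the exchanged points divided
  by the change of size. As the centers are near, the difference of the quotients is a small
  relation and therefore the zero vector; proportional vectors with entries in {-1, 0, 1} are equal
  or opposite.\<close>

lemma light_toggle: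
  assumes t: "0 < t" and drop: "pot t - pot (Suc t) \<le> w\<^sup>2" and j: "j < k" "deg t j \<le> R" "0 < deg t j"
    and t': "0 < t'" and drop': "pot t' - pot (Suc t') \<le> w\<^sup>2" and j': "deg t' j \<le> R" "0 < deg t' j"
    and near: "\<And>l. l < d \<Longrightarrow> \<bar>cen t j l - cen t' j l\<bar> \<le> 10 * real n * w"
  shows "(\<forall>p<n. chg t j p = chg t' j p) \<or> (\<forall>p<n. chg t j p = - chg t' j p)"
proof -
  note nz = light_unbalanced[OF t drop j] light_unbalanced[OF t' drop' j(1) j']
  let ?b = "real_of_int (bal t j)" and ?b' = "real_of_int (bal t' j)"
  define v where "v p = chg t j p / ?b - chg t' j p / ?b'" for p
  have m: "v \<in> svec n R"
  proof -
    have "(\<lambda>p. (indicat_real (cl (Suc t) j - cl t j) p - indicat_real (cl t j - cl (Suc t) j) p) / real_of_int (bal t j)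
        - (indicat_real (cl (Suc t') j - cl t' j) p - indicat_real (cl t' j - cl (Suc t') j) p) / real_of_int (bal t' j)) \<in> svec n R"
      using card_GL[OF t, of j] card_GL[OF t', of j] j j' nz bal_le subsetD[OF cl_sub] by (intro svecI) auto
    then show ?thesis unfolding v_def[abs_def] chg_GL .
  qed
  have each: "\<bar>lin n X (chg t j) l / real_of_int (bal t j) - cen t j l\<bar> \<le> real n * w"
    if h: "0 < t" "pot t - pot (Suc t) \<le> w\<^sup>2" "bal t j \<noteq> 0" and l: "l < d" for t l
  proof -
    have "\<bar>lin n X (chg t j) l - real_of_int (bal t j) * cen t j l\<bar> \<le> real n * w"
      using cluster_balance[OF less_imp_le[OF w] h(2,1) j(1) l] unfolding lin_chg[OF h(1)] bal_sum[OF h(1)] .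
    moreover have "\<bar>lin n X (chg t j) l / real_of_int (bal t j) - cen t j l\<bar>
       = \<bar>lin n X (chg t j) l - real_of_int (bal t j) * cen t j l\<bar> / \<bar>real_of_int (bal t j)\<bar>"
      using h(3) by (simp add: field_simps flip: abs_divide)
    moreover have "1 \<le> \<bar>real_of_int (bal t j)\<bar>" using h(3) by linarith
    ultimately show ?thesis by (smt (verit) divide_le_eq_1 divide_left_mono div_by_1 abs_ge_zero mult_pos_pos)
  qed
  have "\<bar>lin n X v l\<bar> \<le> 20 * real n ^ 2 * w" if l: "l < d" for l
  proof -
    have "lin n X v l = lin n X (chg t j) l / ?b - lin n X (chg t' j) l / ?b'"
      unfolding lin_def v_def by (simp add: left_diff_distrib sum_subtractf sum_divide_distrib)
    then show ?thesis
      using each[OF t drop nz(1) l] each[OF t' drop' nz(2) l] near[OF l] nw20 by linarith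
  qed
  then have v0: "v p = 0" if "p < n" for p using norel1 m that unfolding one_relation_def by blast
  have e: "chg t j p * ?b' = chg t' j p * ?b" if "p < n" for p
    using v0[OF that] nz unfolding v_def by (simp add: field_simps)
  obtain p0 where p0: "p0 < n" "chg t j p0 \<noteq> 0" using chg_nonzero[OF t j(3)] by blast
  have "chg t' j p0 \<noteq> 0" using e[OF p0(1)] p0(2) nz by auto
  then have ab: "\<bar>chg t j p0\<bar> = 1" "\<bar>chg t' j p0\<bar> = 1" using p0(2) unfolding chg_def by (auto simp: indicator_def)
  have "\<bar>chg t j p0\<bar> * \<bar>?b'\<bar> = \<bar>chg t' j p0\<bar> * \<bar>?b\<bar>" using e[OF p0(1)] by (metis abs_mult)
  then have "\<bar>?b'\<bar> = \<bar>?b\<bar>" unfolding ab by simp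
  then have "?b' = ?b \<or> ?b' = - ?b" by (simp add: abs_eq_iff)
  then show ?thesis
  proof
    assume "?b' = ?b"
    then have "chg t j p = chg t' j p" if "p < n" for p using e[OF that] nz by simp
    then show ?thesis by blast
  next
    assume b: "?b' = - ?b"
    then have "chg t j p = - chg t' j p" if "p < n" for p
      
    proof -
      have "(chg t j p + chg t' j p) * ?b = 0" using e[OF that] unfolding b by (simp add: algebra_simps)
      then show ?thesis using nz(1) by simp
    qed
    then show ?thesis by blast
  qed
qed

lemma drift:
  assumes "t \<le> t'" "\<And>s. t \<le> s \<Longrightarrow> s < t' \<Longrightarrow> pot s - pot (Suc s) \<le> w\<^sup>2" "0 < t" "i < k" "l < d"
  shows "\<bar>cen t' i l - cen t i l\<bar> \<le> real (t' - t) * w"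
  using assms
proof (induction rule: dec_induct)
  case (step r)
  have "\<bar>cen (Suc r) i l - cen r i l\<bar> \<le> w"
    using step by (intro small_move_coord[OF less_imp_le[OF w]]) auto
  moreover have "\<bar>cen r i l - cen t i l\<bar> \<le> real (r - t) * w" using step by auto
  moreover have "real (Suc r - t) * w = real (r - t) * w + w" using step by (simp add: Suc_diff_le algebra_simps)
  ultimately show ?case by linarith
qed simp

lemma all_light_window:
  assumes t0: "0 < t0" and L: "L = 5 * (k + 1)" and drop: "pot t0 - pot (t0 + L) \<le> w\<^sup>2"
    and light: "\<And>t j. t0 \<le> t \<Longrightarrow> t < t0 + L \<Longrightarrow> j < k \<Longrightarrow> deg t j \<le> R"
    and strict: "\<And>t. t0 \<le> t \<Longrightarrow> t < t0 + L \<Longrightarrow> pot (Suc t) < pot t"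
  shows False
proof -
  have drops: "pot t - pot (Suc t) \<le> w\<^sup>2" if "t0 \<le> t" "t < t0 + L" for t
    using pot_mono[of t0 t] pot_mono[of "Suc t" "t0 + L"] drop that by simp
  \<comment> \<open>The window has length 5 (k + 1) \<le> 10 n, and each iteration moves a
    coordinate of a center by at most w.\<close>
  have near: "\<bar>cen t j l - cen t' j l\<bar> \<le> 10 * real n * w"
    if tt: "t0 \<le> t" "t \<le> t0 + L" "t0 \<le> t'" "t' \<le> t0 + L" and jl: "j < k" "l < d" for t t' j l
  proof -
    have *: "\<bar>cen b j l - cen a j l\<bar> \<le> 10 * real n * w" if "t0 \<le> a" "a \<le> b" "b \<le> t0 + L" for a b
    proof -
      have "\<bar>cen b j l - cen a j l\<bar> \<le> real (b - a) * w"
        using that t0 jl by (intro drift drops) auto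
      also have "real (b - a) \<le> real L" using that by simp
      then have "real (b - a) * w \<le> real L * w" using w by (intro mult_right_mono) auto
      also have "real L \<le> 10 * real n" using kn npos unfolding L by simp
      then have "real L * w \<le> 10 * real n * w" using w by (intro mult_right_mono) auto
      finally show ?thesis .
    qed
    show ?thesis using *[of t t'] *[of t' t] tt by (cases "t \<le> t'") (auto simp: abs_minus_commute)
  qed
  have "\<exists>A B. \<forall>t\<in>{t0..t0 + L}. cl t j = A \<or> cl t j = B" if j: "j < k" for j
  proof (cases "\<exists>t. t0 \<le> t \<and> t < t0 + L \<and> cl (Suc t) j \<noteq> cl t j")
    case False
    have c: "cl t j = cl t0 j" if "t0 \<le> t" "t \<le> t0 + L" for t
      using that
    proof (induction rule: dec_induct)
      case (step r)
      then have "cl (Suc r) j = cl r j" using False by (metis Suc_le_lessD)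
      then show ?case using step by simp
    qed simp
    have "cl t j = cl t0 j \<or> cl t j = cl t0 j" if "t \<in> {t0..t0 + L}" for t
      using c[of t] that by simp
    then show ?thesis by blast
  next
    case True
    define t1 where "t1 = (LEAST t. t0 \<le> t \<and> t < t0 + L \<and> cl (Suc t) j \<noteq> cl t j)"
    have t1: "t0 \<le> t1" "t1 < t0 + L" "cl (Suc t1) j \<noteq> cl t1 j" using LeastI_ex[OF True] unfolding t1_def by auto
    have before: "cl (Suc t) j = cl t j" if "t0 \<le> t" "t < t1" for t
      using not_less_Least[of t "\<lambda>t. t0 \<le> t \<and> t < t0 + L \<and> cl (Suc t) j \<noteq> cl t j"] that t1(2) unfolding t1_def by auto
    let ?A = "cl t1 j" and ?B = "cl (Suc t1) j"
    have early: "cl t j = cl t0 j" if "t0 \<le> t" "t \<le> t1" for t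
      using that
    proof (induction rule: dec_induct)
      case (step r)
      then show ?case using before[of r] by simp
    qed simp
    have pos1: "0 < deg t1 j" using t1 t0 by (simp add: deg_pos_iff)
    have late: "cl t j = ?A \<or> cl t j = ?B" if "t1 \<le> t" "t \<le> t0 + L" for t
      using that
    proof (induction rule: dec_induct)
      case (step r)
      then have IH: "cl r j = ?A \<or> cl r j = ?B" by auto
      show ?case
      proof (cases "cl (Suc r) j = cl r j")
        case True then show ?thesis using IH by simp
      next
        case False
        have r: "0 < r" "t0 \<le> r" "r < t0 + L" using step t1 t0 by auto
        \<comment> \<open>A later change is plus or minus the first one, from A to B. Adding that to
          B, or subtracting it from A, would give some point the indicator value 2 or -1; so A can
          only turn into B, and B into A.\<close>
        have tog: "(\<forall>p<n. chg t1 j p = chg r j p) \<or> (\<forall>p<n. chg t1 j p = - chg r j p)"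
          using t1 t0 r j False pos1 by (intro light_toggle light drops near) (auto simp: deg_pos_iff)
        have out: "p \<notin> cl t i" if "\<not> p < n" for p t i using that cl_sub[of t i] by auto
        have tog': "(\<forall>p. chg t1 j p = chg r j p) \<or> (\<forall>p. chg t1 j p = - chg r j p)"
        proof -
          have "chg t j p = 0" if "\<not> p < n" for p t using out[OF that] unfolding chg_def by simp
          then show ?thesis using tog by (metis minus_zero)
        qed
        obtain p where p: "p \<in> ?B \<longleftrightarrow> p \<notin> ?A" using t1(3) by blast
        have key: "indicat_real (cl (Suc r) j) q = indicat_real (cl r j) q + chg r j q" for q unfolding chg_def by simp
        show ?thesis using tog'
        proof
          assume e: "\<forall>p. chg t1 j p = chg r j p"
          have "cl r j = ?A"
          proof (rule ccontr)
            assume "cl r j \<noteq> ?A"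
            then have "cl r j = ?B" using IH by simp
            then have "indicat_real (cl (Suc r) j) p = 2 * indicat_real ?B p - indicat_real ?A p"
              using key[of p] e unfolding chg_def by (metis (no_types, lifting) add_diff_eq mult_2)
            then show False using p by (auto simp: indicator_def of_bool_def split: if_splits)
          qed
          then have "indicat_real (cl (Suc r) j) q = indicat_real ?B q" for q
            using key[of q] e unfolding chg_def by (metis add.commute diff_add_cancel)
          then have "cl (Suc r) j = ?B" by (intro set_eqI) (metis indicator_eq_1_iff)
          then show ?thesis ..
        next
          assume e: "\<forall>p. chg t1 j p = - chg r j p"
          have e': "chg r j q = indicat_real ?A q - indicat_real ?B q" for q
            using e[rule_format, of q] unfolding chg_def[of t1] by simp
          have "cl r j = ?B"
          proof (rule ccontr)
            assume "cl r j \<noteq> ?B"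
            then have "cl r j = ?A" using IH by simp
            then have "indicat_real (cl (Suc r) j) p = 2 * indicat_real ?A p - indicat_real ?B p"
              using key[of p] e' by simp
            then show False using p by (auto simp: indicator_def of_bool_def split: if_splits)
          qed
          then have "indicat_real (cl (Suc r) j) q = indicat_real ?A q" for q
            using key[of q] e' by simp
          then have "cl (Suc r) j = ?A" by (intro set_eqI) (metis indicator_eq_1_iff)
          then show ?thesis by simp
        qed
      qed
    qed simp
    have "cl t j = ?A \<or> cl t j = ?B" if "t \<in> {t0..t0 + L}" for t
      using that late[of t] early[of t] early[of t1] t1(1) by (cases "t \<le> t1") auto
    then show ?thesis by blast
  qed
  then obtain u where u: "t0 \<le> u" "u + 4 \<le> t0 + L" "pot (u + 4) = pot (u + 2)"
    using no_long_epoch[OF t0] unfolding L by blast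
  have "pot (u + 4) \<le> pot (Suc (u + 2))" by (rule pot_mono) simp
  also have "\<dots> < pot (u + 2)" using u by (intro strict) auto
  finally show False using u(3) by simp
qed

end
end

section \<open>Iterations in which some cluster exchanges many points\<close>

definition balance :: "nat set \<Rightarrow> (nat \<Rightarrow> nat) \<Rightarrow> (nat \<Rightarrow> nat) \<Rightarrow> nat \<Rightarrow> real" where
  "balance M src dst j = (\<Sum>p\<in>M. inc src dst j p)"

text \<open>A candidate center computed without the points. A light cluster is rounded relative to
  the value that its balance gives when the points are replaced by their means: the offset is then
  controlled by the noise instead of the size of the box, and the number of offsets times the
  probability of the balance contains no power of 1 / \<sigma>. This factor occurs up to k d times,
  so such a power could not be absorbed.\<close>

definition net_center ::
  "(nat \<Rightarrow> nat \<Rightarrow> real) \<Rightarrow> real \<Rightarrow> nat set \<Rightarrow> (nat \<Rightarrow> nat) \<Rightarrow> (nat \<Rightarrow> nat) \<Rightarrow> nat set \<Rightarrow> (nat \<times> nat \<Rightarrow> int) \<Rightarrow> nat \<Rightarrow> nat \<Rightarrow> real" where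
  "net_center \<mu> w M src dst \<Lambda> z j l =
     (if j \<in> \<Lambda> then (\<Sum>p\<in>M. inc src dst j p * \<mu> p l) / balance M src dst j else 0) + w * real_of_int (z (j, l))"

text \<open>\<open>Z2\<close> limits the offsets of light clusters and \<open>Z1\<close> those of
  clusters in \<open>H\<close>, whose centers are only known to lie in the box. All other clusters
  get the single offset 0 and do not add to the count.\<close>

definition net_grid :: "nat \<Rightarrow> nat \<Rightarrow> int \<Rightarrow> int \<Rightarrow> nat set \<Rightarrow> nat set \<Rightarrow> (nat \<times> nat \<Rightarrow> int) set" where
  "net_grid d k Z1 Z2 \<Lambda> H = PiE ({..<k} \<times> {..<d}) (\<lambda>(j, l). if j \<in> \<Lambda> then {-Z2..Z2} else if j \<in> H then {-Z1..Z1} else {0})"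

text \<open>Clusters in \<Lambda> are the light ones, whose centers are determined by the moved points up to w; the
  tree edges e j and the rank witness that these determinations can be made one after the other.\<close>
definition blueprint ::
  "nat \<Rightarrow> nat \<Rightarrow> nat \<Rightarrow> nat \<Rightarrow> nat set \<Rightarrow> (nat \<Rightarrow> nat) \<Rightarrow> (nat \<Rightarrow> nat) \<Rightarrow> nat set \<Rightarrow> nat set \<Rightarrow> nat set \<Rightarrow> bool" where
  "blueprint n d k \<kappa> M src dst Gd \<Lambda> H \<longleftrightarrow>
     M \<subseteq> {..<n} \<and> card M \<le> 16 * k * d \<and> src \<in> M \<rightarrow>\<^sub>E {..<k} \<and> dst \<in> M \<rightarrow>\<^sub>E {..<k} \<and> (\<forall>p\<in>M. src p \<noteq> dst p) \<and>
     Gd \<subseteq> M \<and> \<Lambda> \<subseteq> {..<k} \<and> H \<subseteq> {..<k} \<and> \<Lambda> \<inter> H = {} \<and>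
     (\<exists>e (rk :: nat \<Rightarrow> nat). \<forall>j\<in>\<Lambda>. e j \<in> M - Gd \<and> (src (e j) = j \<or> dst (e j) = j) \<and>
        (\<forall>j'\<in>\<Lambda>. j' \<noteq> j \<longrightarrow> rk j' \<le> rk j \<longrightarrow> src (e j') \<noteq> j \<and> dst (e j') \<noteq> j)) \<and>
     (\<forall>j\<in>\<Lambda>. balance M src dst j \<noteq> 0) \<and>
     8 * d * card H \<le> card Gd \<and> k * d \<le> \<kappa> * card Gd \<and> 8 \<le> card Gd"

text \<open>For fixed candidate centers these are constraints that are affine in each single
  coordinate. The error 11 d D w collects two rounding errors 5 d D w and one gain; 2 n w collects
  the balance error and its rounding error; \<delta> / (2 d) is what rounding leaves of a separation
  \<delta> / d.\<close>

definition blueprint_event ::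
  "nat \<Rightarrow> nat \<Rightarrow> real \<Rightarrow> real \<Rightarrow> real \<Rightarrow> nat set \<Rightarrow> (nat \<Rightarrow> nat) \<Rightarrow> (nat \<Rightarrow> nat) \<Rightarrow> nat set \<Rightarrow> nat set \<Rightarrow> (nat \<Rightarrow> nat \<Rightarrow> real) \<Rightarrow> (nat \<Rightarrow> nat \<Rightarrow> real) \<Rightarrow> bool" where
  "blueprint_event n d D w \<delta> M src dst Gd \<Lambda> ch X \<longleftrightarrow>
     (\<forall>p\<in>Gd. (\<exists>l<d. \<delta> / (2 * real d) \<le> \<bar>ch (src p) l - ch (dst p) l\<bar>) \<and>
        \<bar>sqdist d (X p) (ch (src p)) - sqdist d (X p) (ch (dst p))\<bar> \<le> 11 * real d * D * w) \<and>
     (\<forall>j\<in>\<Lambda>. \<forall>l<d. \<bar>(\<Sum>p\<in>M. inc src dst j p * X p l) - balance M src dst j * ch j l\<bar> \<le> 2 * real n * w)"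

definition blueprint_bad ::
  "nat \<Rightarrow> nat \<Rightarrow> nat \<Rightarrow> nat \<Rightarrow> real \<Rightarrow> real \<Rightarrow> real \<Rightarrow> int \<Rightarrow> int \<Rightarrow> (nat \<Rightarrow> nat \<Rightarrow> real) \<Rightarrow> (nat \<Rightarrow> nat \<Rightarrow> real) \<Rightarrow> bool" where
  "blueprint_bad n d k \<kappa> D w \<delta> Z1 Z2 \<mu> X \<longleftrightarrow> (\<exists>M src dst Gd \<Lambda> H z.
     blueprint n d k \<kappa> M src dst Gd \<Lambda> H \<and> z \<in> net_grid d k Z1 Z2 \<Lambda> H \<and>
     blueprint_event n d D w \<delta> M src dst Gd \<Lambda> (net_center \<mu> w M src dst \<Lambda> z) X)"

text \<open>After factoring the difference of squares, the second factor is at most 2 D + D + 2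
  D.\<close>

lemma sqdist_perturb:
  assumes "\<And>l. l < d \<Longrightarrow> \<bar>c' l - c l\<bar> \<le> w" "\<And>l. l < d \<Longrightarrow> \<bar>x l\<bar> \<le> D" "\<And>l. l < d \<Longrightarrow> \<bar>c l\<bar> \<le> D" "w \<le> D" "0 \<le> w"
  shows "\<bar>sqdist d x c' - sqdist d x c\<bar> \<le> 5 * real d * D * w"
proof -
  have "\<bar>sqdist d x c' - sqdist d x c\<bar> = \<bar>\<Sum>l<d. (c l - c' l) * (2 * x l - c l - c' l)\<bar>"
    unfolding sqdist_def sum_subtractf[symmetric] by (intro arg_cong[where f=abs] sum.cong) (auto simp: power2_eq_square algebra_simps)
  also have "\<dots> \<le> (\<Sum>l<d. \<bar>(c l - c' l) * (2 * x l - c l - c' l)\<bar>)" by (rule sum_abs)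
  also have "\<dots> \<le> (\<Sum>l<d. w * (5 * D))"
  proof (rule sum_mono)
    fix l assume l: "l \<in> {..<d}"
    have "\<bar>2 * x l - c l - c' l\<bar> \<le> 5 * D" "\<bar>c l - c' l\<bar> \<le> w"
      using assms(1)[of l] assms(2)[of l] assms(3)[of l] assms(4) l by auto
    then show "\<bar>(c l - c' l) * (2 * x l - c l - c' l)\<bar> \<le> w * (5 * D)"
      unfolding abs_mult using assms by (intro mult_mono) auto
  qed
  finally show ?thesis by (simp add: mult_ac)
qed

lemma floor_net:
  fixes w a :: real assumes "0 < w"
  shows "\<bar>w * real_of_int \<lfloor>a / w\<rfloor> - a\<bar> \<le> w" and "\<bar>a\<bar> \<le> w * (real_of_int Z - 1) \<Longrightarrow> \<lfloor>a / w\<rfloor> \<in> {-Z..Z}"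
proof -
  have f: "real_of_int \<lfloor>a / w\<rfloor> \<le> a / w" "a / w < real_of_int \<lfloor>a / w\<rfloor> + 1" by linarith+
  have g: "w * real_of_int \<lfloor>a / w\<rfloor> \<le> a" "a < w * real_of_int \<lfloor>a / w\<rfloor> + w"
  proof -
    show "w * real_of_int \<lfloor>a / w\<rfloor> \<le> a" using f(1) by (simp only: pos_le_divide_eq[OF assms] mult.commute)
    show "a < w * real_of_int \<lfloor>a / w\<rfloor> + w" using f(2) assms by (simp add: field_simps)
  qed
  then show "\<bar>w * real_of_int \<lfloor>a / w\<rfloor> - a\<bar> \<le> w" by linarith
  assume "\<bar>a\<bar> \<le> w * (real_of_int Z - 1)"
  then have "\<bar>a / w\<bar> \<le> real_of_int Z - 1" using assms by (simp add: abs_divide divide_le_eq mult.commute)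
  then have "real_of_int \<lfloor>a / w\<rfloor> \<le> real_of_int Z" "- real_of_int Z \<le> real_of_int \<lfloor>a / w\<rfloor>" using f by linarith+
  then show "\<lfloor>a / w\<rfloor> \<in> {-Z..Z}" by (simp flip: of_int_minus)
qed

context kmeans begin

lemma moved_activated: "0 < t \<Longrightarrow> p \<in> moved t \<Longrightarrow> i = asg t p \<or> i = asg (Suc t) p \<Longrightarrow> last_cl (Suc t) i \<noteq> {}"
proof -
  assume h: "0 < t" "p \<in> moved t" "i = asg t p \<or> i = asg (Suc t) p"
  then have "cl t i \<noteq> {} \<or> cl (Suc t) i \<noteq> {}" by (auto simp: mem_cl moved_def)
  then show ?thesis using last_cl_cl[of t i] by auto
qed

context
  fixes w \<delta> D \<nu> :: real and Z1 Z2 :: int and \<mu> :: "nat \<Rightarrow> nat \<Rightarrow> real" and \<kappa> t :: nat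
  assumes w: "0 < w" and wD: "w \<le> D" and w\<delta>: "4 * real d * w \<le> \<delta>"
    and boxD: "\<And>p l. p < n \<Longrightarrow> l < d \<Longrightarrow> \<bar>X p l\<bar> \<le> D" and box\<mu>: "\<And>p l. p < n \<Longrightarrow> l < d \<Longrightarrow> \<bar>X p l - \<mu> p l\<bar> \<le> \<nu>"
    and Z1: "D \<le> w * (real_of_int Z1 - 1)" and Z2: "real n * (w + \<nu>) \<le> w * (real_of_int Z2 - 1)"
    and t: "0 < t" and drop: "pot t - pot (Suc t) \<le> w\<^sup>2"
begin

lemma act_box: "last_cl t i \<noteq> {} \<Longrightarrow> l < d \<Longrightarrow> \<bar>cen t i l\<bar> \<le> D"
  using sum_box_le[of "last_cl t i" X l D] boxD subsetD[OF last_cl_sub[of t i]] w wD by (simp add: cen_last)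

text \<open>Rounding the actual centers to the net turns a concrete iteration into one of finitely
  many blueprints. The assumptions on the edge sets are facts about the exchange graph, supplied
  below in two ways: without light clusters, and with a forest of them.\<close>

lemma blueprint_core:
  assumes M: "M \<subseteq> moved t" "card M \<le> 16 * k * d" and Gd: "Gd \<subseteq> M"
    and \<Lambda>H: "\<Lambda> \<subseteq> {..<k}" "H \<subseteq> {..<k}" "\<Lambda> \<inter> H = {}" and act: "\<And>j. j \<in> \<Lambda> \<union> H \<Longrightarrow> last_cl t j \<noteq> {}"
    and ends: "\<And>p. p \<in> Gd \<Longrightarrow> asg t p \<in> \<Lambda> \<union> H \<and> asg (Suc t) p \<in> \<Lambda> \<union> H"
    and far: "\<And>p. p \<in> Gd \<Longrightarrow> \<delta>\<^sup>2 < sqdist d (cen t (asg t p)) (cen t (asg (Suc t) p))"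
    and light: "\<And>j p. j \<in> \<Lambda> \<Longrightarrow> p \<in> moved t \<Longrightarrow> asg t p = j \<or> asg (Suc t) p = j \<Longrightarrow> p \<in> M"
    and unbal: "\<And>j. j \<in> \<Lambda> \<Longrightarrow> bal t j \<noteq> 0"
    and tree: "\<And>j. j \<in> \<Lambda> \<Longrightarrow> e j \<in> M - Gd \<and> (asg t (e j) = j \<or> asg (Suc t) (e j) = j)"
    and rank: "\<And>j j'. j \<in> \<Lambda> \<Longrightarrow> j' \<in> \<Lambda> \<Longrightarrow> j' \<noteq> j \<Longrightarrow> rk j' \<le> (rk j :: nat) \<Longrightarrow> asg t (e j') \<noteq> j \<and> asg (Suc t) (e j') \<noteq> j"
    and cards: "8 * d * card H \<le> card Gd" "k * d \<le> \<kappa> * card Gd" "8 \<le> card Gd"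
  shows "blueprint_bad n d k \<kappa> D w \<delta> Z1 Z2 \<mu> X"
proof -
  note dr = less_imp_le[OF w] drop t
  have \<delta>0: "0 \<le> \<delta>" using w\<delta> w by (meson dual_order.trans less_imp_le mult_nonneg_nonneg of_nat_0_le_iff zero_le_numeral)
  define src where "src = restrict (asg t) M"
  define dst where "dst = restrict (asg (Suc t)) M"
  have fM: "finite M" using M finite_subset finite_moved by blast
  have Mn: "M \<subseteq> {..<n}" using M unfolding moved_def by auto
  have incM: "inc src dst j p = tinc t j p" if "p \<in> M" for j p using that unfolding src_def dst_def inc_def by simp
  have sumM: "(\<Sum>p\<in>M. inc src dst j p * f p) = (\<Sum>p\<in>moved t. tinc t j p * f p)" if "j \<in> \<Lambda>" for j and f :: "nat \<Rightarrow> real"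
  proof -
    have "(\<Sum>p\<in>M. inc src dst j p * f p) = (\<Sum>p\<in>M. tinc t j p * f p)" using incM by (intro sum.cong) auto
    also have "\<dots> = (\<Sum>p\<in>moved t. tinc t j p * f p)"
      by (rule sum.mono_neutral_left) (use M light[OF that] in \<open>auto simp: inc_def split: if_splits\<close>)
    finally show ?thesis .
  qed
  have balM: "balance M src dst j = real_of_int (bal t j)" if "j \<in> \<Lambda>" for j
    using sumM[OF that, of "\<lambda>_. 1"] bal_sum[OF t] unfolding balance_def by simp
  define mean where "mean j l = (if j \<in> \<Lambda> then (\<Sum>p\<in>M. inc src dst j p * \<mu> p l) / balance M src dst j else 0)" for j l
  define z where "z = (\<lambda>(j, l) \<in> {..<k} \<times> {..<d}. if j \<in> \<Lambda> \<union> H then \<lfloor>(cen t j l - mean j l) / w\<rfloor> else 0)"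
  let ?ch = "net_center \<mu> w M src dst \<Lambda> z"
  have ch: "\<bar>?ch j l - cen t j l\<bar> \<le> w" if "j \<in> \<Lambda> \<union> H" "l < d" for j l
  proof -
    have "?ch j l = mean j l + w * real_of_int \<lfloor>(cen t j l - mean j l) / w\<rfloor>"
      using that \<Lambda>H unfolding net_center_def mean_def z_def by auto
    then show ?thesis using floor_net(1)[OF w, of "cen t j l - mean j l"] by simp
  qed
  \<comment> \<open>Multiplied by the change of size, the deviation consists of the balance error
    and the signed sum of X - \<mu>. The change of size is a nonzero integer, so dividing by it does
    not increase the bound.\<close>
  have lightmean: "\<bar>cen t j l - mean j l\<bar> \<le> real n * (w + \<nu>)" if j: "j \<in> \<Lambda>" and l: "l < d" for j l
  proof -
    have jk: "j < k" using j \<Lambda>H by auto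
    let ?b = "real_of_int (bal t j)"
    have b1: "1 \<le> \<bar>?b\<bar>" using unbal[OF j] by linarith
    have "mean j l * ?b = (\<Sum>p\<in>moved t. tinc t j p * \<mu> p l)"
      using j b1 unfolding mean_def balM[OF j] sumM[OF j] by simp
    then have e: "(cen t j l - mean j l) * ?b = - ((\<Sum>p\<in>moved t. tinc t j p * X p l) - (\<Sum>p\<in>moved t. tinc t j p) * cen t j l)
       + (\<Sum>p\<in>moved t. tinc t j p * (X p l - \<mu> p l))"
      unfolding bal_sum[OF t] by (simp add: algebra_simps sum_subtractf)
    have "\<bar>\<Sum>p\<in>moved t. tinc t j p * (X p l - \<mu> p l)\<bar> \<le> (\<Sum>p\<in>moved t. \<bar>tinc t j p * (X p l - \<mu> p l)\<bar>)" by (rule sum_abs)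
    also have "\<dots> \<le> (\<Sum>p\<in>moved t. \<nu>)"
    proof (rule sum_mono)
      fix p assume "p \<in> moved t"
      then have "\<bar>X p l - \<mu> p l\<bar> \<le> \<nu>" using box\<mu> l by (simp add: moved_def)
      moreover have "\<bar>tinc t j p\<bar> \<le> 1" by (simp add: inc_def)
      ultimately have "\<bar>tinc t j p\<bar> * \<bar>X p l - \<mu> p l\<bar> \<le> 1 * \<nu>" by (intro mult_mono) auto
      then show "\<bar>tinc t j p * (X p l - \<mu> p l)\<bar> \<le> \<nu>" by (simp add: abs_mult)
    qed
    also have "\<dots> \<le> real n * \<nu>"
    proof -
      have "card (moved t) \<le> n" using card_mono[of "{..<n}" "moved t"] unfolding moved_def by auto
      moreover have "0 \<le> \<nu>" using box\<mu>[OF npos dpos] by linarith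
      ultimately show ?thesis by (simp add: mult_right_mono)
    qed
    finally have "\<bar>(cen t j l - mean j l) * ?b\<bar> \<le> real n * w + real n * \<nu>"
      unfolding e using cluster_balance[OF dr jk l] by linarith
    moreover have "\<bar>cen t j l - mean j l\<bar> * 1 \<le> \<bar>cen t j l - mean j l\<bar> * \<bar>?b\<bar>" using b1 by (intro mult_left_mono) auto
    ultimately show ?thesis unfolding abs_mult distrib_left mult_1_right by (rule order_trans[rotated])
  qed
  have zg: "z \<in> net_grid d k Z1 Z2 \<Lambda> H"
    unfolding net_grid_def z_def
  proof (rule restrict_PiE_iff[THEN iffD2], rule ballI)
    fix x assume "x \<in> {..<k} \<times> {..<d}"
    then obtain j l where x: "x = (j, l)" "j < k" "l < d" by auto
    have "\<lfloor>(cen t j l - mean j l) / w\<rfloor> \<in> {-Z2..Z2}" if "j \<in> \<Lambda>"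
      using lightmean[OF that x(3)] Z2 by (intro floor_net(2)[OF w]) linarith
    moreover have "\<lfloor>(cen t j l - mean j l) / w\<rfloor> \<in> {-Z1..Z1}" if "j \<in> H"
    proof -
      have "mean j l = 0" using that \<Lambda>H unfolding mean_def by auto
      then show ?thesis using act_box[OF act x(3), of j] that Z1 by (intro floor_net(2)[OF w]) auto
    qed
    ultimately show "(case x of (j, l) \<Rightarrow> if j \<in> \<Lambda> \<union> H then \<lfloor>(cen t j l - mean j l) / w\<rfloor> else 0)
        \<in> (case x of (j, l) \<Rightarrow> if j \<in> \<Lambda> then {- Z2..Z2} else if j \<in> H then {- Z1..Z1} else {0})"
      unfolding x(1) by auto
  qed
  have bp: "blueprint n d k \<kappa> M src dst Gd \<Lambda> H"
    unfolding blueprint_def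
  proof (intro conjI)
    show "src \<in> M \<rightarrow>\<^sub>E {..<k}" "dst \<in> M \<rightarrow>\<^sub>E {..<k}" unfolding src_def dst_def by (auto simp: asg_lt)
    show "\<forall>p\<in>M. src p \<noteq> dst p" unfolding src_def dst_def using M by (auto simp: moved_def)
    show "\<exists>e (rk :: nat \<Rightarrow> nat). \<forall>j\<in>\<Lambda>. e j \<in> M - Gd \<and> (src (e j) = j \<or> dst (e j) = j) \<and>
        (\<forall>j'\<in>\<Lambda>. j' \<noteq> j \<longrightarrow> rk j' \<le> rk j \<longrightarrow> src (e j') \<noteq> j \<and> dst (e j') \<noteq> j)"
    proof (rule exI[of _ e], rule exI[of _ rk], rule ballI)
      fix j assume j: "j \<in> \<Lambda>"
      have se: "src (e j) = asg t (e j) \<and> dst (e j) = asg (Suc t) (e j)" if "j \<in> \<Lambda>" for j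
        using tree[OF that] unfolding src_def dst_def by auto
      show "e j \<in> M - Gd \<and> (src (e j) = j \<or> dst (e j) = j) \<and>
        (\<forall>j'\<in>\<Lambda>. j' \<noteq> j \<longrightarrow> rk j' \<le> rk j \<longrightarrow> src (e j') \<noteq> j \<and> dst (e j') \<noteq> j)"
        using tree[OF j] rank[OF j] se[OF j] se by auto
    qed
    show "\<forall>j\<in>\<Lambda>. balance M src dst j \<noteq> 0" using balM unbal by auto
  qed (use Mn M Gd \<Lambda>H cards in auto)
  have ev: "blueprint_event n d D w \<delta> M src dst Gd \<Lambda> ?ch X"
    unfolding blueprint_event_def
  proof (intro conjI ballI allI impI)
    fix p assume p: "p \<in> Gd"
    have sd: "src p = asg t p" "dst p = asg (Suc t) p" using p Gd unfolding src_def dst_def by auto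
    note en = ends[OF p]
    have pn: "p < n" using p Gd Mn by auto
    obtain l where l: "l < d" "\<delta> / real d < \<bar>cen t (asg t p) l - cen t (asg (Suc t) p) l\<bar>"
      using sqdist_big_coord[OF \<delta>0 far[OF p] dpos] by blast
    have "2 * w \<le> \<delta> / (2 * real d)" using w\<delta> dpos by (simp add: field_simps)
    moreover have "\<delta> / real d = 2 * (\<delta> / (2 * real d))" by simp
    ultimately have "\<delta> / (2 * real d) \<le> \<bar>?ch (asg t p) l - ?ch (asg (Suc t) p) l\<bar>"
      using l ch[of "asg t p" l] ch[of "asg (Suc t) p" l] en by linarith
    then show "\<exists>l<d. \<delta> / (2 * real d) \<le> \<bar>?ch (src p) l - ?ch (dst p) l\<bar>" unfolding sd using l by blast
    have pert: "\<bar>sqdist d (X p) (?ch j) - sqdist d (X p) (cen t j)\<bar> \<le> 5 * real d * D * w" if "j \<in> \<Lambda> \<union> H" for j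
      using ch[OF that] boxD[OF pn] act_box[OF act[OF that]] wD w by (intro sqdist_perturb) auto
    have "\<bar>gain t p\<bar> \<le> real d * D * w"
    proof -
      have "w * w \<le> real d * D * w"
      proof -
        have "1 * w \<le> real d * D" using wD w dpos by (intro mult_mono) auto
        then show ?thesis using w by (simp add: mult_right_mono)
      qed
      then show ?thesis using small_gain[OF dr pn] gain_nonneg[of t p] by (simp add: power2_eq_square)
    qed
    then show "\<bar>sqdist d (X p) (?ch (src p)) - sqdist d (X p) (?ch (dst p))\<bar> \<le> 11 * real d * D * w"
      using pert[of "asg t p"] pert[of "asg (Suc t) p"] en unfolding sd gain_def by linarith
  next
    fix j l assume j: "j \<in> \<Lambda>" and l: "l < d"
    have jk: "j < k" using j \<Lambda>H by auto
    have "\<bar>(\<Sum>p\<in>M. inc src dst j p * X p l) - balance M src dst j * cen t j l\<bar> \<le> real n * w"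
      unfolding sumM[OF j] balM[OF j] bal_sum[OF t, symmetric] using cluster_balance[OF dr jk l] .
    moreover have "\<bar>balance M src dst j * (?ch j l - cen t j l)\<bar> \<le> real n * w"
      unfolding abs_mult balM[OF j] using ch[of j l] j l bal_le[of t j] by (intro mult_mono) auto
    ultimately show "\<bar>(\<Sum>p\<in>M. inc src dst j p * X p l) - balance M src dst j * ?ch j l\<bar> \<le> 2 * real n * w"
      by (simp add: algebra_simps abs_le_iff)
  qed
  show ?thesis unfolding blueprint_bad_def using bp zg ev by blast
qed

end
end

lemma card_le_fibers:
  assumes "finite C" "\<And>i. i \<in> f ` C \<Longrightarrow> card {p \<in> C. f p = i} \<le> m"
  shows "card C \<le> m * card (f ` C)"
proof -
  have "card C = (\<Sum>i\<in>f ` C. card {p \<in> C. f p = i})"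
    using assms(1) by (subst card_eq_sum, subst sum.group[symmetric, of C "f ` C" f]) auto
  also have "\<dots> \<le> (\<Sum>i\<in>f ` C. m)" using assms(2) by (rule sum_mono)
  finally show ?thesis by (simp add: mult.commute)
qed

section \<open>Exchanges between close centers\<close>

context kmeans begin

definition close :: "real \<Rightarrow> nat \<Rightarrow> nat \<Rightarrow> bool" where
  "close \<delta> t p \<longleftrightarrow> sqdist d (cen t (asg t p)) (cen t (asg (Suc t) p)) \<le> \<delta>\<^sup>2"

abbreviation "heavy R t \<equiv> {j. j < k \<and> R < deg t j}"

context
  fixes w \<delta> :: real and \<kappa> R s t :: nat
  assumes nf: "nullfree" and w: "0 < w" and norel1: "\<not> one_relation n d R (20 * real n ^ 2 * w) X"
    and norel2: "\<not> two_relations n d R (2 * \<delta>) X" and noslab: "\<not> crowded_slab n d (8 * d) (real n * real d * \<delta>) X"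
    and R: "R = 80 * \<kappa> * d" and \<kappa>: "0 < \<kappa>" and w\<delta>: "4 * real n ^ 2 * w \<le> \<delta>"
    and ts: "t = Suc s" and drop: "pot t - pot (Suc t) \<le> w\<^sup>2"
    and act: "\<And>i. i < k \<Longrightarrow> last_cl (Suc t) i \<noteq> {} \<Longrightarrow> last_cl s i \<noteq> {}"
begin

lemma tpos: "0 < t" using ts by simp

lemma d\<delta>: "0 < \<delta>" "w \<le> \<delta>" "4 * real d * w \<le> \<delta>" "2 * w \<le> \<delta>"
proof -
  have n1: "1 \<le> real n ^ 2" using npos by simp
  have "real d \<le> real n ^ 2" using dn npos by (metis le_square le_trans of_nat_le_iff of_nat_power power2_eq_square)
  then have "4 * real d * w \<le> 4 * real n ^ 2 * w" using w by (intro mult_right_mono) auto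
  then show "4 * real d * w \<le> \<delta>" using w\<delta> by simp
  have "4 * 1 * w \<le> 4 * real n ^ 2 * w" using w n1 by (intro mult_right_mono mult_left_mono) auto
  then have "4 * w \<le> \<delta>" using w\<delta> by simp
  then show "0 < \<delta>" "w \<le> \<delta>" "2 * w \<le> \<delta>" using w by auto
qed

lemma moved_ends:
  assumes "p \<in> moved t"
  shows "p < n" "asg t p \<noteq> asg (Suc t) p" "p \<in> cl t (asg t p)" "p \<in> cl (Suc t) (asg (Suc t) p)"
    "last_cl s (asg t p) \<noteq> {}" "last_cl s (asg (Suc t) p) \<noteq> {}" "last_cl t (asg t p) \<noteq> {}" "last_cl t (asg (Suc t) p) \<noteq> {}"
proof -
  show "p < n" "asg t p \<noteq> asg (Suc t) p" using assms by (auto simp: moved_def)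
  then show "p \<in> cl t (asg t p)" "p \<in> cl (Suc t) (asg (Suc t) p)" using tpos by (auto simp: mem_cl)
  show a: "last_cl s (asg t p) \<noteq> {}" "last_cl s (asg (Suc t) p) \<noteq> {}"
    using moved_activated[OF tpos assms] act asg_lt by blast+
  show "last_cl t (asg t p) \<noteq> {}" "last_cl t (asg (Suc t) p) \<noteq> {}"
    using last_cl_mono[of s t, OF _ a(1)] last_cl_mono[of s t, OF _ a(2)] ts by auto
qed

text \<open>Both clusters lie in one thin slab, where 8 d points are excluded. Being small is what
  allows their centroids to be compared by vectors of \<open>svec\<close>.\<close>

lemma close_small:
  assumes p: "p \<in> moved t" and c: "close \<delta> t p"
  shows "card (cl t (asg t p) \<union> cl t (asg (Suc t) p)) < 8 * d"
proof (rule ccontr)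
  assume "\<not> ?thesis"
  then obtain P where P: "P \<subseteq> cl t (asg t p) \<union> cl t (asg (Suc t) p)" "card P = 8 * d"
    by (meson not_less obtain_subset_with_card_n)
  note e = moved_ends[OF p]
  have ne: "cl (Suc s) (asg t p) \<noteq> {}" using e(3) ts by auto
  have cc: "sqdist d (cen (Suc s) (asg t p)) (cen (Suc s) (asg (Suc t) p)) \<le> \<delta>\<^sup>2" using c ts unfolding close_def by simp
  obtain u b l0 where u: "l0 < d" "u l0 = (1::real)" "\<forall>l<d. \<bar>u l\<bar> \<le> 1"
    "\<forall>q\<in>cl t (asg t p) \<union> cl t (asg (Suc t) p). \<bar>(\<Sum>l<d. u l * X q l) - b\<bar> \<le> real n * real d * \<delta>"
    using close_centers_slab[OF asg_lt asg_lt e(2) ne cen_distinct[OF nf asg_lt asg_lt e(2) e(5,6)] less_imp_le[OF d\<delta>(1)] cc]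
    unfolding ts by blast
  have "P \<subseteq> {..<n}" using P(1) cl_sub[of t "asg t p"] cl_sub[of t "asg (Suc t) p"] by auto
  then have "crowded_slab n d (8 * d) (real n * real d * \<delta>) X"
    unfolding crowded_slab_def using P u by blast
  then show False using noslab by simp
qed

lemma close_coord: "close \<delta> t p \<Longrightarrow> l < d \<Longrightarrow> \<bar>cen t (asg t p) l - cen t (asg (Suc t) p) l\<bar> \<le> \<delta>"
  unfolding close_def using d\<delta>(1) by (intro sqdist_coord_le) auto

lemma small_R: "8 * d \<le> R" using R \<kappa> by simp

text \<open>The two centers are then close, so the old cluster is small; it also contains a point
  other than p, since it does not follow p as a whole. Thus p being near the old centroid is a
  nontrivial relation.\<close>

lemma relation_from_source:
  assumes p: "p \<in> moved t" and near: "sqdist d (X p) (cen t (asg t p)) \<le> (2 * real n ^ 2 * w)\<^sup>2"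
    and near': "sqdist d (X p) (cen t (asg (Suc t) p)) \<le> (2 * real n ^ 2 * w)\<^sup>2"
  shows False
proof -
  let ?i = "asg t p"
  note e = moved_ends[OF p]
  have nn: "0 \<le> 2 * real n ^ 2 * w" using w by simp
  have "sqdist d (cen t ?i) (cen t (asg (Suc t) p)) \<le> (2 * real n ^ 2 * w + 2 * real n ^ 2 * w)\<^sup>2"
    by (rule sqdist_triangle[OF nn nn _ near']) (use near in \<open>simp add: sqdist_commute\<close>)
  also have "\<dots> \<le> \<delta>\<^sup>2" using w\<delta> nn by (intro power_mono) linarith+
  finally have "close \<delta> t p" unfolding close_def .
  then have "card (cl t ?i) < 8 * d"
    using close_small[OF p] card_mono[of "cl t ?i \<union> cl t (asg (Suc t) p)" "cl t ?i"] by simp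
  then have sm: "card (cl t ?i) \<le> R" using small_R by simp
  have nall: "\<not> cl t ?i \<subseteq> cl (Suc t) (asg (Suc t) p)"
    using not_all_move[OF nf asg_lt asg_lt e(2) _ e(8)] e(3) by blast
  then have ne: "{p} \<noteq> cl t ?i" using e(4) by auto
  have m: "cdiff {p} (cl t ?i) \<in> svec n R"
    using e(1,3) sm cl_sub[of t ?i] small_R dpos by (intro cdiff_svec) auto
  have nz: "\<exists>q<n. cdiff {p} (cl t ?i) q \<noteq> 0"
    using cdiff_nonzero[OF ne] e(1,3) subsetD[OF cl_sub[of t ?i]] by auto
  have "\<bar>lin n X (cdiff {p} (cl t ?i)) l\<bar> \<le> 20 * real n ^ 2 * w" if l: "l < d" for l
  proof -
    have "lin n X (cdiff {p} (cl t ?i)) l = X p l - cen t ?i l"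
    proof -
      have "cl t ?i \<noteq> {}" using e(3) by auto
      moreover have "{p} \<subseteq> {..<n}" using e(1) by simp
      ultimately show ?thesis unfolding lin_cdiff[OF \<open>{p} \<subseteq> {..<n}\<close> cl_sub] by (simp add: cen_nonempty centroid_def[of X "{p}"])
    qed
    moreover have "\<bar>X p l - cen t ?i l\<bar> \<le> 2 * real n ^ 2 * w" by (rule sqdist_coord_le[OF l nn near])
    ultimately show ?thesis using nn by linarith
  qed
  then show False using norel1 m nz unfolding one_relation_def by blast
qed

text \<open>The balance of a single exchanged point puts it next to the center of j, within 3 (n^2
  w)^2 in squared distance, and its small gain puts it next to the other center as well. That light
  clusters have degree at least 2 leaves enough edges besides a spanning forest.\<close>

lemma deg_not_1:
  assumes j: "j < k"
  shows "deg t j \<noteq> 1"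
proof
  assume "deg t j = 1"
  then obtain p where p: "{p \<in> moved t. asg t p = j \<or> asg (Suc t) p = j} = {p}" unfolding deg_def by (auto simp: card_1_singleton_iff)
  then have pm: "p \<in> moved t" and pj: "asg t p = j \<or> asg (Suc t) p = j" by auto
  note e = moved_ends[OF pm]
  have S: "(\<Sum>q\<in>moved t. tinc t j q * f q) = tinc t j p * f p" for f :: "nat \<Rightarrow> real"
  proof -
    have "(\<Sum>q\<in>moved t. tinc t j q * f q) = (\<Sum>q\<in>{p}. tinc t j q * f q)"
      by (rule sum.mono_neutral_right) (use p pm in \<open>auto simp: inc_def\<close>)
    then show ?thesis by simp
  qed
  have i1: "\<bar>tinc t j p\<bar> = 1" using pj e(2) by (auto simp: inc_def)
  have co: "\<bar>X p l - cen t j l\<bar> \<le> real n * w" if l: "l < d" for l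
  proof -
    have "tinc t j p * X p l - tinc t j p * cen t j l = tinc t j p * (X p l - cen t j l)" by (simp add: algebra_simps)
    moreover have "\<bar>tinc t j p * X p l - tinc t j p * cen t j l\<bar> \<le> real n * w"
      using cluster_balance[OF less_imp_le[OF w] drop tpos j l] S[of "\<lambda>q. X q l"] S[of "\<lambda>_. 1"] by simp
    ultimately show ?thesis using i1 by (simp add: abs_mult)
  qed
  have n1: "1 \<le> real n" using npos by simp
  have "sqdist d (X p) (cen t j) \<le> (\<Sum>l<d. (real n * w)\<^sup>2)"
    unfolding sqdist_def using co by (intro sum_mono) (auto simp: abs_le_square_iff[symmetric] w less_imp_le)
  also have "\<dots> = real d * (real n * w)\<^sup>2" by simp
  also have "\<dots> \<le> real n * (real n * w)\<^sup>2" using dn by (intro mult_right_mono) auto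
  also have "\<dots> \<le> 3 * (real n ^ 2 * w)\<^sup>2"
  proof -
    have "real n * (real n * w)\<^sup>2 = real n ^ 3 * w\<^sup>2" by (simp add: power2_eq_square power3_eq_cube)
    also have "\<dots> \<le> real n ^ 4 * w\<^sup>2" using n1 by (intro mult_right_mono power_increasing) auto
    also have "\<dots> \<le> 3 * (real n ^ 2 * w)\<^sup>2" by (simp add: power_mult_distrib flip: power_mult)
    finally show ?thesis .
  qed
  finally have dj: "sqdist d (X p) (cen t j) \<le> 3 * (real n ^ 2 * w)\<^sup>2" .
  have four: "(2 * real n ^ 2 * w)\<^sup>2 = 4 * (real n ^ 2 * w)\<^sup>2" by (simp add: power_mult_distrib)
  have ww: "w\<^sup>2 \<le> (real n ^ 2 * w)\<^sup>2" "0 \<le> (real n ^ 2 * w)\<^sup>2"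
    using n1 w by (auto intro!: power_mono simp: one_le_power)
  have g: "gain t p \<le> w\<^sup>2" "0 \<le> gain t p" using small_gain[OF less_imp_le[OF w] drop tpos e(1)] gain_nonneg by auto
  have "sqdist d (X p) (cen t (asg t p)) \<le> (2 * real n ^ 2 * w)\<^sup>2" "sqdist d (X p) (cen t (asg (Suc t) p)) \<le> (2 * real n ^ 2 * w)\<^sup>2"
    using pj dj ww g unfolding four gain_def by auto
  then show False using relation_from_source[OF pm] by blast
qed

text \<open>Choose one target for each source of a close exchange, and let h be the number of heavy
  clusters. If the target is light or nonempty before the exchange, source and target give a small
  relation, and three such vectors cannot be pairwise proportional. Otherwise the target is empty
  and heavy: sources with the same target have nearby centroids, and more than h + 1 of them yield
  two independent relations. The total is 2 + (h + 1).\<close>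

lemma close_sources: "card (asg t ` {p \<in> moved t. close \<delta> t p}) \<le> card (heavy R t) + 3"
proof -
  define I where "I = asg t ` {p \<in> moved t. close \<delta> t p}"
  have fI: "finite I" unfolding I_def by simp
  have "\<forall>i\<in>I. \<exists>p. p \<in> moved t \<and> close \<delta> t p \<and> asg t p = i" unfolding I_def by auto
  then obtain pt where pt: "\<And>i. i \<in> I \<Longrightarrow> pt i \<in> moved t \<and> close \<delta> t (pt i) \<and> asg t (pt i) = i" by metis
  define tg where "tg i = asg (Suc t) (pt i)" for i
  have Iprop: "i < k" "tg i < k" "i \<noteq> tg i" "cl t i \<noteq> {}" "card (cl t i) \<le> R" "card (cl t (tg i)) \<le> R"
      "last_cl t (tg i) \<noteq> {}" "pt i \<in> cl (Suc t) (tg i)"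
      "\<And>l. l < d \<Longrightarrow> \<bar>cen t i l - cen t (tg i) l\<bar> \<le> \<delta>" if i: "i \<in> I" for i
  proof -
    note p = pt[OF i] and e = moved_ends[OF conjunct1[OF pt[OF i]]]
    show "i < k" "tg i < k" using p asg_lt unfolding tg_def by metis+
    show "i \<noteq> tg i" "cl t i \<noteq> {}" "last_cl t (tg i) \<noteq> {}" "pt i \<in> cl (Suc t) (tg i)" using e p unfolding tg_def by auto
    have "card (cl t i \<union> cl t (tg i)) < 8 * d" using close_small[of "pt i"] p unfolding tg_def by simp
    moreover have "card (cl t i) \<le> card (cl t i \<union> cl t (tg i))" "card (cl t (tg i)) \<le> card (cl t i \<union> cl t (tg i))"
      by (auto intro: card_mono)
    ultimately show "card (cl t i) \<le> R" "card (cl t (tg i)) \<le> R" using small_R by linarith+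
    show "\<bar>cen t i l - cen t (tg i) l\<bar> \<le> \<delta>" if "l < d" for l using close_coord[of "pt i" l] p that unfolding tg_def by simp
  qed
  have disj: "p \<notin> cl t i'" if "p \<in> cl t i" "i \<noteq> i'" for p i i' using that tpos by (auto simp: mem_cl)
  define I1 where "I1 = {i \<in> I. cl t (tg i) \<noteq> {} \<or> deg t (tg i) \<le> R}"
  define I2 where "I2 = I - I1"
  have "card I1 \<le> 2"
  proof (rule ccontr)
    assume "\<not> card I1 \<le> 2"
    then have "3 \<le> card I1" by simp
    then obtain T where T: "T \<subseteq> I1" "card T = 3" by (meson obtain_subset_with_card_n)
    then obtain i1 i2 i3 where i: "T = {i1, i2, i3}" "i1 \<noteq> i2" "i1 \<noteq> i3" "i2 \<noteq> i3" by (auto simp: card_3_iff)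
    have inI: "i1 \<in> I1" "i2 \<in> I1" "i3 \<in> I1" using T i by auto
    \<comment> \<open>A target that is empty at time t is represented by its next value, which
      consists of gained points only, hence is small if the target is light; its center has moved by
      at most w per coordinate.\<close>
    define B where "B i = (if cl t (tg i) \<noteq> {} then cl t (tg i) else cl (Suc t) (tg i))" for i
    define v where "v i = cdiff (cl t i) (B i)" for i
    have vprop: "v i \<in> svec n R" "\<exists>a<n. a \<in> cl t i \<and> 0 < v i a" "\<And>l. l < d \<Longrightarrow> \<bar>lin n X (v i) l\<bar> \<le> 2 * \<delta>" if "i \<in> I1" for i
    proof -
      have iI: "i \<in> I" and alt: "cl t (tg i) \<noteq> {} \<or> deg t (tg i) \<le> R" using that unfolding I1_def by auto
      note P = Iprop[OF iI]
      have Bn: "B i \<noteq> {}" "B i \<subseteq> {..<n}" using P(8) cl_sub unfolding B_def by auto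
      have Bc: "card (B i) \<le> R"
      proof (cases "cl t (tg i) = {}")
        case True
        then have "cl (Suc t) (tg i) - cl t (tg i) = cl (Suc t) (tg i)" by simp
        then show ?thesis using card_GL(1)[OF tpos, of "tg i"] True alt unfolding B_def by simp
      qed (use P(6) in \<open>simp add: B_def\<close>)
      show "v i \<in> svec n R" unfolding v_def using P(4,5) Bn Bc cl_sub by (intro cdiff_svec) auto
      have "\<exists>a. a \<in> cl t i \<and> a \<notin> B i"
      proof (cases "cl t (tg i) = {}")
        case True
        then show ?thesis using not_all_move[OF nf P(1,2,3,4,7)] unfolding B_def by auto
      next
        case False
        then show ?thesis using P(4) disj[OF _ P(3)] unfolding B_def by auto
      qed
      then obtain a where a: "a \<in> cl t i" "a \<notin> B i" by blast
      have "0 < card (cl t i)" using P(4) by (simp add: card_gt_0_iff)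
      then have "0 < v i a" using a unfolding v_def cdiff_def by simp
      then show "\<exists>a<n. a \<in> cl t i \<and> 0 < v i a" using a(1) cl_sub[of t i] by auto
      fix l assume l: "l < d"
      have "lin n X (v i) l = cen t i l - (if cl t (tg i) \<noteq> {} then cen t (tg i) l else cen (Suc t) (tg i) l)"
      proof -
        have ne: "cl (Suc t) (tg i) \<noteq> {}" using P(8) by auto
        have "centroid X (B i) = (if cl t (tg i) \<noteq> {} then cen t (tg i) else cen (Suc t) (tg i))"
          unfolding B_def using cen_nonempty[OF ne] cen_nonempty[of t "tg i"] by simp
        then show ?thesis unfolding v_def lin_cdiff[OF cl_sub Bn(2)] using cen_nonempty[OF P(4)] by simp
      qed
      moreover have "\<bar>cen (Suc t) (tg i) l - cen t (tg i) l\<bar> \<le> w"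
        using small_move_coord[OF less_imp_le[OF w] drop tpos P(2) l] .
      ultimately show "\<bar>lin n X (v i) l\<bar> \<le> 2 * \<delta>" using P(9)[OF l] d\<delta> by (auto split: if_splits)
    qed
    have par: "v i p * v i' q = v i q * v i' p" if "i \<in> I1" "i' \<in> I1" "p < n" "q < n" for i i' p q
    proof (rule ccontr)
      assume "v i p * v i' q \<noteq> v i q * v i' p"
      then have "two_relations n d R (2 * \<delta>) X" unfolding two_relations_def
        using vprop[OF that(1)] vprop[OF that(2)] that(3,4) by blast
      then show False using norel2 by simp
    qed
    obtain a1 a2 a3 where a: "a1 < n" "a1 \<in> cl t i1" "0 < v i1 a1" "a2 < n" "a2 \<in> cl t i2" "0 < v i2 a2"
        "a3 < n" "a3 \<in> cl t i3" "0 < v i3 a3"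
      using vprop(2)[OF inI(1)] vprop(2)[OF inI(2)] vprop(2)[OF inI(3)] by blast
    have np: "v i a \<le> 0" if "a \<in> cl t i'" "i \<noteq> i'" for i i' a
      using disj[OF that(1)] that(2) unfolding v_def cdiff_def by auto
    have neg: "v i a' < 0" if "i \<in> I1" "i' \<in> I1" "i \<noteq> i'" "a < n" "a \<in> cl t i" "0 < v i a" "a' < n" "a' \<in> cl t i'" "0 < v i' a'" for i i' a a'
    proof -
      have "0 < v i a * v i' a'" using that by simp
      then have "v i a' \<noteq> 0" unfolding par[OF that(1,2,4,7)] by (metis mult_zero_left less_irrefl)
      then show ?thesis using np[OF that(8,3)] by (simp add: less_le)
    qed
    \<comment> \<open>Each vector is positive at its own witness and negative at those of the other
      sources. For \<open>i1\<close> and \<open>i2\<close>, the two products of the minor at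
      \<open>a2\<close> and \<open>a3\<close> then have opposite signs.\<close>
    have "v i1 a2 < 0" "v i1 a3 < 0" "v i2 a3 < 0" using neg inI i a by metis+
    then have "0 < v i1 a2 * v i2 a3" "v i1 a3 * v i2 a2 < 0" using a(6) by (simp_all add: mult_neg_neg mult_neg_pos)
    then show False using par[OF inI(1,2) a(4,7)] by simp
  qed
  moreover have "card I2 \<le> card (heavy R t) + 1"
  proof (rule ccontr)
    assume "\<not> ?thesis"
    then have c2: "card (heavy R t) + 1 < card I2" by simp
    have fI2: "finite I2" using fI unfolding I2_def by simp
    have tgH: "tg ` I2 \<subseteq> heavy R t" using Iprop(2) unfolding I2_def I1_def by auto
    have fH: "finite (heavy R t)" by simp
    have pigeon: "\<exists>i\<in>J. \<exists>i'\<in>J. i \<noteq> i' \<and> tg i = tg i'" if "J \<subseteq> I2" "card (heavy R t) < card J" for J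
    proof (rule ccontr)
      assume "\<not> ?thesis"
      then have "inj_on tg J" by (auto simp: inj_on_def)
      then have "card J \<le> card (heavy R t)" using that tgH fH by (intro card_inj_on_le[of tg]) auto
      then show False using that by simp
    qed
    obtain i1 i2 where i12: "i1 \<in> I2" "i2 \<in> I2" "i1 \<noteq> i2" "tg i1 = tg i2" using pigeon[of I2] c2 by auto
    \<comment> \<open>A second collision is sought without \<open>i1\<close>: a point of
      \<open>cl t i1\<close> is then missing from the second pair, so the two relations are
      independent.\<close>
    have "card (heavy R t) < card (I2 - {i1})" using c2 i12 fI2 by simp
    then obtain i3 i4 where i34: "i3 \<in> I2 - {i1}" "i4 \<in> I2 - {i1}" "i3 \<noteq> i4" "tg i3 = tg i4" using pigeon[of "I2 - {i1}"] by auto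
    have inI: "i1 \<in> I" "i2 \<in> I" "i3 \<in> I" "i4 \<in> I" using i12 i34 unfolding I2_def by auto
    have vprop: "cdiff (cl t i) (cl t i') \<in> svec n R \<and> (\<forall>l<d. \<bar>lin n X (cdiff (cl t i) (cl t i')) l\<bar> \<le> 2 * \<delta>)"
      if "i \<in> I" "i' \<in> I" "tg i = tg i'" for i i'
    proof (intro conjI allI impI)
      note P = Iprop[OF that(1)] and P' = Iprop[OF that(2)]
      show "cdiff (cl t i) (cl t i') \<in> svec n R" using P(4,5) P'(4,5) cl_sub by (intro cdiff_svec) auto
      fix l assume l: "l < d"
      have "lin n X (cdiff (cl t i) (cl t i')) l = cen t i l - cen t i' l"
        using P(4) P'(4) cl_sub by (subst lin_cdiff) (auto simp: cen_nonempty)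
      then show "\<bar>lin n X (cdiff (cl t i) (cl t i')) l\<bar> \<le> 2 * \<delta>" using P(9)[OF l] P'(9)[OF l] that(3) by simp
    qed
    obtain a b where ab: "a \<in> cl t i1" "b \<in> cl t i3" using Iprop(4) inI by blast
    have abn: "a < n" "b < n" using ab cl_sub by blast+
    have pos: "0 < card (cl t i)" if "i \<in> I" for i using Iprop(4)[OF that] by (simp add: card_gt_0_iff)
    have va: "cdiff (cl t i1) (cl t i2) a \<noteq> 0" "cdiff (cl t i3) (cl t i4) a = 0" "cdiff (cl t i3) (cl t i4) b \<noteq> 0"
      using disj[OF ab(1)] disj[OF ab(2)] ab i12 i34 pos inI unfolding cdiff_def by auto
    then have np: "cdiff (cl t i1) (cl t i2) a * cdiff (cl t i3) (cl t i4) b \<noteq> cdiff (cl t i1) (cl t i2) b * cdiff (cl t i3) (cl t i4) a" by simp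
    have "two_relations n d R (2 * \<delta>) X" unfolding two_relations_def
      using vprop[OF inI(1,2) i12(4)] vprop[OF inI(3,4) i34(4)] np abn by blast
    then show False using norel2 by simp
  qed
  moreover have "card I = card I1 + card I2"
    unfolding I2_def using fI by (subst card_Un_disjoint[symmetric]) (auto simp: I1_def intro: arg_cong[where f=card])
  ultimately show ?thesis unfolding I_def[symmetric] by simp
qed

lemma close_count: "card {p \<in> moved t. close \<delta> t p} \<le> 8 * d * card (asg t ` {p \<in> moved t. close \<delta> t p})"
proof (rule card_le_fibers)
  fix i assume "i \<in> asg t ` {p \<in> moved t. close \<delta> t p}"
  then obtain p where p: "p \<in> moved t" "close \<delta> t p" "i = asg t p" by auto
  have "{q \<in> {p \<in> moved t. close \<delta> t p}. asg t q = i} \<subseteq> cl t i" using moved_ends(3) by blast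
  then have "card {q \<in> {p \<in> moved t. close \<delta> t p}. asg t q = i} \<le> card (cl t (asg t p) \<union> cl t (asg (Suc t) p))"
    using p(3) by (intro card_mono) auto
  then show "card {q \<in> {p \<in> moved t. close \<delta> t p}. asg t q = i} \<le> 8 * d" using close_small[OF p(1,2)] by simp
qed simp

end
end

lemma sum_card_fibers:
  assumes "finite S" "finite V"
  shows "(\<Sum>j\<in>V. card {p \<in> S. f p = j}) = card {p \<in> S. f p \<in> V}"
proof -
  have "card (\<Union>j\<in>V. {p \<in> S. f p = j}) = (\<Sum>j\<in>V. card {p \<in> S. f p = j})"
    using assms by (intro card_UN_disjoint) auto
  moreover have "(\<Union>j\<in>V. {p \<in> S. f p = j}) = {p \<in> S. f p \<in> V}" by auto
  ultimately show ?thesis by simp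
qed

section \<open>Excluding heavy clusters by blueprints\<close>

context kmeans begin

context
  fixes w \<delta> D \<nu> :: real and Z1 Z2 :: int and \<mu> :: "nat \<Rightarrow> nat \<Rightarrow> real" and \<kappa> R s t :: nat
  assumes nf: "nullfree" and w: "0 < w" and norel1: "\<not> one_relation n d R (20 * real n ^ 2 * w) X"
    and norel2: "\<not> two_relations n d R (2 * \<delta>) X" and noslab: "\<not> crowded_slab n d (8 * d) (real n * real d * \<delta>) X"
    and nobp: "\<not> blueprint_bad n d k \<kappa> D w \<delta> Z1 Z2 \<mu> X"
    and R: "R = 80 * \<kappa> * d" and \<kappa>: "0 < \<kappa>" "k \<le> \<kappa> * \<kappa>" and w\<delta>: "4 * real n ^ 2 * w \<le> \<delta>" and wD: "w \<le> D"
    and boxD: "\<And>p l. p < n \<Longrightarrow> l < d \<Longrightarrow> \<bar>X p l\<bar> \<le> D" and box\<mu>: "\<And>p l. p < n \<Longrightarrow> l < d \<Longrightarrow> \<bar>X p l - \<mu> p l\<bar> \<le> \<nu>"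
    and Z1: "D \<le> w * (real_of_int Z1 - 1)" and Z2: "real n * (w + \<nu>) \<le> w * (real_of_int Z2 - 1)"
    and ts: "t = Suc s" and drop: "pot t - pot (Suc t) \<le> w\<^sup>2"
    and act: "\<And>i. i < k \<Longrightarrow> last_cl (Suc t) i \<noteq> {} \<Longrightarrow> last_cl s i \<noteq> {}"
begin

lemmas ctx = nf w norel1 norel2 noslab R \<kappa>(1) w\<delta> ts drop act
lemmas t_pos = tpos[OF ctx]
lemmas mends = moved_ends[OF ctx]
lemmas core = blueprint_core[OF w wD d\<delta>(3)[OF ctx] boxD box\<mu> Z1 Z2 t_pos drop]

text \<open>At most 8 k d exchanges are close. If more than 16 k d points moved, 8 k d far exchanges
  would remain, enough to pay for rounding all centers in the box without using any balance. The
  bound keeps the number of blueprints at n^O(k d).\<close>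

lemma not_dense: "card (moved t) \<le> 16 * k * d"
proof (rule ccontr)
  assume big: "\<not> ?thesis"
  let ?C = "{p \<in> moved t. close \<delta> t p}" and ?F = "{p \<in> moved t. \<not> close \<delta> t p}"
  have "card (asg t ` ?C) \<le> k" using card_mono[of "{..<k}" "asg t ` ?C"] asg_lt by auto
  then have "8 * d * card (asg t ` ?C) \<le> 8 * d * k" by simp
  then have "card ?C \<le> 8 * d * k" using close_count[OF ctx] by linarith
  moreover have "card (moved t) = card ?C + card ?F"
    by (subst card_Un_disjoint[symmetric]) (auto intro: arg_cong[where f=card])
  ultimately have "8 * k * d \<le> card ?F" using big by (simp add: mult_ac)
  then obtain Gd where G: "Gd \<subseteq> ?F" "card Gd = 8 * k * d" by (meson obtain_subset_with_card_n)
  have Gm: "Gd \<subseteq> moved t" using G by auto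
  let ?H = "asg t ` Gd \<union> asg (Suc t) ` Gd"
  have Hk: "?H \<subseteq> {..<k}" using asg_lt by auto
  then have cH: "card ?H \<le> k" using card_mono[of "{..<k}" ?H] by simp
  have "blueprint_bad n d k \<kappa> D w \<delta> Z1 Z2 \<mu> X"
  proof (rule core[where M = Gd and Gd = Gd and \<Lambda> = "{}" and H = ?H and e = "\<lambda>_. 0" and rk = "\<lambda>_. 0"])
    show "last_cl t j \<noteq> {}" if "j \<in> {} \<union> ?H" for j using that mends(7,8) Gm by blast
    show "\<delta>\<^sup>2 < sqdist d (cen t (asg t p)) (cen t (asg (Suc t) p))" if "p \<in> Gd" for p
      using that G unfolding close_def by (auto simp: not_le)
    show "8 * d * card ?H \<le> card Gd" unfolding G(2) using cH by (simp add: mult_ac)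
    show "k * d \<le> \<kappa> * card Gd" unfolding G(2) using \<kappa>(1) by (cases \<kappa>) auto
    show "8 \<le> card Gd" unfolding G(2) using kpos dpos by (simp add: mult_ac)
  qed (use Gm G Hk in auto)
  then show False using nobp by simp
qed

text \<open>Take the components of the exchange graph that contain a heavy cluster. A breadth-first
  forest rooted at the heavy clusters gives each light one an edge to a smaller level, reserved for
  resolving its balance. The edges that are neither reserved nor close serve as bisector
  constraints; counting degrees shows that there are enough of them.\<close>

lemma no_heavy: "heavy R t = {}"
proof (rule ccontr)
  let ?Hv = "heavy R t"
  assume ne: "?Hv \<noteq> {}"
  define adj where "adj i j \<longleftrightarrow> (\<exists>p\<in>moved t. (asg t p = i \<and> asg (Suc t) p = j) \<or> (asg t p = j \<and> asg (Suc t) p = i))" for i j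
  define lev where "lev m = ((\<lambda>S. S \<union> {j. \<exists>i\<in>S. adj i j}) ^^ m) ?Hv" for m
  have lev0: "lev 0 = ?Hv" and levS: "lev (Suc m) = lev m \<union> {j. \<exists>i\<in>lev m. adj i j}" for m unfolding lev_def by simp_all
  define V where "V = (\<Union>m. lev m)"
  define rk where "rk j = (LEAST m. j \<in> lev m)" for j
  have HvV: "?Hv \<subseteq> V" unfolding V_def using lev0 by blast
  have Vclosed: "j \<in> V" if "i \<in> V" "adj i j" for i j using that levS unfolding V_def by blast
  have rk_in: "j \<in> lev (rk j)" if "j \<in> V" for j using that unfolding V_def rk_def by (auto intro: LeastI)
  have rk_le: "rk j \<le> m" if "j \<in> lev m" for j m using that unfolding rk_def by (rule Least_le)
  have incident: "\<exists>p\<in>moved t. asg t p = j \<or> asg (Suc t) p = j" if "j \<in> V" for j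
  proof (cases "j \<in> ?Hv")
    case True
    then have "0 < deg t j" by auto
    then have "{p \<in> moved t. asg t p = j \<or> asg (Suc t) p = j} \<noteq> {}" unfolding deg_def by (auto simp: card_gt_0_iff)
    then show ?thesis by auto
  next
    case False
    have "rk j \<noteq> 0" using rk_in[OF that] False lev0 by (metis)
    then obtain m where m: "rk j = Suc m" using not0_implies_Suc by blast
    have "j \<notin> lev m" using rk_le[of j m] m by auto
    then have "\<exists>i\<in>lev m. adj i j" using rk_in[OF that] levS unfolding m by blast
    then show ?thesis unfolding adj_def by blast
  qed
  have Vk: "V \<subseteq> {..<k}" using incident asg_lt by blast
  have fV: "finite V" using Vk finite_subset by blast
  have Vact: "last_cl t j \<noteq> {}" if "j \<in> V" for j using incident[OF that] mends(7,8) by blast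
  define \<Lambda> where "\<Lambda> = V - ?Hv"
  have "\<forall>j\<in>\<Lambda>. \<exists>p\<in>moved t. \<exists>i. i \<in> V \<and> rk i < rk j \<and> ((asg t p = i \<and> asg (Suc t) p = j) \<or> (asg t p = j \<and> asg (Suc t) p = i))"
  proof
    fix j assume j: "j \<in> \<Lambda>"
    then have jV: "j \<in> V" "j \<notin> ?Hv" unfolding \<Lambda>_def by auto
    have "rk j \<noteq> 0" using rk_in[OF jV(1)] jV(2) lev0 by metis
    then obtain m where m: "rk j = Suc m" using not0_implies_Suc by blast
    have "j \<notin> lev m" using rk_le[of j m] m by auto
    then obtain i where i: "i \<in> lev m" "adj i j" using rk_in[OF jV(1)] levS unfolding m by blast
    have "i \<in> V" "rk i < rk j" using i(1) rk_le[OF i(1)] m unfolding V_def by auto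
    then show "\<exists>p\<in>moved t. \<exists>i. i \<in> V \<and> rk i < rk j \<and> ((asg t p = i \<and> asg (Suc t) p = j) \<or> (asg t p = j \<and> asg (Suc t) p = i))"
      using i(2) unfolding adj_def by blast
  qed
  then obtain e where e: "\<And>j. j \<in> \<Lambda> \<Longrightarrow> e j \<in> moved t \<and> (\<exists>i. i \<in> V \<and> rk i < rk j \<and> ((asg t (e j) = i \<and> asg (Suc t) (e j) = j) \<or> (asg t (e j) = j \<and> asg (Suc t) (e j) = i)))"
    by metis
  define M where "M = {p \<in> moved t. asg t p \<in> V}"
  have Vboth: "asg t p \<in> V \<longleftrightarrow> asg (Suc t) p \<in> V" if "p \<in> moved t" for p
    using Vclosed[of "asg t p" "asg (Suc t) p"] Vclosed[of "asg (Suc t) p" "asg t p"] that unfolding adj_def by blast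
  have fM: "finite M" unfolding M_def by simp
  have Msub: "M \<subseteq> moved t" unfolding M_def by auto
  have cM: "card M \<le> 16 * k * d" using card_mono[OF finite_moved Msub] not_dense by simp
  have eM: "e j \<in> M" if "j \<in> \<Lambda>" for j
    using e[OF that] Vboth[of "e j"] that unfolding M_def \<Lambda>_def by auto
  define Gd where "Gd = {p \<in> M. p \<notin> e ` \<Lambda> \<and> \<not> close \<delta> t p}"
  let ?C = "{p \<in> moved t. close \<delta> t p}"
  have f\<Lambda>: "finite \<Lambda>" using fV unfolding \<Lambda>_def by simp
  have degsum: "(\<Sum>j\<in>V. deg t j) = 2 * card M"
  proof -
    have "deg t j = card {p \<in> moved t. asg t p = j} + card {p \<in> moved t. asg (Suc t) p = j}" for j
      unfolding deg_def by (subst card_Un_disjoint[symmetric]) (auto simp: moved_def intro!: arg_cong[where f=card])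
    then have "(\<Sum>j\<in>V. deg t j) = card {p \<in> moved t. asg t p \<in> V} + card {p \<in> moved t. asg (Suc t) p \<in> V}"
      using sum_card_fibers[OF finite_moved fV] by (simp add: sum.distrib)
    moreover have "{p \<in> moved t. asg (Suc t) p \<in> V} = M" "{p \<in> moved t. asg t p \<in> V} = M" unfolding M_def using Vboth by auto
    ultimately show ?thesis by simp
  qed
  have lightdeg: "2 \<le> deg t j" "deg t j \<le> R" "0 < deg t j" if "j \<in> \<Lambda>" for j
  proof -
    have jV: "j \<in> V" "j \<notin> ?Hv" "j < k" using that Vk unfolding \<Lambda>_def by auto
    have "{p \<in> moved t. asg t p = j \<or> asg (Suc t) p = j} \<noteq> {}" using incident[OF jV(1)] by auto
    then have "0 < deg t j" unfolding deg_def by (simp add: card_gt_0_iff)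
    moreover have "deg t j \<noteq> 1" using deg_not_1[OF ctx jV(3)] .
    ultimately show "2 \<le> deg t j" "0 < deg t j" by auto
    show "deg t j \<le> R" using jV by auto
  qed
  have "V = \<Lambda> \<union> ?Hv" "\<Lambda> \<inter> ?Hv = {}" using HvV unfolding \<Lambda>_def by auto
  then have "2 * card M = (\<Sum>j\<in>\<Lambda>. deg t j) + (\<Sum>j\<in>?Hv. deg t j)"
    unfolding degsum[symmetric] using f\<Lambda> by (simp add: sum.union_disjoint)
  moreover have "(\<Sum>j\<in>\<Lambda>. 2) \<le> (\<Sum>j\<in>\<Lambda>. deg t j)" using lightdeg by (intro sum_mono) auto
  moreover have "(\<Sum>j\<in>?Hv. R) \<le> (\<Sum>j\<in>?Hv. deg t j)" by (intro sum_mono) auto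
  ultimately have M2: "2 * card \<Lambda> + card ?Hv * R \<le> 2 * card M" by simp
  have "M \<subseteq> Gd \<union> e ` \<Lambda> \<union> ?C" using Msub unfolding Gd_def by auto
  then have "card M \<le> card (Gd \<union> e ` \<Lambda> \<union> ?C)" using f\<Lambda> fM by (intro card_mono) (auto simp: Gd_def)
  also have "\<dots> \<le> card Gd + card (e ` \<Lambda>) + card ?C"
    by (intro order_trans[OF card_Un_le] add_mono card_Un_le order_refl)
  also have "\<dots> \<le> card Gd + card \<Lambda> + 8 * d * (card ?Hv + 3)"
  proof -
    have "8 * d * card (asg t ` ?C) \<le> 8 * d * (card ?Hv + 3)" using close_sources[OF ctx] by (intro mult_left_mono) auto
    then have "card ?C \<le> 8 * d * (card ?Hv + 3)" using close_count[OF ctx] by linarith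
    then show ?thesis using card_image_le[OF f\<Lambda>, of e] by simp
  qed
  finally have M1: "card M \<le> card Gd + card \<Lambda> + 8 * d * (card ?Hv + 3)" .
  have h1: "1 \<le> card ?Hv" using ne by (simp add: Suc_le_eq card_gt_0_iff)
  \<comment> \<open>With h heavy clusters, 2 |M| \<ge> 2 |\<Lambda>| + 80 h \<kappa> d and |M| \<le>
    |Gd| + |\<Lambda>| + 32 h \<kappa> d leave |Gd| \<ge> 8 h \<kappa> d. The 80 in \<open>R\<close>
    is chosen for this.\<close>
  have big: "8 * (card ?Hv * (\<kappa> * d)) \<le> card Gd"
  proof -
    have "8 * d * (card ?Hv + 3) \<le> 8 * d * (4 * card ?Hv)" using h1 by (intro mult_left_mono) auto
    also have "\<dots> = 32 * (card ?Hv * d)" by simp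
    also have "\<dots> \<le> 32 * (card ?Hv * (\<kappa> * d))" using \<kappa>(1) by simp
    finally have "8 * d * (card ?Hv + 3) \<le> 32 * (card ?Hv * (\<kappa> * d))" .
    moreover have "card ?Hv * R = 80 * (card ?Hv * (\<kappa> * d))" unfolding R by simp
    ultimately show ?thesis using M1 M2 by linarith
  qed
  have "blueprint_bad n d k \<kappa> D w \<delta> Z1 Z2 \<mu> X"
  proof (rule core[where M = M and Gd = Gd and \<Lambda> = \<Lambda> and H = ?Hv and e = e and rk = rk])
    show "M \<subseteq> moved t" "card M \<le> 16 * k * d" by fact+
    show "Gd \<subseteq> M" unfolding Gd_def by auto
    show "\<Lambda> \<subseteq> {..<k}" "?Hv \<subseteq> {..<k}" "\<Lambda> \<inter> ?Hv = {}" using Vk unfolding \<Lambda>_def by auto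
    show "last_cl t j \<noteq> {}" if "j \<in> \<Lambda> \<union> ?Hv" for j using that Vact HvV unfolding \<Lambda>_def by blast
    show "asg t p \<in> \<Lambda> \<union> ?Hv \<and> asg (Suc t) p \<in> \<Lambda> \<union> ?Hv" if "p \<in> Gd" for p
    proof -
      have "p \<in> moved t" "asg t p \<in> V" using that unfolding Gd_def M_def by auto
      then have "asg t p \<in> V" "asg (Suc t) p \<in> V" using Vboth by auto
      then show ?thesis unfolding \<Lambda>_def by blast
    qed
    show "\<delta>\<^sup>2 < sqdist d (cen t (asg t p)) (cen t (asg (Suc t) p))" if "p \<in> Gd" for p
      using that unfolding Gd_def close_def by (auto simp: not_le)
    show "p \<in> M" if "j \<in> \<Lambda>" "p \<in> moved t" "asg t p = j \<or> asg (Suc t) p = j" for j p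
      using that Vboth[OF that(2)] unfolding M_def \<Lambda>_def by auto
    show "bal t j \<noteq> 0" if "j \<in> \<Lambda>" for j
      using light_unbalanced[OF w norel1 t_pos drop _ lightdeg(2,3)[OF that]] that Vk unfolding \<Lambda>_def by auto
    show "e j \<in> M - Gd \<and> (asg t (e j) = j \<or> asg (Suc t) (e j) = j)" if "j \<in> \<Lambda>" for j
      using eM[OF that] e[OF that] that unfolding Gd_def by auto
    show "asg t (e j') \<noteq> j \<and> asg (Suc t) (e j') \<noteq> j" if "j \<in> \<Lambda>" "j' \<in> \<Lambda>" "j' \<noteq> j" "rk j' \<le> rk j" for j j'
      using e[OF that(2)] that(3,4) by auto
    have "8 * d * card ?Hv = 8 * (card ?Hv * (1 * d))" by simp
    also have "\<dots> \<le> 8 * (card ?Hv * (\<kappa> * d))" using \<kappa>(1) by (intro mult_left_mono mult_right_mono) auto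
    finally show "8 * d * card ?Hv \<le> card Gd" using big by linarith
    \<comment> \<open>The square root enters here: one heavy cluster already yields 8 \<kappa> d
      good edges, and \<kappa>^2 \<ge> k.\<close>
    have "k * d \<le> \<kappa> * \<kappa> * d" using \<kappa>(2) by (intro mult_right_mono) auto
    also have "\<dots> \<le> \<kappa> * (8 * (card ?Hv * (\<kappa> * d)))" using h1 by simp
    also have "\<dots> \<le> \<kappa> * card Gd" using big by (intro mult_left_mono) auto
    finally show "k * d \<le> \<kappa> * card Gd" .
    have "8 * (1 * (1 * 1)) \<le> 8 * (card ?Hv * (\<kappa> * d))" using h1 \<kappa>(1) dpos by (intro mult_left_mono mult_mono) auto
    then show "8 \<le> card Gd" using big by linarith
  qed
  then show False using nobp by simp
qed

end

text \<open>A small drop over the window is small in each iteration, so no cluster is heavy and the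
  argument for light windows applies. The window is preceded by time s because an iteration at t
  also refers to the centers of t - 1, which formed the clusters of time t.\<close>

lemma window_drop:
  fixes w \<delta> D \<nu> :: real and Z1 Z2 :: int and \<mu> :: "nat \<Rightarrow> nat \<Rightarrow> real" and \<kappa> R s :: nat
  assumes nf: "nullfree" and w: "0 < w" and norel1: "\<not> one_relation n d R (20 * real n ^ 2 * w) X"
    and norel2: "\<not> two_relations n d R (2 * \<delta>) X" and noslab: "\<not> crowded_slab n d (8 * d) (real n * real d * \<delta>) X"
    and nobp: "\<not> blueprint_bad n d k \<kappa> D w \<delta> Z1 Z2 \<mu> X"
    and R: "R = 80 * \<kappa> * d" and \<kappa>: "0 < \<kappa>" "k \<le> \<kappa> * \<kappa>" and w\<delta>: "4 * real n ^ 2 * w \<le> \<delta>" and wD: "w \<le> D"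
    and boxD: "\<And>p l. p < n \<Longrightarrow> l < d \<Longrightarrow> \<bar>X p l\<bar> \<le> D" and box\<mu>: "\<And>p l. p < n \<Longrightarrow> l < d \<Longrightarrow> \<bar>X p l - \<mu> p l\<bar> \<le> \<nu>"
    and Z1: "D \<le> w * (real_of_int Z1 - 1)" and Z2: "real n * (w + \<nu>) \<le> w * (real_of_int Z2 - 1)"
    and act: "\<And>i. i < k \<Longrightarrow> last_cl (s + 1 + 5 * (k + 1)) i \<noteq> {} \<Longrightarrow> last_cl s i \<noteq> {}"
    and ns: "\<And>t. s < t \<Longrightarrow> t < s + 1 + 5 * (k + 1) \<Longrightarrow> \<not> same_centers (Suc t) t"
  shows "w\<^sup>2 < pot (s + 1) - pot (s + 1 + 5 * (k + 1))"
proof (rule ccontr)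
  assume h: "\<not> ?thesis"
  let ?L = "5 * (k + 1)"
  have drops: "pot t - pot (Suc t) \<le> w\<^sup>2" if "s + 1 \<le> t" "t < s + 1 + ?L" for t
    using pot_mono[of "s + 1" t] pot_mono[of "Suc t" "s + 1 + ?L"] h that by simp
  show False
  proof (rule all_light_window[OF w norel1, of "s + 1" ?L])
    show "pot (s + 1) - pot (s + 1 + ?L) \<le> w\<^sup>2" using h by simp
    show "pot (Suc t) < pot t" if "s + 1 \<le> t" "t < s + 1 + ?L" for t using ns[of t] that by (intro pot_strict) auto
    fix t j assume tj: "s + 1 \<le> t" "t < s + 1 + ?L" "j < k"
    then obtain s' where s': "t = Suc s'" by (cases t) auto
    have act': "last_cl s' i \<noteq> {}" if "i < k" "last_cl (Suc t) i \<noteq> {}" for i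
    proof -
      have "last_cl (s + 1 + ?L) i \<noteq> {}" using last_cl_mono[of "Suc t" "s + 1 + ?L" i] tj that by simp
      then have "last_cl s i \<noteq> {}" using act that by simp
      then show ?thesis using last_cl_mono[of s s' i] tj s' by simp
    qed
    have "heavy R t = {}"
      by (rule no_heavy[OF nf w norel1 norel2 noslab nobp R \<kappa> w\<delta> wD boxD box\<mu> Z1 Z2 s' drops[OF tj(1,2)] act'])
    then have "j \<notin> heavy R t" by simp
    then show "deg t j \<le> R" using tj(3) by simp
  qed auto
qed


text \<open>Cut the run into blocks of length l. Blocks in which no cluster becomes nonempty for the
  first time lower the potential by \<epsilon>, and these drops telescope to at most P. Any other
  block uses up the first filling of some cluster, so there are at most k of them.\<close>

lemma iterations_le:
  fixes P \<epsilon> :: real and l T :: nat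
  assumes l: "0 < l" and \<epsilon>: "0 < \<epsilon>" and P: "pot 1 \<le> P"
    and T: "\<And>t. t + 2 < T \<Longrightarrow> \<not> same_centers (Suc t) t"
    and window: "\<And>s. (\<And>i. i < k \<Longrightarrow> last_cl (s + l) i \<noteq> {} \<Longrightarrow> last_cl s i \<noteq> {}) \<Longrightarrow>
        (\<And>t. s < t \<Longrightarrow> t < s + l \<Longrightarrow> \<not> same_centers (Suc t) t) \<Longrightarrow> \<epsilon> < pot (s + 1) - pot (s + l)"
  shows "real T \<le> real l * (real k + 2 + P / \<epsilon>) + 2"
proof -
  \<comment> \<open>Only times t with t + 2 < T are known to change a center.\<close>
  define N where "N = (T - 2) div l"
  define A where "A = {b \<in> {..<N}. \<exists>i<k. last_cl (b * l + l) i \<noteq> {} \<and> last_cl (b * l) i = {}}"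
  have Nl: "N * l \<le> T - 2" unfolding N_def by simp
  have "\<forall>b\<in>A. \<exists>i<k. last_cl (b * l + l) i \<noteq> {} \<and> last_cl (b * l) i = {}" unfolding A_def by auto
  then obtain f where f: "\<And>b. b \<in> A \<Longrightarrow> f b < k \<and> last_cl (b * l + l) (f b) \<noteq> {} \<and> last_cl (b * l) (f b) = {}" by metis
  have "inj_on f A"
  proof (rule linorder_inj_onI)
    fix b b' assume b: "b < b'" "b \<in> A" "b' \<in> A"
    have "b * l + l \<le> b' * l" using b(1) by (metis Suc_leI add.commute mult_Suc mult_le_mono1)
    then show "f b \<noteq> f b'" using f[OF b(2)] f[OF b(3)] last_cl_mono[of "b * l + l" "b' * l"] by metis
  qed auto
  then have cA: "card A \<le> k" using f card_inj_on_le[of f A "{..<k}"] by auto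
  have good: "\<epsilon> \<le> pot (b * l + 1) - pot (Suc b * l + 1)" if b: "b \<in> {..<N} - A" for b
  proof -
    have "b * l + l \<le> N * l" using b by (metis DiffD1 Suc_leI add.commute lessThan_iff mult_Suc mult_le_mono1)
    then have "\<epsilon> < pot (b * l + 1) - pot (b * l + l)"
      using b Nl unfolding A_def by (intro window T) auto
    moreover have "pot (Suc b * l + 1) \<le> pot (b * l + l)" by (rule pot_mono) simp
    ultimately show ?thesis by simp
  qed
  have "real (N - k) * \<epsilon> \<le> real (card ({..<N} - A)) * \<epsilon>"
  proof (rule mult_right_mono)
    have "card ({..<N} - A) = N - card A" by (subst card_Diff_subset) (auto simp: A_def)
    then show "real (N - k) \<le> real (card ({..<N} - A))" using cA by simp
  qed (use \<epsilon> in simp)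
  also have "\<dots> = (\<Sum>b\<in>{..<N} - A. \<epsilon>)" by simp
  also have "\<dots> \<le> (\<Sum>b\<in>{..<N} - A. pot (b * l + 1) - pot (Suc b * l + 1))" using good by (rule sum_mono)
  also have "\<dots> \<le> (\<Sum>b<N. pot (b * l + 1) - pot (Suc b * l + 1))"
    by (rule sum_mono2) (auto intro!: pot_mono)
  also have "\<dots> = pot (0 * l + 1) - pot (N * l + 1)" by (rule sum_lessThan_telescope')
  also have "\<dots> \<le> P" using P pot_nonneg[of "N * l + 1"] by simp
  finally have "real (N - k) \<le> P / \<epsilon>" using \<epsilon> by (simp add: pos_le_divide_eq)
  then have "real N \<le> real k + P / \<epsilon>" by linarith
  moreover have "T \<le> l * (N + 1) + 2"
  proof -
    have "T - 2 < l * (N + 1)" unfolding N_def using l by (metis Suc_eq_plus1 dividend_less_times_div mult_Suc_right add.commute)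
    then show ?thesis by simp
  qed
  then have "real T \<le> real l * (real N + 1) + 2" by (metis (no_types, lifting) of_nat_1 of_nat_add of_nat_le_iff of_nat_mult of_nat_numeral)
  moreover have "real l * (real N + 1) \<le> real l * (real k + 2 + P / \<epsilon>)" using calculation(1) by (intro mult_left_mono) auto
  ultimately show ?thesis by linarith
qed

text \<open>At time 1 every center in use is already a centroid of points in the box, whatever the
  initial centers were.\<close>

lemma pot_1_le:
  assumes "\<And>p l. p < n \<Longrightarrow> l < d \<Longrightarrow> \<bar>X p l\<bar> \<le> D"
  shows "pot 1 \<le> 4 * real n * real d * D\<^sup>2"
proof -
  have D: "0 \<le> D" using assms[OF npos dpos] by linarith
  have "pot 1 \<le> (\<Sum>p<n. \<Sum>l<d. (2 * D)\<^sup>2)"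
    unfolding pot_def sqdist_def
  proof (intro sum_mono)
    fix p l assume p: "p \<in> {..<n}" and l: "l \<in> {..<d}"
    have "cl 1 (asg 1 p) \<noteq> {}" using p by (auto simp: mem_cl)
    then have "\<bar>cen 1 (asg 1 p) l\<bar> \<le> D"
      using sum_box_le[of "cl 1 (asg 1 p)" X l D] assms D l cl_sub[of 1 "asg 1 p"] by (auto simp: cen_nonempty)
    moreover have "\<bar>X p l\<bar> \<le> D" using assms p l by auto
    ultimately have "\<bar>X p l - cen 1 (asg 1 p) l\<bar> \<le> \<bar>2 * D\<bar>" by linarith
    then show "(X p l - cen 1 (asg 1 p) l)\<^sup>2 \<le> (2 * D)\<^sup>2" by (simp only: abs_le_square_iff)
  qed
  also have "\<dots> = 4 * real n * real d * D\<^sup>2" by (simp add: power_mult_distrib)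
  finally show ?thesis .
qed

end

section \<open>Anti-concentration of Gaussian points\<close>

definition gauss :: "'i set \<Rightarrow> real \<Rightarrow> ('i \<Rightarrow> real) measure" where
  "gauss I \<sigma> = PiM I (\<lambda>_. density lborel (normal_density 0 \<sigma>))"

lemma sets_gauss [measurable_cong]: "sets (gauss I \<sigma>) = sets (PiM I (\<lambda>_. borel))"
  unfolding gauss_def by (intro sets_PiM_cong) auto

lemma prob_space_gauss: "0 < \<sigma> \<Longrightarrow> prob_space (gauss I \<sigma>)"
  unfolding gauss_def by (intro prob_space_PiM prob_space_normal_density)

text \<open>The density is at most 1 / (2 \<sigma>), because sqrt (2 pi) \<ge> 2, and the interval
  has length 2 \<tau> / |a|.\<close>

lemma normal_interval_le:
  fixes \<sigma> \<tau> a b :: real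
  assumes "0 < \<sigma>" "a \<noteq> 0" "0 \<le> \<tau>"
  shows "emeasure (density lborel (normal_density 0 \<sigma>)) {v. \<bar>b + a * v\<bar> \<le> \<tau>} \<le> ennreal (\<tau> / (\<bar>a\<bar> * \<sigma>))"
proof -
  let ?S = "{- b / a - \<tau> / \<bar>a\<bar> .. - b / a + \<tau> / \<bar>a\<bar>}"
  have S: "{v. \<bar>b + a * v\<bar> \<le> \<tau>} \<subseteq> ?S"
  proof
    fix v assume "v \<in> {v. \<bar>b + a * v\<bar> \<le> \<tau>}"
    then have h: "\<bar>b + a * v\<bar> \<le> \<tau>" by simp
    have "\<bar>v - (- b / a)\<bar> = \<bar>b + a * v\<bar> / \<bar>a\<bar>"
      using assms by (simp add: field_simps flip: abs_divide)
    also have "\<dots> \<le> \<tau> / \<bar>a\<bar>" using h by (intro divide_right_mono) auto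
    finally show "v \<in> ?S" by (simp add: abs_le_iff)
  qed
  have dens: "normal_density 0 \<sigma> x \<le> 1 / (2 * \<sigma>)" for x
  proof -
    have "sqrt (2 * pi * \<sigma>\<^sup>2) = sqrt (2 * pi) * \<sigma>"
      using assms by (simp add: real_sqrt_mult)
    moreover have "sqrt (2 * pi) \<ge> 2"
      using pi_gt3 by (intro real_le_rsqrt) auto
    ultimately have "sqrt (2 * pi * \<sigma>\<^sup>2) \<ge> 2 * \<sigma>" using assms by simp
    then have "1 / sqrt (2 * pi * \<sigma>\<^sup>2) \<le> 1 / (2 * \<sigma>)"
      using assms by (intro divide_left_mono) (auto intro!: mult_pos_pos)
    moreover have "exp (- (x - 0)\<^sup>2 / (2 * \<sigma>\<^sup>2)) \<le> 1" by simp
    ultimately show ?thesis unfolding normal_density_def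
      using mult_mono[of "1 / sqrt (2 * pi * \<sigma>\<^sup>2)" "1 / (2 * \<sigma>)" "exp (- (x - 0)\<^sup>2 / (2 * \<sigma>\<^sup>2))" 1] assms
      by simp
  qed
  have "emeasure (density lborel (normal_density 0 \<sigma>)) {v. \<bar>b + a * v\<bar> \<le> \<tau>}
      \<le> emeasure (density lborel (normal_density 0 \<sigma>)) ?S"
    using S by (intro emeasure_mono) auto
  also have "\<dots> = (\<integral>\<^sup>+ x. ennreal (normal_density 0 \<sigma> x) * indicator ?S x \<partial>lborel)"
    by (subst emeasure_density) auto
  also have "\<dots> \<le> (\<integral>\<^sup>+ x. ennreal (1 / (2 * \<sigma>)) * indicator ?S x \<partial>lborel)"
    using dens by (intro nn_integral_mono mult_right_mono ennreal_leI) auto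
  also have "\<dots> = ennreal (1 / (2 * \<sigma>)) * ennreal (2 * (\<tau> / \<bar>a\<bar>))"
    using assms by (subst nn_integral_cmult_indicator) auto
  also have "\<dots> = ennreal (\<tau> / (\<bar>a\<bar> * \<sigma>))"
    using assms by (simp add: field_simps flip: ennreal_mult)
  finally show ?thesis .
qed

text \<open>The coordinates \<^term>\<open>co b\<close> are integrated out in order of decreasing rank: each is confined
  to a short interval once all coordinates of lower rank are fixed.\<close>
lemma triangular_anticoncentration:
  fixes F :: "'b \<Rightarrow> ('i \<Rightarrow> real) \<Rightarrow> real" and rk :: "'b \<Rightarrow> nat" and \<alpha> \<tau> :: "'b \<Rightarrow> real"
  assumes "finite B" "finite I" "0 < \<sigma>" "inj_on co B" "co ` B \<subseteq> I"
    and "\<And>b. b \<in> B \<Longrightarrow> F b \<in> borel_measurable (gauss I \<sigma>)"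
    and "\<And>b. b \<in> B \<Longrightarrow> \<alpha> b \<noteq> 0" "\<And>b. b \<in> B \<Longrightarrow> 0 \<le> \<tau> b"
    and "\<And>b g v. b \<in> B \<Longrightarrow> F b (g(co b := v)) = F b (g(co b := 0)) + \<alpha> b * v"
    and "\<And>b b' g v. b \<in> B \<Longrightarrow> b' \<in> B \<Longrightarrow> b' \<noteq> b \<Longrightarrow> rk b \<le> rk b' \<Longrightarrow> F b (g(co b' := v)) = F b g"
  shows "emeasure (gauss I \<sigma>) {g \<in> space (gauss I \<sigma>). \<forall>b\<in>B. \<bar>F b g\<bar> \<le> \<tau> b}
    \<le> (\<Prod>b\<in>B. ennreal (\<tau> b / (\<bar>\<alpha> b\<bar> * \<sigma>)))"
  using assms
proof (induction "card B" arbitrary: B I F)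
  case 0
  then have "B = {}" by simp
  interpret prob_space "gauss I \<sigma>" using prob_space_gauss[OF 0(4)] .
  show ?case unfolding \<open>B = {}\<close> by (simp add: emeasure_space_1)
next
  case (Suc m B I F)
  note prems = Suc.prems and IH = Suc.hyps(1)
  have "B \<noteq> {}" using Suc.hyps(2) by auto
  have "\<exists>b0\<in>B. \<forall>b\<in>B. rk b \<le> rk b0"
  proof -
    have "Max (rk ` B) \<in> rk ` B" using \<open>B \<noteq> {}\<close> prems(1) by (intro Max_in) auto
    then obtain b0 where "b0 \<in> B" "rk b0 = Max (rk ` B)" by auto
    then show ?thesis using prems(1) by (intro bexI[of _ b0]) auto
  qed
  then obtain b0 where b0: "b0 \<in> B" "\<And>b. b \<in> B \<Longrightarrow> rk b \<le> rk b0" by blast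
  define q where "q = co b0"
  define J where "J = I - {q}"
  define B' where "B' = B - {b0}"
  have qI: "q \<in> I" using b0 prems(5) q_def by auto
  have I: "I = insert q J" "q \<notin> J" "finite J" using qI J_def prems(2) by auto
  have B: "B = insert b0 B'" "b0 \<notin> B'" "finite B'" using b0 B'_def prems(1) by auto
  have cardB': "m = card B'" using Suc.hyps(2) B by simp
  let ?N = "density lborel (normal_density 0 \<sigma>)"
  interpret N: prob_space ?N using prob_space_normal_density[OF prems(3)] .
  interpret product_sigma_finite "\<lambda>_::'i. ?N" by standard
  define F' where "F' = (\<lambda>b g. F b (g(q := 0)))"
  have upd: "(\<lambda>g. g(q := 0)) \<in> measurable (gauss J \<sigma>) (gauss I \<sigma>)"
  proof -
    have "(\<lambda>g. (\<lambda>(f, y). f(q := y)) (g, 0)) \<in> measurable (PiM J (\<lambda>_::'i. borel)) (PiM (insert q J) (\<lambda>_. borel :: real measure))"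
      by (rule measurable_compose[OF _ measurable_add_dim]) simp
    then show ?thesis using I by (simp cong: measurable_cong_sets add: sets_gauss)
  qed
  have F'm: "F' b \<in> borel_measurable (gauss J \<sigma>)" if "b \<in> B" for b
    unfolding F'_def using measurable_compose[OF upd prems(6)[OF that]] .
  let ?A = "{g \<in> space (gauss I \<sigma>). \<forall>b\<in>B. \<bar>F b g\<bar> \<le> \<tau> b}"
  let ?A' = "{g \<in> space (gauss J \<sigma>). \<forall>b\<in>B'. \<bar>F' b g\<bar> \<le> \<tau> b}"
  have Am: "?A \<in> sets (gauss I \<sigma>)" using prems(1,6) by measurable
  have A'm: "?A' \<in> sets (gauss J \<sigma>)" using B(3) F'm unfolding B'_def by measurable
  have coB': "co ` B' \<subseteq> J"
    using prems(4,5) b0 unfolding J_def B'_def q_def by (auto dest: inj_onD)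
  have IH': "emeasure (gauss J \<sigma>) ?A' \<le> (\<Prod>b\<in>B'. ennreal (\<tau> b / (\<bar>\<alpha> b\<bar> * \<sigma>)))"
  proof (rule IH[OF cardB' B(3) I(3) prems(3) _ coB'])
    show "inj_on co B'" using prems(4) B by (auto intro: inj_on_subset)
    show "F' b \<in> borel_measurable (gauss J \<sigma>)" if "b \<in> B'" for b using F'm that B by auto
    show "\<alpha> b \<noteq> 0" if "b \<in> B'" for b using prems(7) that B by auto
    show "0 \<le> \<tau> b" if "b \<in> B'" for b using prems(8) that B by auto
    fix b g v assume b: "b \<in> B'"
    then have ne: "co b \<noteq> q" using coB' J_def by auto
    show "F' b (g(co b := v)) = F' b (g(co b := 0)) + \<alpha> b * v"
      unfolding F'_def using prems(9)[of b "g(q := 0)" v] ne b B by (simp add: fun_upd_twist)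
    fix b' assume b': "b' \<in> B'" "b' \<noteq> b" "rk b \<le> rk b'"
    then have ne': "co b' \<noteq> q" using coB' J_def by auto
    show "F' b (g(co b' := v)) = F' b g"
      unfolding F'_def using prems(10)[of b b' "g(q := 0)" v] ne' b b' B by (simp add: fun_upd_twist)
  qed
  \<comment> \<open>Only the constraint of maximal rank sees q. Integrating q out first therefore
    yields its factor, uniformly in all other coordinates.\<close>
  have Fq: "F b (g(q := v)) = F b g" if "b \<in> B'" for b g v
    using prems(10)[of b b0 g v] b0 that B unfolding q_def by auto
  have "emeasure (gauss I \<sigma>) ?A = (\<integral>\<^sup>+ g. indicator ?A g \<partial>gauss I \<sigma>)" using Am by simp
  also have "\<dots> = (\<integral>\<^sup>+ g. (\<integral>\<^sup>+ y. indicator ?A (g(q := y)) \<partial>?N) \<partial>gauss J \<sigma>)"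
    unfolding I(1) gauss_def
    by (rule product_nn_integral_insert[OF I(3,2)]) (use Am I(1) in \<open>simp add: gauss_def\<close>)
  also have "\<dots> \<le> (\<integral>\<^sup>+ g. indicator ?A' g * ennreal (\<tau> b0 / (\<bar>\<alpha> b0\<bar> * \<sigma>)) \<partial>gauss J \<sigma>)"
  proof (rule nn_integral_mono)
    fix g assume g: "g \<in> space (gauss J \<sigma>)"
    have "(\<integral>\<^sup>+ y. indicator ?A (g(q := y)) \<partial>?N)
      \<le> (\<integral>\<^sup>+ y. indicator ?A' g * indicator {v. \<bar>F b0 (g(q := 0)) + \<alpha> b0 * v\<bar> \<le> \<tau> b0} y \<partial>?N)"
    proof (rule nn_integral_mono)
      fix y
      show "indicator ?A (g(q := y)) \<le> (indicator ?A' g * indicator {v. \<bar>F b0 (g(q := 0)) + \<alpha> b0 * v\<bar> \<le> \<tau> b0} y :: ennreal)"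
      proof (cases "g(q := y) \<in> ?A")
        case True
        then have *: "\<forall>b\<in>B. \<bar>F b (g(q := y))\<bar> \<le> \<tau> b" by auto
        have "g \<in> ?A'"
          using * g Fq B unfolding F'_def by auto
        moreover have "\<bar>F b0 (g(q := 0)) + \<alpha> b0 * y\<bar> \<le> \<tau> b0"
          using * prems(9)[of b0 g y] b0 unfolding q_def by auto
        ultimately show ?thesis by (simp add: indicator_def)
      qed simp
    qed
    also have "\<dots> = indicator ?A' g * emeasure ?N {v. \<bar>F b0 (g(q := 0)) + \<alpha> b0 * v\<bar> \<le> \<tau> b0}"
      by (subst nn_integral_cmult_indicator) auto
    also have "\<dots> \<le> indicator ?A' g * ennreal (\<tau> b0 / (\<bar>\<alpha> b0\<bar> * \<sigma>))"
      using prems b0 by (intro mult_left_mono normal_interval_le) auto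
    finally show "(\<integral>\<^sup>+ y. indicator ?A (g(q := y)) \<partial>?N) \<le> indicator ?A' g * ennreal (\<tau> b0 / (\<bar>\<alpha> b0\<bar> * \<sigma>))" .
  qed
  also have "\<dots> = emeasure (gauss J \<sigma>) ?A' * ennreal (\<tau> b0 / (\<bar>\<alpha> b0\<bar> * \<sigma>))"
    using A'm by (subst nn_integral_multc) auto
  also have "\<dots> \<le> (\<Prod>b\<in>B'. ennreal (\<tau> b / (\<bar>\<alpha> b\<bar> * \<sigma>))) * ennreal (\<tau> b0 / (\<bar>\<alpha> b0\<bar> * \<sigma>))"
    using IH' by (rule mult_right_mono) simp
  also have "\<dots> = (\<Prod>b\<in>B. ennreal (\<tau> b / (\<bar>\<alpha> b\<bar> * \<sigma>)))"
    using B by (simp add: mult.commute)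
  finally show ?case .
qed

section \<open>Probabilities of the degenerate configurations\<close>

text \<open>Outer probability at most q; this avoids proving that the event itself is measurable.\<close>
definition small_event :: "'a measure \<Rightarrow> ('a \<Rightarrow> bool) \<Rightarrow> real \<Rightarrow> bool" where
  "small_event M P q \<longleftrightarrow> (\<exists>A\<in>sets M. (\<forall>g\<in>space M. P g \<longrightarrow> g \<in> A) \<and> emeasure M A \<le> ennreal q)"

lemma small_event_mono:
  assumes "small_event M Q q" "\<And>g. g \<in> space M \<Longrightarrow> P g \<Longrightarrow> Q g" "q \<le> q'"
  shows "small_event M P q'"
  using assms unfolding small_event_def by (meson ennreal_leI order_trans)

lemma small_event_Union:
  assumes "finite S" "\<And>x. x \<in> S \<Longrightarrow> small_event M (P x) q" "real (card S) \<le> N" "0 \<le> q"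
  shows "small_event M (\<lambda>g. \<exists>x\<in>S. P x g) (N * q)"
proof -
  from assms(2) have "\<forall>x\<in>S. \<exists>A. A \<in> sets M \<and> (\<forall>g\<in>space M. P x g \<longrightarrow> g \<in> A) \<and> emeasure M A \<le> ennreal q"
    unfolding small_event_def by blast
  then obtain A where A: "\<And>x. x \<in> S \<Longrightarrow> A x \<in> sets M \<and> (\<forall>g\<in>space M. P x g \<longrightarrow> g \<in> A x) \<and> emeasure M (A x) \<le> ennreal q"
    by metis
  have "emeasure M (\<Union>x\<in>S. A x) \<le> (\<Sum>x\<in>S. emeasure M (A x))"
    using A assms(1) by (intro emeasure_subadditive_finite) auto
  also have "\<dots> \<le> (\<Sum>x\<in>S. ennreal q)" using A by (intro sum_mono) auto
  also have "\<dots> = ennreal (real (card S) * q)" using assms(4) by (simp add: ennreal_of_nat_eq_real_of_nat ennreal_mult)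
  also have "\<dots> \<le> ennreal (N * q)" using assms by (intro ennreal_leI mult_right_mono) auto
  finally show ?thesis unfolding small_event_def using A assms(1)
    by (intro bexI[of _ "\<Union>x\<in>S. A x"]) auto
qed

lemma small_event_or:
  assumes "small_event M P p" "small_event M Q q" "0 \<le> p" "0 \<le> q"
  shows "small_event M (\<lambda>g. P g \<or> Q g) (p + q)"
proof -
  obtain A B where A: "A \<in> sets M" "\<forall>g\<in>space M. P g \<longrightarrow> g \<in> A" "emeasure M A \<le> ennreal p"
    and B: "B \<in> sets M" "\<forall>g\<in>space M. Q g \<longrightarrow> g \<in> B" "emeasure M B \<le> ennreal q"
    using assms(1,2) unfolding small_event_def by blast
  have "emeasure M (A \<union> B) \<le> emeasure M A + emeasure M B" using A B by (intro emeasure_subadditive) auto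
  also have "\<dots> \<le> ennreal (p + q)" using A B assms by (simp add: add_mono)
  finally show ?thesis unfolding small_event_def using A B by (intro bexI[of _ "A \<union> B"]) auto
qed

definition pts :: "(nat \<Rightarrow> nat \<Rightarrow> real) \<Rightarrow> (nat \<times> nat \<Rightarrow> real) \<Rightarrow> nat \<Rightarrow> nat \<Rightarrow> real" where
  "pts \<mu> g p l = \<mu> p l + g (p, l)"

abbreviation "gaussm n d \<sigma> \<equiv> gauss ({..<n} \<times> {..<d}) \<sigma>"

lemma small_event_triangular:
  fixes F :: "'b \<Rightarrow> ('i \<Rightarrow> real) \<Rightarrow> real" and rk :: "'b \<Rightarrow> nat" and \<alpha> \<tau> \<beta> :: "'b \<Rightarrow> real"
  assumes "finite B" "finite I" "0 < \<sigma>" "inj_on co B" "co ` B \<subseteq> I"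
    and "\<And>b. b \<in> B \<Longrightarrow> F b \<in> borel_measurable (gauss I \<sigma>)"
    and "\<And>b. b \<in> B \<Longrightarrow> \<alpha> b \<noteq> 0" "\<And>b. b \<in> B \<Longrightarrow> 0 \<le> \<tau> b"
    and "\<And>b g v. b \<in> B \<Longrightarrow> F b (g(co b := v)) = F b (g(co b := 0)) + \<alpha> b * v"
    and "\<And>b b' g v. b \<in> B \<Longrightarrow> b' \<in> B \<Longrightarrow> b' \<noteq> b \<Longrightarrow> rk b \<le> rk b' \<Longrightarrow> F b (g(co b' := v)) = F b g"
    and \<beta>: "\<And>b. b \<in> B \<Longrightarrow> \<tau> b / (\<bar>\<alpha> b\<bar> * \<sigma>) \<le> \<beta> b"
  shows "small_event (gauss I \<sigma>) (\<lambda>g. \<forall>b\<in>B. \<bar>F b g\<bar> \<le> \<tau> b) (\<Prod>b\<in>B. \<beta> b)"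
proof -
  have nn: "0 \<le> \<tau> b / (\<bar>\<alpha> b\<bar> * \<sigma>)" if "b \<in> B" for b using assms(8)[OF that] assms(3) by simp
  have "emeasure (gauss I \<sigma>) {g \<in> space (gauss I \<sigma>). \<forall>b\<in>B. \<bar>F b g\<bar> \<le> \<tau> b} \<le> (\<Prod>b\<in>B. ennreal (\<tau> b / (\<bar>\<alpha> b\<bar> * \<sigma>)))"
    by (rule triangular_anticoncentration[OF assms(1-10)])
  also have "\<dots> = ennreal (\<Prod>b\<in>B. \<tau> b / (\<bar>\<alpha> b\<bar> * \<sigma>))" using nn by (intro prod_ennreal) auto
  also have "\<dots> \<le> ennreal (\<Prod>b\<in>B. \<beta> b)" using nn \<beta> by (intro ennreal_leI prod_mono) auto
  finally show ?thesis unfolding small_event_def using assms(1,6)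
    by (intro bexI[of _ "{g \<in> space (gauss I \<sigma>). \<forall>b\<in>B. \<bar>F b g\<bar> \<le> \<tau> b}"]) auto
qed

lemma coord_measurable: "p < n \<Longrightarrow> l < d \<Longrightarrow> (\<lambda>g. g (p, l)) \<in> borel_measurable (gaussm n d \<sigma>)"
proof -
  assume "p < n" "l < d"
  then have "(\<lambda>g. g (p, l)) \<in> borel_measurable (PiM ({..<n} \<times> {..<d}) (\<lambda>_. borel :: real measure))"
    by (intro measurable_component_singleton) auto
  then show ?thesis by (simp cong: measurable_cong_sets add: sets_gauss)
qed

lemma pts_measurable: "p < n \<Longrightarrow> l < d \<Longrightarrow> (\<lambda>g. pts \<mu> g p l) \<in> borel_measurable (gaussm n d \<sigma>)"
  unfolding pts_def by (intro borel_measurable_add coord_measurable) auto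

lemma lin_measurable: "l < d \<Longrightarrow> (\<lambda>g. lin n (pts \<mu> g) v l) \<in> borel_measurable (gaussm n d \<sigma>)"
  unfolding lin_def by (intro borel_measurable_sum borel_measurable_times pts_measurable) auto

lemma lin_upd:
  "lin n (pts \<mu> (g((p, l) := x))) v l = lin n (pts \<mu> (g((p, l) := 0))) v l + v p * x" if "p < n"
proof -
  have e: "lin n (pts \<mu> (g((p, l) := y))) v l = (\<Sum>q\<in>{..<n} - {p}. v q * pts \<mu> g q l) + v p * (\<mu> p l + y)" for y
  proof -
    have "lin n (pts \<mu> (g((p, l) := y))) v l = v p * pts \<mu> (g((p, l) := y)) p l + (\<Sum>q\<in>{..<n} - {p}. v q * pts \<mu> (g((p, l) := y)) q l)"
      unfolding lin_def using that by (subst sum.remove[of _ p]) auto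
    also have "(\<Sum>q\<in>{..<n} - {p}. v q * pts \<mu> (g((p, l) := y)) q l) = (\<Sum>q\<in>{..<n} - {p}. v q * pts \<mu> g q l)"
      by (intro sum.cong) (auto simp: pts_def)
    also have "pts \<mu> (g((p, l) := y)) p l = \<mu> p l + y" by (simp add: pts_def)
    finally show ?thesis by (simp only: add.commute)
  qed
  show ?thesis unfolding e by (simp add: algebra_simps)
qed

lemma lin_indep: "l' \<noteq> l \<or> v p = 0 \<Longrightarrow> lin n (pts \<mu> (g((p, l') := x))) v l = lin n (pts \<mu> g) v l"
  unfolding lin_def pts_def by (intro sum.cong) auto

lemma svec_entry:
  assumes "v \<in> svec n R"
  shows "\<exists>a b z. a \<noteq> 0 \<and> b \<noteq> 0 \<and> \<bar>a\<bar> \<le> int n \<and> \<bar>b\<bar> \<le> int n \<and> (\<forall>p. v p = real_of_int (z p) / (real_of_int a * real_of_int b))"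
    and "\<bar>v p\<bar> \<le> 2"
proof -
  obtain G L a G' L' b where ab: "a \<noteq> 0" "b \<noteq> 0" "\<bar>a\<bar> \<le> int n" "\<bar>b\<bar> \<le> int n" and
    v: "v = (\<lambda>p. (indicat_real G p - indicat_real L p) / real_of_int a - (indicat_real G' p - indicat_real L' p) / real_of_int b)"
    using assms unfolding svec_def Let_def by auto
  define z where "z p = (of_bool (p \<in> G) - of_bool (p \<in> L)) * b - (of_bool (p \<in> G') - of_bool (p \<in> L')) * a" for p
  have "v p = real_of_int (z p) / (real_of_int a * real_of_int b)" for p
    unfolding v z_def using ab by (simp add: field_simps indicator_def)
  then show "\<exists>a b z. a \<noteq> 0 \<and> b \<noteq> 0 \<and> \<bar>a\<bar> \<le> int n \<and> \<bar>b\<bar> \<le> int n \<and> (\<forall>p. v p = real_of_int (z p) / (real_of_int a * real_of_int b))"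
    using ab by blast
  have one: "\<bar>(indicat_real G p - indicat_real L p) / real_of_int a\<bar> \<le> 1" if "a \<noteq> 0" for G L and a :: int
  proof -
    have "1 \<le> \<bar>real_of_int a\<bar>" using that by linarith
    moreover have "\<bar>indicat_real G p - indicat_real L p\<bar> \<le> 1" by (auto simp: indicator_def)
    ultimately show ?thesis by (simp add: abs_divide divide_le_eq)
  qed
  show "\<bar>v p\<bar> \<le> 2" using one[OF ab(1), of G L] one[OF ab(2), of G' L'] unfolding v by linarith
qed

lemma int_frac_ge:
  assumes "a \<noteq> 0" "b \<noteq> 0" "\<bar>a\<bar> \<le> int n" "\<bar>b\<bar> \<le> int n" "real_of_int z / (real_of_int a * real_of_int b) \<noteq> 0"
  shows "1 / real n ^ 2 \<le> \<bar>real_of_int z / (real_of_int a * real_of_int b)\<bar>"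
proof -
  have "z \<noteq> 0" using assms(5) by auto
  then have z: "1 \<le> \<bar>real_of_int z\<bar>" by linarith
  have "\<bar>real_of_int a * real_of_int b\<bar> \<le> real n * real n"
    unfolding abs_mult using assms(3,4) by (intro mult_mono) linarith+
  moreover have "0 < \<bar>real_of_int a * real_of_int b\<bar>" using assms by simp
  moreover have "0 < real n" using assms(1,3) by linarith
  ultimately have "1 / (real n * real n) \<le> 1 / \<bar>real_of_int a * real_of_int b\<bar>"
    by (intro divide_left_mono mult_pos_pos) linarith+
  also have "\<dots> \<le> \<bar>real_of_int z\<bar> / \<bar>real_of_int a * real_of_int b\<bar>" using z by (intro divide_right_mono) auto
  finally show ?thesis by (simp add: power2_eq_square abs_divide)
qed

lemma svec_entry_ge:
  assumes "v \<in> svec n R" "v p \<noteq> 0"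
  shows "1 / real n ^ 2 \<le> \<bar>v p\<bar>"
proof -
  obtain a b z where ab: "a \<noteq> 0" "b \<noteq> 0" "\<bar>a\<bar> \<le> int n" "\<bar>b\<bar> \<le> int n" "\<forall>p. v p = real_of_int (z p) / (real_of_int a * real_of_int b)"
    using svec_entry(1)[OF assms(1)] by blast
  show ?thesis using int_frac_ge[OF ab(1-4), of "z p"] ab(5) assms(2) by simp
qed

text \<open>Every entry has a common denominator of modulus at most n^2, so the minor is an integer
  divided by a number of modulus at most n^4.\<close>

lemma svec_minor_ge:
  assumes "v \<in> svec n R" "v' \<in> svec n R" "v p * v' q \<noteq> v q * v' p"
  shows "1 / real n ^ 4 \<le> \<bar>v' q * v p - v q * v' p\<bar>"
proof -
  obtain a b z where ab: "a \<noteq> 0" "b \<noteq> 0" "\<bar>a\<bar> \<le> int n" "\<bar>b\<bar> \<le> int n" and v: "\<forall>p. v p = real_of_int (z p) / (real_of_int a * real_of_int b)"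
    using svec_entry(1)[OF assms(1)] by blast
  obtain a' b' z' where ab': "a' \<noteq> 0" "b' \<noteq> 0" "\<bar>a'\<bar> \<le> int n" "\<bar>b'\<bar> \<le> int n" and v': "\<forall>p. v' p = real_of_int (z' p) / (real_of_int a' * real_of_int b')"
    using svec_entry(1)[OF assms(2)] by blast
  let ?z = "z' q * z p - z q * z' p" and ?A = "a * b" and ?B = "a' * b'"
  have n2: "\<bar>?A\<bar> \<le> int (n * n)" "\<bar>?B\<bar> \<le> int (n * n)" unfolding abs_mult using ab ab' by (auto intro!: mult_mono)
  have e: "v' q * v p - v q * v' p = real_of_int ?z / (real_of_int ?A * real_of_int ?B)"
    unfolding v[rule_format] v'[rule_format] using ab ab' by (simp add: field_simps)
  have "1 / real (n * n) ^ 2 \<le> \<bar>real_of_int ?z / (real_of_int ?A * real_of_int ?B)\<bar>"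
  proof (rule int_frac_ge[OF _ _ n2])
    show "real_of_int ?z / (real_of_int ?A * real_of_int ?B) \<noteq> 0" unfolding e[symmetric] using assms(3) by (simp add: mult.commute)
  qed (use ab ab' in auto)
  then show ?thesis unfolding e by (simp add: power2_eq_square power4_eq_xxxx)
qed

lemma card_small_subsets: "card {G. G \<subseteq> {..<n} \<and> card G \<le> R} \<le> (n + 1) ^ R"
proof -
  have "{G. G \<subseteq> {..<n} \<and> card G \<le> R} \<subseteq> (\<lambda>f. f ` {..<R} - {n}) ` ({..<R} \<rightarrow>\<^sub>E {..n})"
  proof
    fix G assume "G \<in> {G. G \<subseteq> {..<n} \<and> card G \<le> R}"
    then have G: "G \<subseteq> {..<n}" "card G \<le> R" by auto
    then have "finite G" using finite_subset by blast
    then obtain h where h: "bij_betw h {..<card G} G" using ex_bij_betw_nat_finite atLeast0LessThan by metis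
    define f where "f = (\<lambda>i\<in>{..<R}. if i < card G then h i else n)"
    have hG: "h ` {..<card G} = G" using h by (simp add: bij_betw_def)
    have "f ` {..<R} - {n} = G"
    proof
      show "f ` {..<R} - {n} \<subseteq> G" using hG unfolding f_def by (auto split: if_splits)
      show "G \<subseteq> f ` {..<R} - {n}"
      proof
        fix x assume x: "x \<in> G"
        then obtain i where i: "i < card G" "x = h i" using hG by auto
        then have "x = f i" "i < R" using G(2) unfolding f_def by auto
        then show "x \<in> f ` {..<R} - {n}" using x G(1) by auto
      qed
    qed
    moreover have "f \<in> {..<R} \<rightarrow>\<^sub>E {..n}" using hG G(1) unfolding f_def by fastforce
    ultimately show "G \<in> (\<lambda>f. f ` {..<R} - {n}) ` ({..<R} \<rightarrow>\<^sub>E {..n})" by blast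
  qed
  then have "card {G. G \<subseteq> {..<n} \<and> card G \<le> R} \<le> card ((\<lambda>f. f ` {..<R} - {n}) ` ({..<R} \<rightarrow>\<^sub>E {..n}))"
    by (intro card_mono finite_imageI finite_PiE) auto
  also have "\<dots> \<le> card ({..<R} \<rightarrow>\<^sub>E {..n})" by (intro card_image_le finite_PiE) auto
  also have "\<dots> = (n + 1) ^ R" by (simp add: card_PiE)
  finally show ?thesis .
qed

lemma finite_svec: "finite (svec n R)" and card_svec: "card (svec n R) \<le> ((n + 1) ^ R) ^ 4 * (2 * n) ^ 2"
proof -
  let ?s = "{G. G \<subseteq> {..<n} \<and> card G \<le> R}" and ?z = "{a::int. a \<noteq> 0 \<and> \<bar>a\<bar> \<le> int n}"
  have fs: "finite ?s" by (rule finite_subset[of _ "Pow {..<n}"]) auto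
  have ez: "?z = {- int n..int n} - {0}" by auto
  have fz: "finite ?z" unfolding ez by simp
  have cz: "card ?z = 2 * n" unfolding ez by (subst card_Diff_singleton) auto
  show "finite (svec n R)" unfolding svec_def Let_def using fs fz by (intro finite_imageI finite_cartesian_product)
  have "card (svec n R) \<le> card (?s \<times> ?s \<times> ?z \<times> ?s \<times> ?s \<times> ?z)"
    unfolding svec_def Let_def using fs fz by (intro card_image_le finite_cartesian_product)
  also have "\<dots> = card ?s ^ 4 * (2 * n) ^ 2" unfolding card_cartesian_product cz by (simp add: power4_eq_xxxx power2_eq_square)
  also have "\<dots> \<le> ((n + 1) ^ R) ^ 4 * (2 * n) ^ 2" using card_small_subsets by (intro mult_right_mono power_mono) auto
  finally show "card (svec n R) \<le> ((n + 1) ^ R) ^ 4 * (2 * n) ^ 2" .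
qed

text \<open>The d coordinates involve separate noise variables; in each of them one point with a
  nonzero coefficient, of modulus at least n^-2, confines the value. The prefactor counts the
  vectors.\<close>

lemma small_one_relation:
  assumes "0 < \<sigma>" "0 \<le> \<tau>"
  shows "small_event (gaussm n d \<sigma>) (\<lambda>g. one_relation n d R \<tau> (pts \<mu> g))
    (real (((n + 1) ^ R) ^ 4 * (2 * n) ^ 2) * (real n ^ 2 * \<tau> / \<sigma>) ^ d)"
proof -
  let ?S = "{v \<in> svec n R. \<exists>p<n. v p \<noteq> 0}"
  have "small_event (gaussm n d \<sigma>) (\<lambda>g. \<exists>v\<in>?S. \<forall>l\<in>{..<d}. \<bar>lin n (pts \<mu> g) v l\<bar> \<le> \<tau>)
    (real (((n + 1) ^ R) ^ 4 * (2 * n) ^ 2) * (real n ^ 2 * \<tau> / \<sigma>) ^ d)"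
  proof (rule small_event_Union)
    show "finite ?S" using finite_svec by simp
    have "card ?S \<le> card (svec n R)" using finite_svec by (intro card_mono) auto
    then show "real (card ?S) \<le> real (((n + 1) ^ R) ^ 4 * (2 * n) ^ 2)" using card_svec[of n R] by linarith
    show "0 \<le> (real n ^ 2 * \<tau> / \<sigma>) ^ d" using assms by simp
    fix v assume "v \<in> ?S"
    then obtain p where v: "v \<in> svec n R" and p: "p < n" "v p \<noteq> 0" by auto
    note ge = svec_entry_ge[OF v p(2)]
    have "small_event (gaussm n d \<sigma>) (\<lambda>g. \<forall>l\<in>{..<d}. \<bar>lin n (pts \<mu> g) v l\<bar> \<le> \<tau>) (\<Prod>l\<in>{..<d}. real n ^ 2 * \<tau> / \<sigma>)"
    proof (rule small_event_triangular[where co = "\<lambda>l. (p, l)" and \<alpha> = "\<lambda>_. v p" and rk = "\<lambda>_. 0"])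
      show "\<tau> / (\<bar>v p\<bar> * \<sigma>) \<le> real n ^ 2 * \<tau> / \<sigma>"
      proof -
        have "1 / \<bar>v p\<bar> \<le> real n ^ 2" using ge p by (simp add: field_simps)
        then have "(1 / \<bar>v p\<bar>) * (\<tau> / \<sigma>) \<le> real n ^ 2 * (\<tau> / \<sigma>)" using assms by (intro mult_right_mono) auto
        then show ?thesis by simp
      qed
      show "lin n (pts \<mu> (g((p, l) := x))) v l = lin n (pts \<mu> (g((p, l) := 0))) v l + v p * x" for l g x
        using p(1) by (rule lin_upd)
      show "lin n (pts \<mu> (g((p, l') := x))) v l = lin n (pts \<mu> g) v l" if "l' \<noteq> l" for l l' g x
        using that by (intro lin_indep) auto
    qed (use assms p in \<open>auto simp: inj_on_def intro!: lin_measurable\<close>)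
    then show "small_event (gaussm n d \<sigma>) (\<lambda>g. \<forall>l\<in>{..<d}. \<bar>lin n (pts \<mu> g) v l\<bar> \<le> \<tau>) ((real n ^ 2 * \<tau> / \<sigma>) ^ d)" by simp
  qed
  then show ?thesis by (rule small_event_mono) (auto simp: one_relation_def)
qed

text \<open>Gaussian elimination makes the pair triangular: \<open>u\<close> vanishes at q and
  equals the minor at p. Thus p carries \<open>u\<close> and q carries \<open>v'\<close>, which
  gives 2 d factors. If \<open>v' q\<close> is zero the two vectors exchange roles.\<close>

lemma small_two_relations:
  assumes "0 < \<sigma>" "0 \<le> \<tau>"
  shows "small_event (gaussm n d \<sigma>) (\<lambda>g. two_relations n d R \<tau> (pts \<mu> g))
    (real ((((n + 1) ^ R) ^ 4 * (2 * n) ^ 2) ^ 2) * (4 * real n ^ 4 * \<tau> / \<sigma>) ^ (2 * d))"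
proof -
  let ?S = "{(v, v'). v \<in> svec n R \<and> v' \<in> svec n R \<and> (\<exists>p<n. \<exists>q<n. v p * v' q \<noteq> v q * v' p \<and> v' q \<noteq> 0)}"
  let ?E = "\<lambda>x g. \<forall>l\<in>{..<d}. \<bar>lin n (pts \<mu> g) (fst x) l\<bar> \<le> \<tau> \<and> \<bar>lin n (pts \<mu> g) (snd x) l\<bar> \<le> \<tau>"
  have "small_event (gaussm n d \<sigma>) (\<lambda>g. \<exists>x\<in>?S. ?E x g)
    (real ((((n + 1) ^ R) ^ 4 * (2 * n) ^ 2) ^ 2) * (4 * real n ^ 4 * \<tau> / \<sigma>) ^ (2 * d))"
  proof (rule small_event_Union)
    have sub: "?S \<subseteq> svec n R \<times> svec n R" by auto
    have f: "finite (svec n R \<times> svec n R)" using finite_svec by simp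
    then show "finite ?S" using sub finite_subset by blast
    have "card ?S \<le> card (svec n R \<times> svec n R)" using sub f by (rule card_mono[rotated])
    also have "\<dots> = card (svec n R) ^ 2" by (simp add: card_cartesian_product power2_eq_square)
    also have "\<dots> \<le> (((n + 1) ^ R) ^ 4 * (2 * n) ^ 2) ^ 2" using card_svec by (intro power_mono) auto
    finally show "real (card ?S) \<le> real ((((n + 1) ^ R) ^ 4 * (2 * n) ^ 2) ^ 2)" by (rule of_nat_mono)
    show "0 \<le> (4 * real n ^ 4 * \<tau> / \<sigma>) ^ (2 * d)" using assms by simp
    fix x assume "x \<in> ?S"
    then obtain v v' p q where x: "x = (v, v')" and v: "v \<in> svec n R" "v' \<in> svec n R" and
      pq: "p < n" "q < n" "v p * v' q \<noteq> v q * v' p" "v' q \<noteq> 0" by auto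
    define u where "u r = v' q * v r - v q * v' r" for r
    have n1: "1 \<le> real n" using pq(1) by simp
    have up: "1 / real n ^ 4 \<le> \<bar>u p\<bar>" using svec_minor_ge[OF v pq(3)] unfolding u_def by simp
    have vq: "1 / real n ^ 2 \<le> \<bar>v' q\<bar>" using svec_entry_ge[OF v(2) pq(4)] .
    have uq: "u q = 0" unfolding u_def by simp
    have pne: "p \<noteq> q" using pq(3) by auto
    have up0: "u p \<noteq> 0" using pq(3) unfolding u_def by (simp add: mult.commute)
    let ?B = "{..<d} \<times> {0, 1::nat}"
    have "small_event (gaussm n d \<sigma>) (\<lambda>g. \<forall>b\<in>?B. \<bar>lin n (pts \<mu> g) (if snd b = 0 then u else v') (fst b)\<bar> \<le> (if snd b = 0 then 4 * \<tau> else \<tau>))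
        (\<Prod>b\<in>?B. 4 * real n ^ 4 * \<tau> / \<sigma>)"
    proof (rule small_event_triangular[where co = "\<lambda>b. (if snd b = 0 then p else q, fst b)" and \<alpha> = "\<lambda>b. if snd b = 0 then u p else v' q" and rk = "snd"])
      fix b :: "nat \<times> nat" and g x assume b: "b \<in> ?B"
      show "lin n (pts \<mu> (g((if snd b = 0 then p else q, fst b) := x))) (if snd b = 0 then u else v') (fst b)
        = lin n (pts \<mu> (g((if snd b = 0 then p else q, fst b) := 0))) (if snd b = 0 then u else v') (fst b) + (if snd b = 0 then u p else v' q) * x"
        using lin_upd[OF pq(1), of \<mu> g "fst b" x u] lin_upd[OF pq(2), of \<mu> g "fst b" x v']
        by (cases "snd b = 0") simp_all
      fix b' assume b': "b' \<in> ?B" "b' \<noteq> b" "snd b \<le> snd b'"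
      show "lin n (pts \<mu> (g((if snd b' = 0 then p else q, fst b') := x))) (if snd b = 0 then u else v') (fst b)
        = lin n (pts \<mu> g) (if snd b = 0 then u else v') (fst b)"
        using b b' uq by (intro lin_indep) auto
    next
      fix b :: "nat \<times> nat" assume b: "b \<in> ?B"
      have "1 / \<bar>u p\<bar> \<le> real n ^ 4" using up up0 n1 by (simp add: field_simps)
      then have 1: "(1 / \<bar>u p\<bar>) * (4 * \<tau> / \<sigma>) \<le> real n ^ 4 * (4 * \<tau> / \<sigma>)" using assms by (intro mult_right_mono) auto
      have "1 / \<bar>v' q\<bar> \<le> real n ^ 2" using vq pq n1 by (simp add: field_simps)
      also have "\<dots> \<le> real n ^ 4" using n1 by (intro power_increasing) auto
      finally have "(1 / \<bar>v' q\<bar>) * (\<tau> / \<sigma>) \<le> real n ^ 4 * (4 * \<tau> / \<sigma>)" using assms n1 by (intro mult_mono divide_right_mono) auto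
      with 1 show "(if snd b = 0 then 4 * \<tau> else \<tau>) / (\<bar>if snd b = 0 then u p else v' q\<bar> * \<sigma>) \<le> 4 * real n ^ 4 * \<tau> / \<sigma>" by (simp add: mult_ac)
    qed (use assms pq pne up0 in \<open>auto simp: inj_on_def intro!: lin_measurable\<close>)
    note b2 = this
    have 1: "small_event (gaussm n d \<sigma>) (\<lambda>g. \<forall>b\<in>?B. \<bar>lin n (pts \<mu> g) (if snd b = 0 then u else v') (fst b)\<bar> \<le> (if snd b = 0 then 4 * \<tau> else \<tau>))
      ((4 * real n ^ 4 * \<tau> / \<sigma>) ^ (2 * d))"
    proof -
      have c: "card ?B = 2 * d" by (simp add: card_cartesian_product)
      show ?thesis using b2 unfolding prod_constant c .
    qed
    show "small_event (gaussm n d \<sigma>) (?E x) ((4 * real n ^ 4 * \<tau> / \<sigma>) ^ (2 * d))"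
    proof (rule small_event_mono[OF 1 _ order_refl], rule ballI)
      fix g b assume h: "?E x g" and b: "b \<in> ?B"
      then have l: "fst b < d" by auto
      have hv: "\<bar>lin n (pts \<mu> g) v (fst b)\<bar> \<le> \<tau>" "\<bar>lin n (pts \<mu> g) v' (fst b)\<bar> \<le> \<tau>" using h l x by auto
      have "lin n (pts \<mu> g) u (fst b) = v' q * lin n (pts \<mu> g) v (fst b) - v q * lin n (pts \<mu> g) v' (fst b)"
        unfolding lin_def u_def by (simp add: sum_distrib_left sum_subtractf left_diff_distrib mult.assoc)
      moreover have "\<bar>v' q * lin n (pts \<mu> g) v (fst b)\<bar> \<le> 2 * \<tau>" "\<bar>v q * lin n (pts \<mu> g) v' (fst b)\<bar> \<le> 2 * \<tau>"
        unfolding abs_mult using svec_entry(2)[OF v(1)] svec_entry(2)[OF v(2)] hv by (auto intro!: mult_mono)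
      ultimately have "\<bar>lin n (pts \<mu> g) u (fst b)\<bar> \<le> 4 * \<tau>" by linarith
      then show "\<bar>lin n (pts \<mu> g) (if snd b = 0 then u else v') (fst b)\<bar> \<le> (if snd b = 0 then 4 * \<tau> else \<tau>)" using hv by simp
    qed
  qed
  then show ?thesis
  proof (rule small_event_mono)
    fix g assume "two_relations n d R \<tau> (pts \<mu> g)"
    then obtain v v' p q where v: "v \<in> svec n R" "v' \<in> svec n R" "p < n" "q < n" "v p * v' q \<noteq> v q * v' p"
      and l: "\<And>l. l < d \<Longrightarrow> \<bar>lin n (pts \<mu> g) v l\<bar> \<le> \<tau> \<and> \<bar>lin n (pts \<mu> g) v' l\<bar> \<le> \<tau>" unfolding two_relations_def by blast
    show "\<exists>x\<in>?S. ?E x g"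
    proof (cases "v' q = 0")
      case False
      then have "(v, v') \<in> ?S" using v by auto
      then show ?thesis using l by (intro bexI[of _ "(v, v')"]) auto
    next
      case True
      then have "v q \<noteq> 0" "v' p * v q \<noteq> v' q * v p" using v(5) by (auto simp: mult.commute)
      then have "(v', v) \<in> ?S" using v by auto
      then show ?thesis using l by (intro bexI[of _ "(v', v)"]) auto
    qed
  qed simp
qed

text \<open>A finite union of events in which a nonconstant affine function of the noise takes one
  prescribed value, that is, lies in an interval of length 0.\<close>

lemma small_null:
  assumes "0 < \<sigma>" "0 < d"
  shows "small_event (gaussm n d \<sigma>) (\<lambda>g. \<not> null_free n k (pts \<mu> g) C0) 0"
proof -
  have one: "small_event (gaussm n d \<sigma>) (\<lambda>g. lin n (pts \<mu> g) v 0 = c) 0" if "p < n" "v p \<noteq> 0" for v p c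
  proof -
    have "small_event (gaussm n d \<sigma>) (\<lambda>g. \<forall>b\<in>{()}. \<bar>lin n (pts \<mu> g) v 0 - c\<bar> \<le> 0) (\<Prod>b\<in>{()}. 0)"
    proof (rule small_event_triangular[where co = "\<lambda>_. (p, 0)" and \<alpha> = "\<lambda>_. v p" and rk = "\<lambda>_. 0"])
      show "(\<lambda>g. lin n (pts \<mu> g) v 0 - c) \<in> borel_measurable (gaussm n d \<sigma>)"
        using assms by (intro borel_measurable_diff lin_measurable) auto
      show "lin n (pts \<mu> (g((p, 0) := x))) v 0 - c = lin n (pts \<mu> (g((p, 0) := 0))) v 0 - c + v p * x" for g x
        using lin_upd[OF that(1), of \<mu> g 0 x v] by linarith
    qed (use assms that in auto)
    then show ?thesis by simp
  qed
  let ?P = "{B. B \<subseteq> {..<n} \<and> B \<noteq> {}}"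
  have fP: "finite ?P" by (rule finite_subset[of _ "Pow {..<n}"]) auto
  have fin: "finite B" if "B \<in> ?P" for B using that finite_subset by auto
  have 1: "small_event (gaussm n d \<sigma>) (\<lambda>g. \<exists>x\<in>{(B, B'). B \<in> ?P \<and> B' \<in> ?P \<and> B \<noteq> B'}. lin n (pts \<mu> g) (cdiff (fst x) (snd x)) 0 = 0)
      (real (card {(B, B'). B \<in> ?P \<and> B' \<in> ?P \<and> B \<noteq> B'}) * 0)"
  proof (rule small_event_Union)
    show "finite {(B, B'). B \<in> ?P \<and> B' \<in> ?P \<and> B \<noteq> B'}" by (rule finite_subset[of _ "?P \<times> ?P"]) (use fP in auto)
    fix x assume "x \<in> {(B, B'). B \<in> ?P \<and> B' \<in> ?P \<and> B \<noteq> B'}"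
    then obtain B B' where x: "x = (B, B')" "B \<in> ?P" "B' \<in> ?P" "B \<noteq> B'" by auto
    then obtain p where "p \<in> B \<union> B'" "cdiff B B' p \<noteq> 0" using cdiff_nonzero[OF x(4) fin fin] by blast
    then show "small_event (gaussm n d \<sigma>) (\<lambda>g. lin n (pts \<mu> g) (cdiff (fst x) (snd x)) 0 = 0) 0"
      using x by (intro one[of p]) auto
  qed auto
  have 2: "small_event (gaussm n d \<sigma>) (\<lambda>g. \<exists>x\<in>?P \<times> {..<k}. lin n (pts \<mu> g) (\<lambda>p. indicat_real (fst x) p / real (card (fst x))) 0 = C0 (snd x) 0)
      (real (card (?P \<times> {..<k})) * 0)"
  proof (rule small_event_Union)
    show "finite (?P \<times> {..<k})" using fP by simp
    fix x assume x: "x \<in> ?P \<times> {..<k}"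
    then have "fst x \<noteq> {}" "finite (fst x)" using finite_subset[of "fst x" "{..<n}"] by auto
    then have c: "0 < card (fst x)" by (simp add: card_gt_0_iff)
    obtain p where "p \<in> fst x" using \<open>fst x \<noteq> {}\<close> by auto
    then show "small_event (gaussm n d \<sigma>) (\<lambda>g. lin n (pts \<mu> g) (\<lambda>p. indicat_real (fst x) p / real (card (fst x))) 0 = C0 (snd x) 0) 0"
      using x c by (intro one[of p]) auto
  qed auto
  have "small_event (gaussm n d \<sigma>) (\<lambda>g. (\<exists>x\<in>{(B, B'). B \<in> ?P \<and> B' \<in> ?P \<and> B \<noteq> B'}. lin n (pts \<mu> g) (cdiff (fst x) (snd x)) 0 = 0)
    \<or> (\<exists>x\<in>?P \<times> {..<k}. lin n (pts \<mu> g) (\<lambda>p. indicat_real (fst x) p / real (card (fst x))) 0 = C0 (snd x) 0)) (0 + 0)"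
    by (rule small_event_or) (use 1 2 in simp_all)
  then show ?thesis
  proof (rule small_event_mono)
    fix g assume "\<not> null_free n k (pts \<mu> g) C0"
    then consider B B' where "B \<subseteq> {..<n}" "B' \<subseteq> {..<n}" "B \<noteq> {}" "B' \<noteq> {}" "B \<noteq> B'" "centroid (pts \<mu> g) B 0 = centroid (pts \<mu> g) B' 0"
      | B i where "B \<subseteq> {..<n}" "B \<noteq> {}" "i < k" "centroid (pts \<mu> g) B 0 = C0 i 0" unfolding null_free_def by blast
    then show "(\<exists>x\<in>{(B, B'). B \<in> ?P \<and> B' \<in> ?P \<and> B \<noteq> B'}. lin n (pts \<mu> g) (cdiff (fst x) (snd x)) 0 = 0)
      \<or> (\<exists>x\<in>?P \<times> {..<k}. lin n (pts \<mu> g) (\<lambda>p. indicat_real (fst x) p / real (card (fst x))) 0 = C0 (snd x) 0)"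
    proof cases
      case 1
      then show ?thesis by (intro disjI1 bexI[of _ "(B, B')"]) (auto simp: lin_cdiff)
    next
      case 2
      have "lin n (pts \<mu> g) (\<lambda>p. indicat_real B p / real (card B)) 0 = centroid (pts \<mu> g) B 0"
        unfolding lin_def centroid_def sum_divide_distrib
        by (rule sum.mono_neutral_cong_right) (use 2 in \<open>auto simp: indicator_def\<close>)
      then show ?thesis using 2 by (intro disjI2 bexI[of _ "(B, i)"]) auto
    qed
  qed simp
qed

definition in_box :: "nat \<Rightarrow> nat \<Rightarrow> real \<Rightarrow> (nat \<Rightarrow> nat \<Rightarrow> real) \<Rightarrow> bool" where
  "in_box n d D X \<longleftrightarrow> (\<forall>p<n. \<forall>l<d. \<bar>X p l\<bar> \<le> D)"

lemma pts_upd_other: "p' \<noteq> p \<Longrightarrow> pts \<mu> (g((p', l) := x)) p = pts \<mu> g p"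
  unfolding pts_def by auto

lemma sum_coord_upd:
  fixes h :: "nat \<Rightarrow> real \<Rightarrow> real"
  assumes "l0 < d" "\<And>x. h l0 (\<mu> p l0 + x) = h l0 (\<mu> p l0) + a * x"
  shows "(\<Sum>l<d. h l (pts \<mu> (g((p, l0) := x)) p l)) = (\<Sum>l<d. h l (pts \<mu> (g((p, l0) := 0)) p l)) + a * x"
proof -
  have e: "(\<Sum>l<d. h l (pts \<mu> (g((p, l0) := y)) p l)) = h l0 (\<mu> p l0 + y) + (\<Sum>l\<in>{..<d} - {l0}. h l (pts \<mu> g p l))" for y
  proof -
    have "(\<Sum>l<d. h l (pts \<mu> (g((p, l0) := y)) p l)) = h l0 (pts \<mu> (g((p, l0) := y)) p l0) + (\<Sum>l\<in>{..<d} - {l0}. h l (pts \<mu> (g((p, l0) := y)) p l))"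
      using assms(1) by (subst sum.remove[of _ l0]) auto
    also have "(\<Sum>l\<in>{..<d} - {l0}. h l (pts \<mu> (g((p, l0) := y)) p l)) = (\<Sum>l\<in>{..<d} - {l0}. h l (pts \<mu> g p l))"
      by (intro sum.cong) (auto simp: pts_def)
    also have "pts \<mu> (g((p, l0) := y)) p l0 = \<mu> p l0 + y" by (simp add: pts_def)
    finally show ?thesis .
  qed
  show ?thesis unfolding e using assms(2)[of x] assms(2)[of 0] by simp
qed

lemma small_fixed_slab:
  assumes "0 < \<sigma>" "0 \<le> \<tau>" "P \<subseteq> {..<n}" "l0 < d" "u l0 = 1"
  shows "small_event (gaussm n d \<sigma>) (\<lambda>g. \<forall>p\<in>P. \<bar>(\<Sum>l<d. u l * pts \<mu> g p l) - b\<bar> \<le> \<tau>) ((\<tau> / \<sigma>) ^ card P)"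
proof -
  have "small_event (gaussm n d \<sigma>) (\<lambda>g. \<forall>p\<in>P. \<bar>(\<Sum>l<d. u l * pts \<mu> g p l) - b\<bar> \<le> \<tau>) (\<Prod>p\<in>P. \<tau> / \<sigma>)"
  proof (rule small_event_triangular[where co = "\<lambda>p. (p, l0)" and \<alpha> = "\<lambda>_. 1" and rk = "\<lambda>_. 0"])
    show "finite P" using assms finite_subset by blast
    show "(\<lambda>g. (\<Sum>l<d. u l * pts \<mu> g p l) - b) \<in> borel_measurable (gaussm n d \<sigma>)" if "p \<in> P" for p
      using assms that by (intro borel_measurable_diff borel_measurable_sum borel_measurable_times pts_measurable) auto
    show "(\<Sum>l<d. u l * pts \<mu> (g((p, l0) := x)) p l) - b = (\<Sum>l<d. u l * pts \<mu> (g((p, l0) := 0)) p l) - b + 1 * x" for p g x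
      using sum_coord_upd[OF assms(4), of "\<lambda>l y. u l * y" \<mu> p 1 g x] assms(5) by (simp add: algebra_simps)
    show "(\<Sum>l<d. u l * pts \<mu> (g((p', l0) := x)) p l) - b = (\<Sum>l<d. u l * pts \<mu> g p l) - b" if "p' \<noteq> p" for p p' g x
      using pts_upd_other[OF that] by simp
  qed (use assms in \<open>auto simp: inj_on_def\<close>)
  then show ?thesis by simp
qed

text \<open>Normals are rounded to multiples of \<eta> and offsets to multiples of \<tau>, with the
  entry 1 kept exact. The tolerance grows to 3 \<tau>: one \<tau> from the slab, one from the
  offset, and one from the normal, for which the points have to lie in the box.\<close>

lemma small_crowded_slab:
  fixes Zu Zb :: int
  assumes \<sigma>: "0 < \<sigma>" "0 < \<tau>" "0 < D" "0 < d" "0 < s" and \<eta>: "0 < \<eta>" "real d * \<eta> * D \<le> \<tau>"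
    and Zu: "1 \<le> \<eta> * (real_of_int Zu - 1)" and Zb: "real d * D + \<tau> \<le> \<tau> * (real_of_int Zb - 1)"
  shows "small_event (gaussm n d \<sigma>) (\<lambda>g. in_box n d D (pts \<mu> g) \<and> crowded_slab n d s \<tau> (pts \<mu> g))
    (real ((n + 1) ^ s) * (real d * ((2 * real_of_int Zu + 1) ^ d * ((2 * real_of_int Zb + 1) * (3 * \<tau> / \<sigma>) ^ s))))"
proof -
  let ?M = "gaussm n d \<sigma>"
  let ?u = "\<lambda>l0 z l. if l = l0 then 1 else \<eta> * real_of_int (z l)"
  let ?ev = "\<lambda>P l0 z (zb::int) g. \<forall>p\<in>P. \<bar>(\<Sum>l<d. ?u l0 z l * pts \<mu> g p l) - \<tau> * real_of_int zb\<bar> \<le> 3 * \<tau>"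
  have Zpos: "0 \<le> Zu" "0 \<le> Zb"
  proof -
    have "0 < \<eta> * (real_of_int Zu - 1)" using Zu by linarith
    then have "0 < real_of_int Zu - 1" using \<eta>(1) by (simp add: zero_less_mult_iff)
    then show "0 \<le> Zu" by linarith
    have "0 < real d * D" using \<sigma> by simp
    then have "0 < \<tau> * (real_of_int Zb - 1)" using Zb \<sigma> by linarith
    then have "0 < real_of_int Zb - 1" using \<sigma>(2) by (simp add: zero_less_mult_iff)
    then show "0 \<le> Zb" by linarith
  qed
  have q: "0 \<le> (3 * \<tau> / \<sigma>) ^ s" using \<sigma> by simp
  have "small_event ?M (\<lambda>g. \<exists>P\<in>{P. P \<subseteq> {..<n} \<and> card P = s}. \<exists>l0\<in>{..<d}. \<exists>z\<in>({..<d} \<rightarrow>\<^sub>E {-Zu..Zu}). \<exists>zb\<in>{-Zb..Zb}. ?ev P l0 z zb g)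
    (real ((n + 1) ^ s) * (real d * ((2 * real_of_int Zu + 1) ^ d * ((2 * real_of_int Zb + 1) * (3 * \<tau> / \<sigma>) ^ s))))"
  proof (intro small_event_Union)
    fix P l0 z zb assume "P \<in> {P. P \<subseteq> {..<n} \<and> card P = s}" "l0 \<in> {..<d}"
    then show "small_event ?M (?ev P l0 z zb) ((3 * \<tau> / \<sigma>) ^ s)"
      using small_fixed_slab[of \<sigma> "3 * \<tau>" P n l0 d "?u l0 z" \<mu> "\<tau> * real_of_int zb"] \<sigma> by auto
  next
    show "finite {P. P \<subseteq> {..<n} \<and> card P = s}" by (rule finite_subset[of _ "Pow {..<n}"]) auto
    have "card {P. P \<subseteq> {..<n} \<and> card P = s} \<le> card {P. P \<subseteq> {..<n} \<and> card P \<le> s}"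
      by (rule card_mono[OF finite_subset[of _ "Pow {..<n}"]]) auto
    then show "real (card {P. P \<subseteq> {..<n} \<and> card P = s}) \<le> real ((n + 1) ^ s)" using card_small_subsets[of n s] by linarith
    show "finite ({..<d} \<rightarrow>\<^sub>E {-Zu..Zu})" by (intro finite_PiE) auto
    show "real (card ({..<d} \<rightarrow>\<^sub>E {-Zu..Zu})) \<le> (2 * real_of_int Zu + 1) ^ d" using Zpos by (simp add: card_PiE)
    show "real (card {-Zb..Zb}) \<le> 2 * real_of_int Zb + 1" using Zpos by simp
  qed (use Zpos q in \<open>auto intro!: mult_nonneg_nonneg\<close>)
  then show ?thesis
  proof (rule small_event_mono)
    fix g assume "in_box n d D (pts \<mu> g) \<and> crowded_slab n d s \<tau> (pts \<mu> g)"
    then obtain P u b l0 where box: "\<And>p l. p < n \<Longrightarrow> l < d \<Longrightarrow> \<bar>pts \<mu> g p l\<bar> \<le> D" and P: "P \<subseteq> {..<n}" "card P = s" and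
      l0: "l0 < d" "u l0 = 1" and u: "\<And>l. l < d \<Longrightarrow> \<bar>u l\<bar> \<le> 1" and ub: "\<And>p. p \<in> P \<Longrightarrow> \<bar>(\<Sum>l<d. u l * pts \<mu> g p l) - b\<bar> \<le> \<tau>"
      unfolding in_box_def crowded_slab_def by blast
    have "P \<noteq> {}" using P \<sigma> by auto
    then obtain p0 where p0: "p0 \<in> P" by auto
    have "\<bar>\<Sum>l<d. u l * pts \<mu> g p0 l\<bar> \<le> (\<Sum>l<d. \<bar>u l * pts \<mu> g p0 l\<bar>)" by (rule sum_abs)
    also have "\<dots> \<le> (\<Sum>l<d. 1 * D)" unfolding abs_mult using u box[of p0] p0 P by (intro sum_mono mult_mono) auto
    finally have "\<bar>b\<bar> \<le> real d * D + \<tau>" using ub[OF p0] by simp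
    then have bz: "\<lfloor>b / \<tau>\<rfloor> \<in> {-Zb..Zb}" "\<bar>\<tau> * real_of_int \<lfloor>b / \<tau>\<rfloor> - b\<bar> \<le> \<tau>"
      using Zb floor_net[OF \<sigma>(2), of b] by auto
    define z where "z = (\<lambda>l\<in>{..<d}. \<lfloor>u l / \<eta>\<rfloor>)"
    have "\<lfloor>u l / \<eta>\<rfloor> \<in> {-Zu..Zu}" if "l < d" for l
      by (rule floor_net(2)[OF \<eta>(1)]) (use u[OF that] Zu in linarith)
    then have zz: "z \<in> {..<d} \<rightarrow>\<^sub>E {-Zu..Zu}" unfolding z_def by (auto simp del: atLeastAtMost_iff)
    have uz: "\<bar>?u l0 z l - u l\<bar> \<le> \<eta>" if "l < d" for l
      using floor_net(1)[OF \<eta>(1), of "u l"] that l0 \<eta> unfolding z_def by auto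
    have "?ev P l0 z \<lfloor>b / \<tau>\<rfloor> g"
    proof
      fix p assume p: "p \<in> P"
      have "\<bar>(\<Sum>l<d. ?u l0 z l * pts \<mu> g p l) - (\<Sum>l<d. u l * pts \<mu> g p l)\<bar> = \<bar>\<Sum>l<d. (?u l0 z l - u l) * pts \<mu> g p l\<bar>"
        by (simp only: sum_subtractf left_diff_distrib)
      also have "\<dots> \<le> (\<Sum>l<d. \<bar>(?u l0 z l - u l) * pts \<mu> g p l\<bar>)" by (rule sum_abs)
      also have "\<dots> \<le> (\<Sum>l<d. \<eta> * D)" unfolding abs_mult using uz box[of p] p P \<eta> by (intro sum_mono mult_mono) auto
      also have "\<dots> \<le> \<tau>" using \<eta> by (simp add: mult.assoc)
      finally show "\<bar>(\<Sum>l<d. ?u l0 z l * pts \<mu> g p l) - \<tau> * real_of_int \<lfloor>b / \<tau>\<rfloor>\<bar> \<le> 3 * \<tau>" using ub[OF p] bz(2) by linarith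
    qed
    then show "\<exists>P\<in>{P. P \<subseteq> {..<n} \<and> card P = s}. \<exists>l0\<in>{..<d}. \<exists>z\<in>({..<d} \<rightarrow>\<^sub>E {-Zu..Zu}). \<exists>zb\<in>{-Zb..Zb}. ?ev P l0 z zb g"
      using P l0 zz bz(1) by blast
  qed simp
qed

text \<open>The squares of the varied coordinate cancel between the two distances, which leaves a
  slope proportional to the separation of the centers in that coordinate.\<close>

lemma sqdist_pts_affine:
  assumes "l0 < d"
  shows "sqdist d (pts \<mu> (g((p, l0) := x)) p) c - sqdist d (pts \<mu> (g((p, l0) := x)) p) c'
    = sqdist d (pts \<mu> (g((p, l0) := 0)) p) c - sqdist d (pts \<mu> (g((p, l0) := 0)) p) c' + 2 * (c' l0 - c l0) * x"
  unfolding sqdist_def sum_subtractf[symmetric]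
  by (rule sum_coord_upd[OF assms]) (simp add: power2_eq_square algebra_simps)

text \<open>A good edge is resolved by a coordinate of its own point in which its candidate centers
  are separated; the balance of a light cluster by the d coordinates of its reserved edge. In a
  suitable order the system is triangular and the bounds multiply.\<close>

lemma small_blueprint_event:
  assumes bp: "blueprint n d k \<kappa> M src dst Gd \<Lambda> H" and \<sigma>: "0 < \<sigma>" "0 < \<delta>" "0 \<le> D" "0 \<le> w" "0 < d"
  shows "small_event (gaussm n d \<sigma>) (\<lambda>g. blueprint_event n d D w \<delta> M src dst Gd \<Lambda> ch (pts \<mu> g))
    ((11 * real d ^ 2 * D * w / (\<delta> * \<sigma>)) ^ card Gd * (2 * real n * w / \<sigma>) ^ (d * card \<Lambda>))"
proof (cases "\<forall>p\<in>Gd. \<exists>l<d. \<delta> / (2 * real d) \<le> \<bar>ch (src p) l - ch (dst p) l\<bar>")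
  case False
  then have "\<not> blueprint_event n d D w \<delta> M src dst Gd \<Lambda> ch X" for X unfolding blueprint_event_def by blast
  then show ?thesis unfolding small_event_def by (intro bexI[of _ "{}"]) auto
next
  case True
  then obtain lsel where lsel: "\<And>p. p \<in> Gd \<Longrightarrow> lsel p < d \<and> \<delta> / (2 * real d) \<le> \<bar>ch (src p) (lsel p) - ch (dst p) (lsel p)\<bar>" by metis
  have M: "M \<subseteq> {..<n}" "\<And>p. p \<in> M \<Longrightarrow> src p \<noteq> dst p" "Gd \<subseteq> M" "\<Lambda> \<subseteq> {..<k}" using bp unfolding blueprint_def by auto
  have "\<exists>e (rk :: nat \<Rightarrow> nat). \<forall>j\<in>\<Lambda>. e j \<in> M - Gd \<and> (src (e j) = j \<or> dst (e j) = j) \<and>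
        (\<forall>j'\<in>\<Lambda>. j' \<noteq> j \<longrightarrow> rk j' \<le> rk j \<longrightarrow> src (e j') \<noteq> j \<and> dst (e j') \<noteq> j)"
    using bp unfolding blueprint_def by (elim conjE)
  then obtain e and rk :: "nat \<Rightarrow> nat" where e': "\<forall>j\<in>\<Lambda>. e j \<in> M - Gd \<and> (src (e j) = j \<or> dst (e j) = j) \<and>
        (\<forall>j'\<in>\<Lambda>. j' \<noteq> j \<longrightarrow> rk j' \<le> rk j \<longrightarrow> src (e j') \<noteq> j \<and> dst (e j') \<noteq> j)" by (elim exE)
  note e = bspec[OF e']
  have e3: "src (e j') \<noteq> j \<and> dst (e j') \<noteq> j" if "j \<in> \<Lambda>" "j' \<in> \<Lambda>" "j' \<noteq> j" "rk j' \<le> rk j" for j j'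
    using e[OF that(1)] that(2-4) by simp
  have fM: "finite M" using finite_subset[OF M(1)] by simp
  note fin = fM finite_subset[OF M(3) fM] finite_subset[OF M(4) finite_lessThan]
  have einj: "inj_on e \<Lambda>"
  proof (rule inj_onI)
    fix j j' assume j: "j \<in> \<Lambda>" "j' \<in> \<Lambda>" "e j = e j'"
    show "j = j'"
    proof (rule ccontr)
      assume ne: "j \<noteq> j'"
      show False
      proof (cases "rk j' \<le> rk j")
        case True
        then have "src (e j') \<noteq> j \<and> dst (e j') \<noteq> j" using e3[OF j(1,2)] ne by simp
        then show False using e[OF j(1)] j(3) by simp
      next
        case False
        then have "rk j \<le> rk j'" by simp
        then have "src (e j) \<noteq> j' \<and> dst (e j) \<noteq> j'" using e3[OF j(2,1)] ne by simp
        then show False using e[OF j(2)] j(3) by simp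
      qed
    qed
  qed
  \<comment> \<open>Levels are reversed in the ranks below. The balance of j may contain points
    reserved for clusters of larger level, which have to be fixed before, but none reserved for
    another cluster of equal or smaller level. Good edges come at rank 0, as they see only their own
    point. \<open>K\<close> keeps the subtraction from truncating.\<close>
  define K where "K = (\<Sum>j\<in>\<Lambda>. rk j)"
  have K: "rk j \<le> K" if "j \<in> \<Lambda>" for j unfolding K_def using that fin by (intro member_le_sum) auto
  define vec where "vec j q = (if q \<in> M then inc src dst j q else 0)" for j q
  have vlin: "lin n X (vec j) l = (\<Sum>p\<in>M. inc src dst j p * X p l)" for X j l
    unfolding lin_def vec_def by (rule sum.mono_neutral_cong_right) (use M in auto)
  define F where "F b g = (case b of Inl p \<Rightarrow> sqdist d (pts \<mu> g p) (ch (src p)) - sqdist d (pts \<mu> g p) (ch (dst p))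
      | Inr (j, l) \<Rightarrow> lin n (pts \<mu> g) (vec j) l - balance M src dst j * ch j l)" for b g
  define co where "co b = (case b of Inl p \<Rightarrow> (p, lsel p) | Inr (j, l) \<Rightarrow> (e j, l))" for b :: "nat + nat \<times> nat"
  define \<alpha> where "\<alpha> b = (case b of Inl p \<Rightarrow> 2 * (ch (dst p) (lsel p) - ch (src p) (lsel p)) | Inr (j, l) \<Rightarrow> vec j (e j))" for b :: "nat + nat \<times> nat"
  define rk' where "rk' b = (case b of Inl p \<Rightarrow> 0 | Inr (j, l) \<Rightarrow> Suc (K - rk j))" for b :: "nat + nat \<times> nat"
  define \<tau> where "\<tau> b = (case b of Inl p \<Rightarrow> 11 * real d * D * w | Inr _ \<Rightarrow> 2 * real n * w)" for b :: "nat + nat \<times> nat"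
  define \<beta> where "\<beta> b = (case b of Inl p \<Rightarrow> 11 * real d ^ 2 * D * w / (\<delta> * \<sigma>) | Inr _ \<Rightarrow> 2 * real n * w / \<sigma>)" for b :: "nat + nat \<times> nat"
  let ?B = "Gd <+> (\<Lambda> \<times> {..<d})"
  have ve: "\<bar>vec j (e j)\<bar> = 1" if "j \<in> \<Lambda>" for j
    using e[OF that] M(2)[of "e j"] unfolding vec_def inc_def by auto
  have \<alpha>l: "\<delta> / real d \<le> \<bar>\<alpha> (Inl p)\<bar>" if "p \<in> Gd" for p
  proof -
    have "\<delta> / real d = 2 * (\<delta> / (2 * real d))" by simp
    also have "\<dots> \<le> 2 * \<bar>ch (src p) (lsel p) - ch (dst p) (lsel p)\<bar>" using conjunct2[OF lsel[OF that]] by (intro mult_left_mono) auto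
    also have "\<dots> = \<bar>\<alpha> (Inl p)\<bar>" unfolding \<alpha>_def sum.case abs_mult by (simp only: abs_minus_commute abs_numeral)
    finally show ?thesis .
  qed
  have \<delta>d: "0 < \<delta> / real d" using \<sigma> by simp
  have "small_event (gaussm n d \<sigma>) (\<lambda>g. \<forall>b\<in>?B. \<bar>F b g\<bar> \<le> \<tau> b) (\<Prod>b\<in>?B. \<beta> b)"
  proof (rule small_event_triangular[where co = co and \<alpha> = \<alpha> and rk = rk'])
    show "finite ?B" using fin by simp
    show "finite ({..<n} \<times> {..<d})" by simp
    show "0 < \<sigma>" by fact
    show "inj_on co ?B"
    proof (rule inj_onI)
      fix b b' assume b: "b \<in> ?B" "b' \<in> ?B" "co b = co b'"
      show "b = b'"
      proof (cases b; cases b')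
        fix p p' assume "b = Inl p" "b' = Inl p'" then show ?thesis using b unfolding co_def by auto
      next
        fix p x assume x: "b = Inl p" "b' = Inr x"
        then have "p \<in> Gd" "fst x \<in> \<Lambda>" using b by auto
        then show ?thesis using b(3) x e[of "fst x"] unfolding co_def by (auto split: prod.splits)
      next
        fix p x assume x: "b = Inr x" "b' = Inl p"
        then have "p \<in> Gd" "fst x \<in> \<Lambda>" using b by auto
        then show ?thesis using b(3) x e[of "fst x"] unfolding co_def by (auto split: prod.splits)
      next
        fix x x' assume x: "b = Inr x" "b' = Inr x'"
        then have "fst x \<in> \<Lambda>" "fst x' \<in> \<Lambda>" using b by auto
        then show ?thesis using b(3) x einj unfolding co_def by (auto split: prod.splits dest: inj_onD)
      qed
    qed
    show "co ` ?B \<subseteq> {..<n} \<times> {..<d}"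
    proof
      fix y assume "y \<in> co ` ?B"
      then obtain b where b: "b \<in> ?B" "y = co b" by auto
      show "y \<in> {..<n} \<times> {..<d}"
      proof (cases b)
        case (Inl p)
        then show ?thesis using b lsel[of p] M unfolding co_def by auto
      next
        case (Inr x)
        then have "fst x \<in> \<Lambda>" "snd x < d" using b by auto
        then show ?thesis using b(2) Inr e[of "fst x"] M(1) unfolding co_def by (auto split: prod.splits)
      qed
    qed
    fix b assume b: "b \<in> ?B"
    show "F b \<in> borel_measurable (gaussm n d \<sigma>)"
    proof (cases b)
      case (Inl p)
      then have "p < n" using b M by auto
      then show ?thesis unfolding F_def Inl sum.case sqdist_def
        by (intro borel_measurable_diff borel_measurable_sum borel_measurable_power pts_measurable) auto
    next
      case (Inr x)
      then show ?thesis using b unfolding F_def Inr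
        by (auto split: prod.splits intro!: borel_measurable_diff lin_measurable)
    qed
    show "\<alpha> b \<noteq> 0"
    proof (cases b)
      case (Inl p) then show ?thesis using \<alpha>l[of p] \<delta>d b by auto
    next
      case (Inr x) then show ?thesis using ve[of "fst x"] b unfolding \<alpha>_def by (auto split: prod.splits)
    qed
    show "0 \<le> \<tau> b" unfolding \<tau>_def using \<sigma> by (auto split: sum.splits)
    show "F b (g(co b := v)) = F b (g(co b := 0)) + \<alpha> b * v" for g v
    proof (cases b)
      case (Inl p)
      then have "lsel p < d" using b lsel by auto
      then show ?thesis unfolding F_def co_def \<alpha>_def Inl sum.case by (rule sqdist_pts_affine)
    next
      case (Inr x)
      obtain j l where x: "x = (j, l)" by (cases x)
      then have "e j < n" using Inr b e[of j] M by auto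
      then show ?thesis using lin_upd[of "e j" n \<mu> g l v "vec j"] unfolding F_def co_def \<alpha>_def Inr x by simp
    qed
    show "\<tau> b / (\<bar>\<alpha> b\<bar> * \<sigma>) \<le> \<beta> b"
    proof (cases b)
      case (Inl p)
      then have a: "\<delta> / real d \<le> \<bar>\<alpha> b\<bar>" using \<alpha>l b by auto
      have a0: "0 < \<bar>\<alpha> b\<bar>" using a \<delta>d by linarith
      have "11 * real d * D * w / (\<bar>\<alpha> b\<bar> * \<sigma>) \<le> 11 * real d * D * w / ((\<delta> / real d) * \<sigma>)"
        using a a0 \<sigma> \<delta>d by (intro divide_left_mono mult_right_mono mult_pos_pos) auto
      also have "\<dots> = 11 * real d ^ 2 * D * w / (\<delta> * \<sigma>)" using \<sigma> by (simp add: power2_eq_square)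
      finally show ?thesis unfolding \<tau>_def \<beta>_def Inl by simp
    next
      case (Inr x)
      then have "\<bar>\<alpha> b\<bar> = 1" using ve[of "fst x"] b unfolding \<alpha>_def by (auto split: prod.splits)
      then show ?thesis unfolding \<tau>_def \<beta>_def using Inr by simp
    qed
    fix b' g v assume b': "b' \<in> ?B" "b' \<noteq> b" "rk' b \<le> rk' b'"
    show "F b (g(co b' := v)) = F b g"
    proof (cases b)
      case (Inl p)
      have "fst (co b') \<noteq> p"
      proof (cases b')
        case (Inl p') then show ?thesis using \<open>b = Inl p\<close> b' unfolding co_def by auto
      next
        case (Inr x)
        then have "fst x \<in> \<Lambda>" using b' by auto
        then show ?thesis using e[of "fst x"] Inr \<open>b = Inl p\<close> b unfolding co_def by (auto split: prod.splits)
      qed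
      then have "pts \<mu> (g(co b' := v)) p = pts \<mu> g p" using pts_upd_other[of "fst (co b')" p \<mu> g "snd (co b')" v] by simp
      then show ?thesis unfolding F_def Inl by simp
    next
      case (Inr x)
      obtain j l where x: "x = (j, l)" by (cases x)
      have j: "j \<in> \<Lambda>" using b Inr x by auto
      obtain x' where "b' = Inr x'" using b'(3) unfolding rk'_def Inr x by (cases b') auto
      then obtain j' l' where x': "b' = Inr (j', l')" by (cases x') auto
      have j': "j' \<in> \<Lambda>" using b' x' by auto
      have "rk j' \<le> rk j" using b'(3) K[OF j] K[OF j'] unfolding rk'_def Inr x x' by simp
      then have "l' \<noteq> l \<or> vec j (e j') = 0" using e3[OF j j'] b'(2) x' Inr x unfolding vec_def inc_def by auto
      then have "lin n (pts \<mu> (g((e j', l') := v))) (vec j) l = lin n (pts \<mu> g) (vec j) l" by (rule lin_indep)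
      then show ?thesis unfolding F_def co_def Inr x x' by simp
    qed
  qed
  moreover have "(\<Prod>b\<in>?B. \<beta> b) = (11 * real d ^ 2 * D * w / (\<delta> * \<sigma>)) ^ card Gd * (2 * real n * w / \<sigma>) ^ (d * card \<Lambda>)"
    using fin unfolding \<beta>_def by (simp add: prod.Plus card_cartesian_product mult.commute)
  ultimately have "small_event (gaussm n d \<sigma>) (\<lambda>g. \<forall>b\<in>?B. \<bar>F b g\<bar> \<le> \<tau> b)
    ((11 * real d ^ 2 * D * w / (\<delta> * \<sigma>)) ^ card Gd * (2 * real n * w / \<sigma>) ^ (d * card \<Lambda>))" by simp
  then show ?thesis
  proof (rule small_event_mono[OF _ _ order_refl])
    fix g assume ev: "blueprint_event n d D w \<delta> M src dst Gd \<Lambda> ch (pts \<mu> g)"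
    show "\<forall>b\<in>?B. \<bar>F b g\<bar> \<le> \<tau> b"
    proof
      fix b assume "b \<in> ?B"
      then show "\<bar>F b g\<bar> \<le> \<tau> b" using ev unfolding blueprint_event_def F_def \<tau>_def vlin by auto
    qed
  qed
qed

lemma finite_net_grid: "finite (net_grid d k Z1 Z2 \<Lambda> H)"
  unfolding net_grid_def by (intro finite_PiE) (auto split: prod.splits)

lemma card_net_grid:
  assumes "\<Lambda> \<subseteq> {..<k}" "H \<subseteq> {..<k}" "\<Lambda> \<inter> H = {}" "0 \<le> Z1" "0 \<le> Z2"
  shows "real (card (net_grid d k Z1 Z2 \<Lambda> H)) = ((2 * real_of_int Z2 + 1) ^ card \<Lambda> * (2 * real_of_int Z1 + 1) ^ card H) ^ d"
proof -
  let ?f = "\<lambda>j. if j \<in> \<Lambda> then 2 * real_of_int Z2 + 1 else if j \<in> H then 2 * real_of_int Z1 + 1 else 1"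
  have fin: "finite \<Lambda>" "finite H" using assms finite_subset by blast+
  have "real (card (net_grid d k Z1 Z2 \<Lambda> H)) = (\<Prod>x\<in>{..<k} \<times> {..<d}. ?f (fst x))"
    unfolding net_grid_def card_PiE[OF finite_cartesian_product[OF finite_lessThan finite_lessThan]] of_nat_prod
    using assms(4,5) by (intro prod.cong) auto
  also have "\<dots> = (\<Prod>j<k. \<Prod>l<d. ?f j)" unfolding prod.cartesian_product case_prod_beta ..
  also have "\<dots> = (\<Prod>j<k. ?f j) ^ d" by (simp add: prod_power_distrib)
  also have "(\<Prod>j<k. ?f j) = (\<Prod>j\<in>\<Lambda> \<union> H. ?f j)" using assms by (intro prod.mono_neutral_right) auto
  also have "\<dots> = (\<Prod>j\<in>\<Lambda>. ?f j) * (\<Prod>j\<in>H. ?f j)" using assms fin by (intro prod.union_disjoint) auto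
  also have "(\<Prod>j\<in>\<Lambda>. ?f j) = (\<Prod>j\<in>\<Lambda>. 2 * real_of_int Z2 + 1)" by (intro prod.cong) auto
  also have "(\<Prod>j\<in>H. ?f j) = (\<Prod>j\<in>H. 2 * real_of_int Z1 + 1)" using assms by (intro prod.cong) auto
  finally show ?thesis by simp
qed

text \<open>Regrouping of the union bound: each light coordinate pairs its grid size a with the
  probability c of its balance, each coordinate of a cluster in \<open>H\<close> pairs its grid size
  b with four good edges, and g good edges are left over.\<close>

lemma grid_power_identity:
  fixes a b c q :: real
  shows "(a ^ L * b ^ h) ^ d * (q ^ (4 * (d * h) + g) * c ^ (d * L)) = (a * c) ^ (d * L) * (b * q ^ 4) ^ (d * h) * q ^ g"
  by (simp add: power_mult_distrib power_add mult_ac flip: power_mult)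

text \<open>The number of blueprints and the paired factors of the light clusters together cost at
  most N0^(k d). At least half of the good edges remain after paying for \<open>H\<close>, and k d
  is at most \<kappa> times the number of good edges, so a cost of N0^(2 \<kappa>) per remaining
  edge suffices. At least four remain, hence the fourth power.\<close>

lemma small_blueprint_bad:
  fixes \<kappa> n d k :: nat and Z1 Z2 :: int and N0 A2 D w \<delta> \<sigma> :: real
  defines "q1 \<equiv> 11 * real d ^ 2 * D * w / (\<delta> * \<sigma>)" and "m \<equiv> 16 * k * d"
  assumes \<sigma>: "0 < \<sigma>" "0 < \<delta>" "0 \<le> D" "0 \<le> w" "0 < d" "0 < k" "0 < n" and Z: "0 \<le> Z1" "0 \<le> Z2"
    and A2: "(2 * real_of_int Z2 + 1) * (2 * real n * w / \<sigma>) \<le> A2" "1 \<le> A2"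
    and bq: "(2 * real_of_int Z1 + 1) * q1 ^ 4 \<le> 1"
    and N0: "1 \<le> N0" "real ((n + 1) ^ m * ((k ^ m) ^ 2 * (2 ^ m * (2 ^ k * 2 ^ k)))) * A2 ^ (k * d) \<le> N0 ^ (k * d)"
    and fin: "N0 ^ (2 * \<kappa>) * q1 \<le> 1"
  shows "small_event (gaussm n d \<sigma>) (\<lambda>g. blueprint_bad n d k \<kappa> D w \<delta> Z1 Z2 \<mu> (pts \<mu> g)) ((N0 ^ (2 * \<kappa>) * q1) ^ 4)"
proof -
  let ?M = "gaussm n d \<sigma>"
  \<comment> \<open>Counts the choices of M, of the pair src and dst, of Gd, of \<Lambda> and of
    H.\<close>
  define N where "N = (n + 1) ^ m * ((k ^ m) ^ 2 * (2 ^ m * (2 ^ k * 2 ^ k)))"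
  define Q where "Q = (N0 ^ (2 * \<kappa>) * q1) ^ 4 / real N"
  have Npos: "0 < real N" unfolding N_def using \<sigma> by simp
  have q0: "0 \<le> q1" unfolding q1_def using \<sigma> by simp
  have q1le: "q1 \<le> 1"
  proof -
    have "1 * q1 \<le> N0 ^ (2 * \<kappa>) * q1" using N0(1) q0 by (intro mult_right_mono one_le_power)
    then show ?thesis using fin by simp
  qed
  have Q0: "0 \<le> Q" unfolding Q_def using Npos q0 N0 by simp
  have inner: "small_event ?M (\<lambda>g. blueprint n d k \<kappa> M src dst Gd \<Lambda> H \<and> (\<exists>z\<in>net_grid d k Z1 Z2 \<Lambda> H.
      blueprint_event n d D w \<delta> M src dst Gd \<Lambda> (net_center \<mu> w M src dst \<Lambda> z) (pts \<mu> g))) Q" for M src dst Gd \<Lambda> H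
  proof (cases "blueprint n d k \<kappa> M src dst Gd \<Lambda> H")
    case False
    then show ?thesis unfolding small_event_def by (intro bexI[of _ "{}"]) auto
  next
    case bp: True
    have c: "\<Lambda> \<subseteq> {..<k}" "H \<subseteq> {..<k}" "\<Lambda> \<inter> H = {}" "8 * d * card H \<le> card Gd" "k * d \<le> \<kappa> * card Gd" "8 \<le> card Gd"
      using bp unfolding blueprint_def by auto
    let ?p = "q1 ^ card Gd * (2 * real n * w / \<sigma>) ^ (d * card \<Lambda>)"
    have p0: "0 \<le> ?p" using q0 \<sigma> by simp
    have "small_event ?M (\<lambda>g. \<exists>z\<in>net_grid d k Z1 Z2 \<Lambda> H.
      blueprint_event n d D w \<delta> M src dst Gd \<Lambda> (net_center \<mu> w M src dst \<Lambda> z) (pts \<mu> g))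
      (((2 * real_of_int Z2 + 1) ^ card \<Lambda> * (2 * real_of_int Z1 + 1) ^ card H) ^ d * ?p)"
      by (rule small_event_Union[OF finite_net_grid _ eq_refl[OF card_net_grid[OF c(1-3) Z]] p0])
        (use small_blueprint_event[OF bp \<sigma>(1-5)] in \<open>simp add: q1_def\<close>)
    moreover have "((2 * real_of_int Z2 + 1) ^ card \<Lambda> * (2 * real_of_int Z1 + 1) ^ card H) ^ d * ?p \<le> Q"
    proof -
      let ?b = "2 * real_of_int Z1 + 1" and ?a = "(2 * real_of_int Z2 + 1) * (2 * real n * w / \<sigma>)"
      define g' where "g' = card Gd - 4 * d * card H"
      have g': "card Gd = 4 * (d * card H) + g'" "card Gd \<le> 2 * g'" "4 \<le> g'" using c(4,6) unfolding g'_def by auto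
      have b1: "1 \<le> ?b" using Z by simp
      have a0: "0 \<le> ?a" using Z \<sigma> by simp
      have e: "((2 * real_of_int Z2 + 1) ^ card \<Lambda> * ?b ^ card H) ^ d * ?p = ?a ^ (d * card \<Lambda>) * (?b * q1 ^ 4) ^ (d * card H) * q1 ^ g'"
        unfolding g'(1) by (rule grid_power_identity)
      have "card \<Lambda> \<le> k" using card_mono[OF _ c(1)] by simp
      have "?a ^ (d * card \<Lambda>) \<le> A2 ^ (d * card \<Lambda>)" using A2 a0 by (intro power_mono) auto
      also have "\<dots> \<le> A2 ^ (k * d)" using A2 \<open>card \<Lambda> \<le> k\<close> by (intro power_increasing) (auto simp: mult.commute)
      finally have 1: "?a ^ (d * card \<Lambda>) \<le> A2 ^ (k * d)" .
      have 2: "(?b * q1 ^ 4) ^ (d * card H) \<le> 1" using bq b1 q0 by (intro power_le_one) auto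
      have "?a ^ (d * card \<Lambda>) * (?b * q1 ^ 4) ^ (d * card H) * q1 ^ g' \<le> A2 ^ (k * d) * 1 * q1 ^ g'"
        using 1 2 A2 b1 q0 by (intro mult_mono mult_nonneg_nonneg zero_le_power) auto
      then have "real N * (?a ^ (d * card \<Lambda>) * (?b * q1 ^ 4) ^ (d * card H) * q1 ^ g') \<le> real N * (A2 ^ (k * d) * q1 ^ g')"
        using Npos by (intro mult_left_mono) auto
      also have "\<dots> = (real N * A2 ^ (k * d)) * q1 ^ g'" by simp
      also have "\<dots> \<le> N0 ^ (k * d) * q1 ^ g'" using N0(2) q0 unfolding N_def by (intro mult_right_mono) auto
      also have "\<dots> \<le> N0 ^ (2 * \<kappa> * g') * q1 ^ g'"
      proof (intro mult_right_mono power_increasing N0(1))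
        have "\<kappa> * card Gd \<le> \<kappa> * (2 * g')" using g'(2) by (intro mult_left_mono) auto
        also have "\<dots> = 2 * \<kappa> * g'" by simp
        finally show "k * d \<le> 2 * \<kappa> * g'" using c(5) by linarith
      qed (use q0 in auto)
      also have "\<dots> = (N0 ^ (2 * \<kappa>) * q1) ^ g'" by (simp add: power_mult power_mult_distrib)
      also have "\<dots> \<le> (N0 ^ (2 * \<kappa>) * q1) ^ 4" using fin g'(3) q0 N0 by (intro power_decreasing) auto
      finally show ?thesis unfolding e Q_def using Npos by (simp add: pos_le_divide_eq mult.commute)
    qed
    ultimately show ?thesis using bp by (auto elim: small_event_mono)
  qed
  let ?E = "\<lambda>M src dst Gd \<Lambda> H g. blueprint n d k \<kappa> M src dst Gd \<Lambda> H \<and> (\<exists>z\<in>net_grid d k Z1 Z2 \<Lambda> H.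
      blueprint_event n d D w \<delta> M src dst Gd \<Lambda> (net_center \<mu> w M src dst \<Lambda> z) (pts \<mu> g))"
  let ?MM = "{M. M \<subseteq> {..<n} \<and> card M \<le> m}"
  have "small_event ?M (\<lambda>g. \<exists>M\<in>?MM. \<exists>x\<in>(M \<rightarrow>\<^sub>E {..<k}) \<times> (M \<rightarrow>\<^sub>E {..<k}). \<exists>Gd\<in>Pow M. \<exists>\<Lambda>\<in>Pow {..<k}. \<exists>H\<in>Pow {..<k}.
      ?E M (fst x) (snd x) Gd \<Lambda> H g) (real ((n + 1) ^ m) * (real ((k ^ m) ^ 2) * (real (2 ^ m) * (real (2 ^ k) * (real (2 ^ k) * Q)))))"
  proof (intro small_event_Union inner)
    show "finite ?MM" by (rule finite_subset[of _ "Pow {..<n}"]) auto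
    show "real (card ?MM) \<le> real ((n + 1) ^ m)" using card_small_subsets[of n m] by linarith
    fix M assume M: "M \<in> ?MM"
    then have fM: "finite M" using finite_subset[of M "{..<n}"] by auto
    show "finite ((M \<rightarrow>\<^sub>E {..<k}) \<times> (M \<rightarrow>\<^sub>E {..<k}))" using fM by (intro finite_cartesian_product finite_PiE) auto
    have "card (M \<rightarrow>\<^sub>E {..<k}) \<le> k ^ m" using fM M \<sigma> by (auto simp: card_PiE intro!: power_increasing)
    then have "card (M \<rightarrow>\<^sub>E {..<k}) * card (M \<rightarrow>\<^sub>E {..<k}) \<le> k ^ m * k ^ m" by (intro mult_mono) auto
    then show "real (card ((M \<rightarrow>\<^sub>E {..<k}) \<times> (M \<rightarrow>\<^sub>E {..<k}))) \<le> real ((k ^ m) ^ 2)"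
      unfolding card_cartesian_product power2_eq_square by (simp only: of_nat_le_iff)
    show "finite (Pow M)" using fM by simp
    show "real (card (Pow M)) \<le> real (2 ^ m)" using fM M by (simp add: card_Pow)
    show "finite (Pow {..<k})" by simp
    show "real (card (Pow {..<k})) \<le> real (2 ^ k)" by (simp add: card_Pow)
    show "finite (Pow {..<k})" by simp
    show "real (card (Pow {..<k})) \<le> real (2 ^ k)" by (simp add: card_Pow)
  qed (use Q0 in \<open>auto intro!: mult_nonneg_nonneg\<close>)
  moreover have "real ((n + 1) ^ m) * (real ((k ^ m) ^ 2) * (real (2 ^ m) * (real (2 ^ k) * (real (2 ^ k) * Q)))) = (N0 ^ (2 * \<kappa>) * q1) ^ 4"
  proof -
    have "real ((n + 1) ^ m) * (real ((k ^ m) ^ 2) * (real (2 ^ m) * (real (2 ^ k) * (real (2 ^ k) * Q)))) = real N * Q"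
      unfolding N_def by (simp only: of_nat_mult mult.assoc)
    then show ?thesis unfolding Q_def using Npos by simp
  qed
  ultimately have "small_event ?M (\<lambda>g. \<exists>M\<in>?MM. \<exists>x\<in>(M \<rightarrow>\<^sub>E {..<k}) \<times> (M \<rightarrow>\<^sub>E {..<k}). \<exists>Gd\<in>Pow M. \<exists>\<Lambda>\<in>Pow {..<k}. \<exists>H\<in>Pow {..<k}.
      ?E M (fst x) (snd x) Gd \<Lambda> H g) ((N0 ^ (2 * \<kappa>) * q1) ^ 4)" by simp
  then show ?thesis
  proof (rule small_event_mono[OF _ _ order_refl])
    fix g assume "blueprint_bad n d k \<kappa> D w \<delta> Z1 Z2 \<mu> (pts \<mu> g)"
    then obtain M src dst Gd \<Lambda> H z where b: "blueprint n d k \<kappa> M src dst Gd \<Lambda> H" "z \<in> net_grid d k Z1 Z2 \<Lambda> H"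
      "blueprint_event n d D w \<delta> M src dst Gd \<Lambda> (net_center \<mu> w M src dst \<Lambda> z) (pts \<mu> g)" unfolding blueprint_bad_def by blast
    have m: "M \<in> ?MM" "(src, dst) \<in> (M \<rightarrow>\<^sub>E {..<k}) \<times> (M \<rightarrow>\<^sub>E {..<k})" "Gd \<in> Pow M" "\<Lambda> \<in> Pow {..<k}" "H \<in> Pow {..<k}"
      using b(1) unfolding blueprint_def m_def by auto
    have "?E M (fst (src, dst)) (snd (src, dst)) Gd \<Lambda> H g" using b by auto
    then show "\<exists>M\<in>?MM. \<exists>x\<in>(M \<rightarrow>\<^sub>E {..<k}) \<times> (M \<rightarrow>\<^sub>E {..<k}). \<exists>Gd\<in>Pow M. \<exists>\<Lambda>\<in>Pow {..<k}. \<exists>H\<in>Pow {..<k}. ?E M (fst x) (snd x) Gd \<Lambda> H g"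
      using m by blast
  qed
qed

section \<open>Choice of the scales\<close>

locale scales =
  fixes n d k \<kappa> :: nat and \<sigma> \<theta> :: real
  assumes n2: "2 \<le> n" and k0: "0 < k" and d0: "0 < d" and kn: "k \<le> n" and dn: "d \<le> n" and \<sigma>: "0 < \<sigma>"
    and \<kappa>0: "0 < \<kappa>" and k\<kappa>: "k \<le> \<kappa> * \<kappa>" and \<theta>: "0 < \<theta>"
begin

text \<open>If the potential drops by at most w^2, no center moves by more than w; two centers at distance at most
  \<delta> count as close, and R separates clusters that exchange few points from those that exchange many.\<close>
definition "Y = 1 / \<sigma> + 4 * real n"
text \<open>The exponent 660 \<kappa> comes from pairs of relations: the square of n^(8 R + 4) with
  R = 80 \<kappa> d against \<theta>^(2 d). The exponent 3 comes from the grid of a center in the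
  box, whose cost after four good edges is of order Y^5 \<theta>^2 up to powers of n.\<close>

definition "A = real n ^ (660 * \<kappa>) * Y ^ 3"
definition "w = \<sigma> * \<theta>\<^sup>2"
definition "\<delta> = \<sigma> * \<theta>"
definition "D = 1 + 4 * real n * \<sigma>"
definition "R = 80 * \<kappa> * d"

lemma Y8: "8 \<le> Y" using n2 \<sigma> unfolding Y_def by (simp add: add_increasing)
lemma nr: "2 \<le> real n" using n2 by simp
lemma DY: "D = \<sigma> * Y" unfolding D_def Y_def using \<sigma> by (simp add: field_simps)
lemma wpos: "0 < w" and \<delta>pos: "0 < \<delta>" and Dpos: "0 < D" unfolding w_def \<delta>_def D_def using \<sigma> \<theta> by (auto intro: add_pos_nonneg)
lemma w\<sigma>: "w / \<sigma> = \<theta>\<^sup>2" and \<delta>\<sigma>: "\<delta> / \<sigma> = \<theta>" unfolding w_def \<delta>_def using \<sigma> by auto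

lemma pow_n: "a \<le> b \<Longrightarrow> real n ^ a \<le> real n ^ b" using nr by (intro power_increasing) auto

lemma two_pow: "2 ^ a \<le> real n ^ a" using nr by (intro power_mono) auto

lemma num_le: "x \<le> 2 ^ a \<Longrightarrow> x \<le> real n ^ a" for x :: real using two_pow[of a] by linarith

context assumes A\<theta>: "A * \<theta> \<le> 1" begin

lemma mono: "a \<le> 660 * \<kappa> \<Longrightarrow> b \<le> 3 \<Longrightarrow> real n ^ a * Y ^ b * \<theta> \<le> A * \<theta>"
  unfolding A_def using nr Y8 \<theta> by (intro mult_right_mono mult_mono power_increasing) auto

lemma mono1: "a \<le> 660 * \<kappa> \<Longrightarrow> b \<le> 3 \<Longrightarrow> real n ^ a * Y ^ b * \<theta> \<le> 1" using mono A\<theta> by (rule order_trans)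

lemma \<theta>1: "real n ^ 10 * \<theta> \<le> 1" "\<theta> \<le> 1"
proof -
  show a: "real n ^ 10 * \<theta> \<le> 1" using mono1[of 10 0] \<kappa>0 by simp
  have "1 * \<theta> \<le> real n ^ 10 * \<theta>" using nr \<theta> by (intro mult_right_mono one_le_power) auto
  then show "\<theta> \<le> 1" using a by simp
qed

lemma final_pow:
  assumes "a \<le> 660 * \<kappa>" "b \<le> 3" "4 \<le> m" "q \<le> (real n ^ a * Y ^ b * \<theta>) ^ m"
  shows "q \<le> (A * \<theta>) ^ 4"
proof -
  have nn: "0 \<le> real n ^ a * Y ^ b * \<theta>" using nr Y8 \<theta> by auto
  have "(real n ^ a * Y ^ b * \<theta>) ^ m \<le> (real n ^ a * Y ^ b * \<theta>) ^ 4"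
    using nn mono1[OF assms(1,2)] assms(3) by (intro power_decreasing) auto
  also have "\<dots> \<le> (A * \<theta>) ^ 4" using nn mono[OF assms(1,2)] by (intro power_mono) auto
  finally show ?thesis using assms(4) by simp
qed

lemma n1sq: "real n + 1 \<le> real n ^ 2" "2 * real n \<le> real n ^ 2"
proof -
  have "2 * real n \<le> real n * real n" using nr by (intro mult_right_mono) auto
  then show "2 * real n \<le> real n ^ 2" "real n + 1 \<le> real n ^ 2" using nr unfolding power2_eq_square by linarith+
qed

lemma count_le: "real (((n + 1) ^ r) ^ 4 * (2 * n) ^ 2) \<le> real n ^ (8 * r + 4)"
proof -
  have "real (((n + 1) ^ r) ^ 4 * (2 * n) ^ 2) = ((real n + 1) ^ r) ^ 4 * (2 * real n) ^ 2" by (simp add: add.commute)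
  also have "\<dots> \<le> ((real n ^ 2) ^ r) ^ 4 * (real n ^ 2) ^ 2" using n1sq by (intro mult_mono power_mono) auto
  also have "\<dots> = real n ^ (8 * r + 4)" by (simp add: power_add flip: power_mult)
  finally show ?thesis .
qed

lemma \<kappa>d: "1 \<le> \<kappa> * d" "d \<le> \<kappa> * d" using \<kappa>0 d0 by (auto simp: Suc_le_eq)

lemma ceil_le: "2 * real_of_int (\<lceil>x\<rceil> + 1) + 1 \<le> 2 * x + 5"
  using of_int_ceiling_le_add_one[of x] unfolding of_int_add of_int_1 distrib_left by linarith

text \<open>The threshold is of order \<theta>^2, so d coordinates give \<theta>^(2 d), which is at
  least four factors \<theta> exactly when d \<ge> 2.\<close>

lemma one_relation_small:
  assumes d2: "2 \<le> d"
  shows "small_event (gaussm n d \<sigma>) (\<lambda>g. one_relation n d R (20 * real n ^ 2 * w) (pts \<mu> g)) ((A * \<theta>) ^ 4)"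
proof (rule small_event_mono[OF small_one_relation])
  have "20 * real n ^ 4 \<le> real n ^ 5 * real n ^ 4" using num_le[of 20 5] by (intro mult_right_mono) auto
  then have b: "20 * real n ^ 4 * \<theta>\<^sup>2 \<le> real n ^ 9 * \<theta>\<^sup>2" by (intro mult_right_mono) (auto simp flip: power_add)
  have "real n ^ 2 * (20 * real n ^ 2 * w) / \<sigma> = 20 * real n ^ 4 * (w / \<sigma>)" by (simp flip: power_add)
  then have "(real n ^ 2 * (20 * real n ^ 2 * w) / \<sigma>) ^ d = (20 * real n ^ 4 * \<theta>\<^sup>2) ^ d" unfolding w\<sigma> by simp
  also have "\<dots> \<le> (real n ^ 9 * \<theta>\<^sup>2) ^ d" using b by (intro power_mono) auto
  finally have "real (((n + 1) ^ R) ^ 4 * (2 * n) ^ 2) * (real n ^ 2 * (20 * real n ^ 2 * w) / \<sigma>) ^ d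
     \<le> real n ^ (8 * R + 4) * (real n ^ 9 * \<theta>\<^sup>2) ^ d"
    using count_le[of R] wpos \<sigma> by (intro mult_mono) auto
  also have "\<dots> = real n ^ (8 * R + 4 + 9 * d) * \<theta> ^ (2 * d)" by (simp add: power_add power_mult_distrib flip: power_mult)
  also have "\<dots> \<le> real n ^ (653 * \<kappa> * (2 * d)) * \<theta> ^ (2 * d)"
  proof (intro mult_right_mono pow_n)
    have "8 * R = 640 * (\<kappa> * d)" "653 * \<kappa> * (2 * d) = 1306 * (\<kappa> * d)" unfolding R_def by simp_all
    then show "8 * R + 4 + 9 * d \<le> 653 * \<kappa> * (2 * d)" using \<kappa>d by linarith
  qed (use \<theta> in auto)
  also have "\<dots> = (real n ^ (653 * \<kappa>) * Y ^ 0 * \<theta>) ^ (2 * d)" by (simp add: power_mult_distrib flip: power_mult)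
  finally have q: "real (((n + 1) ^ R) ^ 4 * (2 * n) ^ 2) * (real n ^ 2 * (20 * real n ^ 2 * w) / \<sigma>) ^ d \<le> (real n ^ (653 * \<kappa>) * Y ^ 0 * \<theta>) ^ (2 * d)" .
  show "real (((n + 1) ^ R) ^ 4 * (2 * n) ^ 2) * (real n ^ 2 * (20 * real n ^ 2 * w) / \<sigma>) ^ d \<le> (A * \<theta>) ^ 4"
    by (rule final_pow[OF _ _ _ q]) (use d2 in auto)
qed (use \<sigma> wpos in auto)

lemma two_relations_small:
  assumes d2: "2 \<le> d"
  shows "small_event (gaussm n d \<sigma>) (\<lambda>g. two_relations n d R (2 * \<delta>) (pts \<mu> g)) ((A * \<theta>) ^ 4)"
proof (rule small_event_mono[OF small_two_relations])
  have "8 * real n ^ 4 \<le> real n ^ 3 * real n ^ 4" using num_le[of 8 3] by (intro mult_right_mono) auto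
  then have b: "8 * real n ^ 4 * \<theta> \<le> real n ^ 7 * \<theta>" using \<theta> by (intro mult_right_mono) (auto simp flip: power_add)
  have "4 * real n ^ 4 * (2 * \<delta>) / \<sigma> = 8 * real n ^ 4 * (\<delta> / \<sigma>)" by simp
  then have "(4 * real n ^ 4 * (2 * \<delta>) / \<sigma>) ^ (2 * d) = (8 * real n ^ 4 * \<theta>) ^ (2 * d)" unfolding \<delta>\<sigma> by simp
  also have "\<dots> \<le> (real n ^ 7 * \<theta>) ^ (2 * d)" using b \<theta> by (intro power_mono) auto
  finally have "real ((((n + 1) ^ R) ^ 4 * (2 * n) ^ 2) ^ 2) * (4 * real n ^ 4 * (2 * \<delta>) / \<sigma>) ^ (2 * d)
     \<le> (real n ^ (8 * R + 4)) ^ 2 * (real n ^ 7 * \<theta>) ^ (2 * d)"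
    using power_mono[OF count_le[of R], of 2] \<delta>pos \<sigma> by (intro mult_mono) auto
  also have "\<dots> = real n ^ (2 * (8 * R + 4) + 14 * d) * \<theta> ^ (2 * d)"
    by (simp add: power_add power_mult_distrib mult_ac flip: power_mult)
  also have "\<dots> \<le> real n ^ (660 * \<kappa> * (2 * d)) * \<theta> ^ (2 * d)"
  proof (intro mult_right_mono pow_n)
    have "2 * (640 * x + 4) + 14 * y \<le> 1320 * x" if "1 \<le> x" "y \<le> x" for x y :: nat using that unfolding distrib_left by linarith
    from this[OF \<kappa>d] show "2 * (8 * R + 4) + 14 * d \<le> 660 * \<kappa> * (2 * d)" unfolding R_def by (simp only: mult_ac) simp
  qed (use \<theta> in auto)
  also have "\<dots> = (real n ^ (660 * \<kappa>) * Y ^ 0 * \<theta>) ^ (2 * d)" by (simp add: power_mult_distrib flip: power_mult)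
  finally have q: "real ((((n + 1) ^ R) ^ 4 * (2 * n) ^ 2) ^ 2) * (4 * real n ^ 4 * (2 * \<delta>) / \<sigma>) ^ (2 * d) \<le> (real n ^ (660 * \<kappa>) * Y ^ 0 * \<theta>) ^ (2 * d)" .
  show "real ((((n + 1) ^ R) ^ 4 * (2 * n) ^ 2) ^ 2) * (4 * real n ^ 4 * (2 * \<delta>) / \<sigma>) ^ (2 * d) \<le> (A * \<theta>) ^ 4"
    by (rule final_pow[OF _ _ _ q]) (use d2 in auto)
qed (use \<sigma> \<delta>pos in auto)

text \<open>With d = 1 the fourth power comes from two relations at the finer threshold of order
  \<theta>^2. They involve only single points, so R = 1.\<close>

lemma two_relations_small_1d:
  shows "small_event (gaussm n 1 \<sigma>) (\<lambda>g. two_relations n 1 1 (10 * real n ^ 2 * w) (pts \<mu> g)) ((A * \<theta>) ^ 4)"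
proof (rule small_event_mono[OF small_two_relations])
  have "40 * real n ^ 6 \<le> real n ^ 6 * real n ^ 6" using num_le[of 40 6] by (intro mult_right_mono) auto
  then have b: "40 * real n ^ 6 * \<theta>\<^sup>2 \<le> real n ^ 12 * \<theta>\<^sup>2" using \<theta> by (intro mult_right_mono) (auto simp flip: power_add)
  have "4 * real n ^ 4 * (10 * real n ^ 2 * w) / \<sigma> = 40 * real n ^ 6 * (w / \<sigma>)" by (simp flip: power_add)
  then have "(4 * real n ^ 4 * (10 * real n ^ 2 * w) / \<sigma>) ^ (2 * 1) = (40 * real n ^ 6 * \<theta>\<^sup>2) ^ (2 * 1)" unfolding w\<sigma> by simp
  also have "\<dots> \<le> (real n ^ 12 * \<theta>\<^sup>2) ^ (2 * 1)" using b by (intro power_mono) auto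
  finally have "real ((((n + 1) ^ 1) ^ 4 * (2 * n) ^ 2) ^ 2) * (4 * real n ^ 4 * (10 * real n ^ 2 * w) / \<sigma>) ^ (2 * 1)
     \<le> (real n ^ (8 * 1 + 4)) ^ 2 * (real n ^ 12 * \<theta>\<^sup>2) ^ (2 * 1)"
    using power_mono[OF count_le[of 1], of 2] wpos \<sigma> by (intro mult_mono) auto
  also have "\<dots> = (real n ^ 12 * Y ^ 0 * \<theta>) ^ 4" by (simp add: power_mult_distrib flip: power_mult power_add)
  finally have q: "real ((((n + 1) ^ 1) ^ 4 * (2 * n) ^ 2) ^ 2) * (4 * real n ^ 4 * (10 * real n ^ 2 * w) / \<sigma>) ^ (2 * 1) \<le> (real n ^ 12 * Y ^ 0 * \<theta>) ^ 4" .
  show "real ((((n + 1) ^ 1) ^ 4 * (2 * n) ^ 2) ^ 2) * (4 * real n ^ 4 * (10 * real n ^ 2 * w) / \<sigma>) ^ (2 * 1) \<le> (A * \<theta>) ^ 4"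
    by (rule final_pow[OF _ _ _ q]) (use \<kappa>0 in auto)
qed (use \<sigma> wpos in auto)

text \<open>The net of normals costs \<theta>^-d and that of offsets \<theta>^-1, at most
  \<theta>^-d, against \<theta>^(8 d) for 8 d points; what remains is \<theta>^(6 d).\<close>

lemma slab_small:
  "small_event (gaussm n d \<sigma>) (\<lambda>g. in_box n d D (pts \<mu> g) \<and> crowded_slab n d (8 * d) (real n * real d * \<delta>) (pts \<mu> g)) ((A * \<theta>) ^ 4)"
proof -
  define \<tau> where "\<tau> = real n * real d * \<delta>"
  define \<eta> where "\<eta> = \<tau> / (real d * D)"
  define Zu :: int where "Zu = \<lceil>1 / \<eta>\<rceil> + 1"
  define Zb :: int where "Zb = \<lceil>(real d * D + \<tau>) / \<tau>\<rceil> + 1"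
  have \<tau>: "0 < \<tau>" unfolding \<tau>_def using \<delta>pos n2 d0 by simp
  have \<eta>: "0 < \<eta>" unfolding \<eta>_def using \<tau> Dpos d0 by simp
  have inv: "1 / \<eta> = Y / (real n * \<theta>)" unfolding \<eta>_def \<tau>_def DY \<delta>_def using \<sigma> d0 \<theta> n2 by (simp add: field_simps)
  have Y\<theta>: "1 \<le> Y / \<theta>" using Y8 \<theta>1 \<theta> by (simp add: le_divide_eq)
  have invle: "1 / \<eta> \<le> Y / \<theta>"
  proof -
    have "Y / (real n * \<theta>) \<le> Y / (1 * \<theta>)" using Y8 \<theta> nr by (intro divide_left_mono mult_right_mono mult_pos_pos) auto
    then show ?thesis unfolding inv by simp
  qed
  have bZu: "2 * real_of_int Zu + 1 \<le> real n ^ 3 * Y / \<theta>"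
  proof -
    have "2 * real_of_int Zu + 1 \<le> 2 * (1 / \<eta>) + 5" unfolding Zu_def by (rule ceil_le)
    also have "\<dots> \<le> 7 * (Y / \<theta>)" using invle Y\<theta> by linarith
    also have "\<dots> \<le> real n ^ 3 * (Y / \<theta>)" using num_le[of 7 3] Y\<theta> by (intro mult_right_mono) auto
    finally show ?thesis by simp
  qed
  have dD\<tau>: "real d * D / \<tau> = 1 / \<eta>" unfolding \<eta>_def using \<tau> Dpos d0 by simp
  have bZb: "2 * real_of_int Zb + 1 \<le> real n ^ 4 * Y / \<theta>"
  proof -
    have "(real d * D + \<tau>) / \<tau> = 1 / \<eta> + 1" using dD\<tau> \<tau> by (simp add: add_divide_distrib)
    then have "2 * real_of_int Zb + 1 \<le> 2 * (1 / \<eta> + 1) + 5" unfolding Zb_def using ceil_le[of "(real d * D + \<tau>) / \<tau>"] by simp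
    also have "\<dots> \<le> 9 * (Y / \<theta>)"
    proof -
      have "2 * (x + 1) + 5 \<le> 9 * y" if "x \<le> y" "1 \<le> y" for x y :: real using that unfolding distrib_left by linarith
      from this[OF invle Y\<theta>] show ?thesis .
    qed
    also have "\<dots> \<le> real n ^ 4 * (Y / \<theta>)" using num_le[of 9 4] Y\<theta> by (intro mult_right_mono) auto
    finally show ?thesis by simp
  qed
  have Zn: "0 \<le> real_of_int Zu" "0 \<le> real_of_int Zb"
  proof -
    have "0 < 1 / \<eta>" "0 < (real d * D + \<tau>) / \<tau>" using \<eta> \<tau> Dpos by (auto intro!: divide_pos_pos add_nonneg_pos)
    then have "0 \<le> \<lceil>1 / \<eta>\<rceil>" "0 \<le> \<lceil>(real d * D + \<tau>) / \<tau>\<rceil>" by linarith+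
    then show "0 \<le> real_of_int Zu" "0 \<le> real_of_int Zb" unfolding Zu_def Zb_def by auto
  qed
  have "3 * \<tau> / \<sigma> = 3 * real n * real d * \<theta>" unfolding \<tau>_def \<delta>_def using \<sigma> by simp
  also have "\<dots> \<le> real n ^ 2 * real n * real n * \<theta>" using num_le[of 3 2] dn \<theta> by (intro mult_right_mono mult_mono) auto
  also have "\<dots> = real n ^ 4 * \<theta>" by (simp add: power4_eq_xxxx power2_eq_square)
  finally have b\<tau>: "3 * \<tau> / \<sigma> \<le> real n ^ 4 * \<theta>" .
  show ?thesis unfolding \<tau>_def[symmetric]
  proof (rule small_event_mono[OF small_crowded_slab[where \<eta> = \<eta> and Zu = Zu and Zb = Zb]])
    show "real d * \<eta> * D \<le> \<tau>" unfolding \<eta>_def using d0 Dpos by simp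
    have "1 / \<eta> \<le> real_of_int Zu - 1" unfolding Zu_def by simp
    then show "1 \<le> \<eta> * (real_of_int Zu - 1)" using \<eta> by (simp add: divide_le_eq mult.commute)
    have "(real d * D + \<tau>) / \<tau> \<le> real_of_int Zb - 1" unfolding Zb_def by simp
    then show "real d * D + \<tau> \<le> \<tau> * (real_of_int Zb - 1)" using \<tau> by (simp add: divide_le_eq mult.commute)
    have c1: "real ((n + 1) ^ (8 * d)) \<le> (real n ^ 16) ^ d"
    proof -
      have "real ((n + 1) ^ (8 * d)) = (real n + 1) ^ (8 * d)" by (simp add: add.commute)
      also have "\<dots> \<le> (real n ^ 2) ^ (8 * d)" using n1sq by (intro power_mono) auto
      finally show ?thesis by (simp flip: power_mult)
    qed
    have c2: "real d \<le> real n ^ d"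
    proof -
      have "real d \<le> real n" using dn by simp
      also have "\<dots> \<le> real n ^ d" using pow_n[of 1 d] d0 by simp
      finally show ?thesis .
    qed
    have c3: "real n ^ 4 * Y / \<theta> \<le> (real n ^ 4 * Y / \<theta>) ^ d"
    proof -
      have "1 * 1 \<le> real n ^ 4 * (Y / \<theta>)" using Y\<theta> nr by (intro mult_mono one_le_power) auto
      then have "(real n ^ 4 * (Y / \<theta>)) ^ 1 \<le> (real n ^ 4 * (Y / \<theta>)) ^ d" using d0 by (intro power_increasing) auto
      then show ?thesis by simp
    qed
    have "real ((n + 1) ^ (8 * d)) * (real d * ((2 * real_of_int Zu + 1) ^ d * ((2 * real_of_int Zb + 1) * (3 * \<tau> / \<sigma>) ^ (8 * d))))
      \<le> (real n ^ 16) ^ d * (real n ^ d * ((real n ^ 3 * Y / \<theta>) ^ d * ((real n ^ 4 * Y / \<theta>) ^ d * (real n ^ 4 * \<theta>) ^ (8 * d))))"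
      using c1 c2 order_trans[OF bZb c3] bZu b\<tau> Zn \<tau> \<sigma> Y8 \<theta>
      by (intro mult_mono power_mono mult_nonneg_nonneg zero_le_power) auto
    also have "\<dots> = (real n ^ 16 * (real n * ((real n ^ 3 * Y / \<theta>) * ((real n ^ 4 * Y / \<theta>) * (real n ^ 4 * \<theta>) ^ 8)))) ^ d"
      by (simp add: power_mult_distrib power_divide power_mult)
    also have "real n ^ 16 * (real n * ((real n ^ 3 * Y / \<theta>) * ((real n ^ 4 * Y / \<theta>) * (real n ^ 4 * \<theta>) ^ 8))) = real n ^ 56 * Y ^ 2 * \<theta> ^ 6"
    proof -
      have "real n ^ 16 * (real n * ((real n ^ 3 * Y / \<theta>) * ((real n ^ 4 * Y / \<theta>) * (real n ^ 4 * \<theta>) ^ 8)))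
        = (real n ^ 16 * real n ^ 1 * real n ^ 3 * real n ^ 4 * real n ^ 32) * (Y * Y) * (\<theta> ^ 8 / (\<theta> * \<theta>))"
        by (simp add: power_mult_distrib flip: power_mult)
      also have "\<theta> ^ 8 / (\<theta> * \<theta>) = \<theta> ^ 6" using \<theta> by (simp add: field_simps flip: power_Suc)
      also have "real n ^ 16 * real n ^ 1 * real n ^ 3 * real n ^ 4 * real n ^ 32 = real n ^ 56" unfolding power_add[symmetric] by simp
      finally show ?thesis by (simp add: power2_eq_square)
    qed
    also have "(real n ^ 56 * Y ^ 2 * \<theta> ^ 6) ^ d \<le> (real n ^ 60 * Y ^ 6 * \<theta> ^ 6) ^ d"
      using nr Y8 \<theta> by (intro power_mono mult_mono power_increasing) auto
    also have "\<dots> = (real n ^ 10 * Y ^ 1 * \<theta>) ^ (6 * d)" by (simp add: power_mult power_mult_distrib flip: power_mult[of "real n" 10 6])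
    finally have q: "real ((n + 1) ^ (8 * d)) * (real d * ((2 * real_of_int Zu + 1) ^ d * ((2 * real_of_int Zb + 1) * (3 * \<tau> / \<sigma>) ^ (8 * d))))
       \<le> (real n ^ 10 * Y ^ 1 * \<theta>) ^ (6 * d)" .
    show "real ((n + 1) ^ (8 * d)) * (real d * ((2 * real_of_int Zu + 1) ^ d * ((2 * real_of_int Zb + 1) * (3 * \<tau> / \<sigma>) ^ (8 * d)))) \<le> (A * \<theta>) ^ 4"
      by (rule final_pow[OF _ _ _ q]) (use \<kappa>0 d0 in auto)
  qed (use \<sigma> \<tau> Dpos d0 \<eta> in auto)
qed

definition "Z1 = \<lceil>D / w\<rceil> + 1"
definition "Z2 = \<lceil>real n * (w + 4 * real n * \<sigma>) / w\<rceil> + 1"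

lemma Z1_net: "D \<le> w * (real_of_int Z1 - 1)"
proof -
  have "D / w \<le> real_of_int Z1 - 1" unfolding Z1_def by simp
  then show ?thesis using wpos by (simp add: divide_le_eq mult.commute)
qed

lemma Z2_net: "real n * (w + 4 * real n * \<sigma>) \<le> w * (real_of_int Z2 - 1)"
proof -
  have "real n * (w + 4 * real n * \<sigma>) / w \<le> real_of_int Z2 - 1" unfolding Z2_def by simp
  then show ?thesis using wpos by (simp add: divide_le_eq mult.commute)
qed

text \<open>Here \<open>?q\<close>, the bound for one bisector constraint, is 11 d^2 Y \<theta>: the
  threshold \<delta> for close centers leaves one factor \<theta> of w. Only this single factor Y
  meets the exponent \<kappa> of n, so the power of 1 / \<sigma> stays independent of k.\<close>

lemma blueprint_small:
  "small_event (gaussm n d \<sigma>) (\<lambda>g. blueprint_bad n d k \<kappa> D w \<delta> Z1 Z2 \<mu> (pts \<mu> g)) ((A * \<theta>) ^ 4)"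
proof -
  let ?q = "11 * real d ^ 2 * D * w / (\<delta> * \<sigma>)"
  have Dw: "D / w = Y / \<theta>\<^sup>2" unfolding DY w_def using \<sigma> by simp
  have q: "?q = 11 * real d ^ 2 * Y * \<theta>" unfolding DY w_def \<delta>_def using \<sigma> \<theta> by (simp add: field_simps power2_eq_square)
  have "11 * real d ^ 2 \<le> real n ^ 4 * real n ^ 2" using num_le[of 11 4] dn by (intro mult_mono power_mono) auto
  then have "11 * real d ^ 2 * Y * \<theta> \<le> real n ^ 4 * real n ^ 2 * Y * \<theta>" using Y8 \<theta> by (intro mult_right_mono) auto
  then have qle: "?q \<le> real n ^ 6 * Y * \<theta>" unfolding q by (simp flip: power_add)
  have q0: "0 \<le> ?q" unfolding q using Y8 \<theta> by simp
  have Z0: "0 \<le> Z1" "0 \<le> Z2"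
  proof -
    have "0 < D / w" "0 < real n * (w + 4 * real n * \<sigma>) / w" using wpos Dpos n2 \<sigma> by (auto intro!: divide_pos_pos mult_pos_pos add_pos_pos)
    then have "0 \<le> \<lceil>D / w\<rceil>" "0 \<le> \<lceil>real n * (w + 4 * real n * \<sigma>) / w\<rceil>" by linarith+
    then show "0 \<le> Z1" "0 \<le> Z2" unfolding Z1_def Z2_def by auto
  qed
  have \<theta>\<theta>: "1 \<le> 1 / \<theta>\<^sup>2" "0 < \<theta>\<^sup>2" using \<theta>1 \<theta> by (auto simp: power_le_one)
  have Y\<theta>: "1 \<le> Y / \<theta>\<^sup>2"
  proof -
    have "1 * 1 \<le> Y * (1 / \<theta>\<^sup>2)" using Y8 \<theta>\<theta> by (intro mult_mono) auto
    then show ?thesis by simp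
  qed
  have b1: "2 * real_of_int Z1 + 1 \<le> 7 * (Y / \<theta>\<^sup>2)"
    using ceil_le[of "Y / \<theta>\<^sup>2"] Y\<theta> unfolding Z1_def Dw by linarith
  have bq: "(2 * real_of_int Z1 + 1) * ?q ^ 4 \<le> 1"
  proof -
    have "(2 * real_of_int Z1 + 1) * ?q ^ 4 \<le> 7 * (Y / \<theta>\<^sup>2) * (real n ^ 6 * Y * \<theta>) ^ 4"
      using b1 qle q0 Z0 Y\<theta> by (intro mult_mono power_mono) auto
    also have "\<dots> = 7 * (real n ^ 24 * Y ^ 5 * \<theta>\<^sup>2)"
    proof -
      have "(real n ^ 6 * Y * \<theta>) ^ 4 = real n ^ 24 * Y ^ 4 * (\<theta>\<^sup>2 * \<theta>\<^sup>2)"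
        by (simp add: power_mult_distrib flip: power_mult power_add)
      then have "7 * (Y / \<theta>\<^sup>2) * (real n ^ 6 * Y * \<theta>) ^ 4 = 7 * (real n ^ 24 * (Y * Y ^ 4)) * (\<theta>\<^sup>2 * \<theta>\<^sup>2 / \<theta>\<^sup>2)" by simp
      also have "\<theta>\<^sup>2 * \<theta>\<^sup>2 / \<theta>\<^sup>2 = \<theta>\<^sup>2" using \<theta>\<theta>(2) by (intro nonzero_mult_div_cancel_right) auto
      also have "Y * Y ^ 4 = Y ^ 5" by (simp flip: power_Suc)
      finally show ?thesis by simp
    qed
    also have "\<dots> \<le> real n ^ 3 * (real n ^ 24 * Y ^ 6 * \<theta>\<^sup>2)"
      using num_le[of 7 3] Y8 by (intro mult_mono mult_right_mono mult_left_mono power_increasing) auto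
    also have "\<dots> = real n ^ 27 * Y ^ 6 * \<theta>\<^sup>2" by (simp flip: power_add)
    also have "\<dots> \<le> real n ^ 28 * Y ^ 6 * \<theta>\<^sup>2" using Y8 by (intro mult_right_mono pow_n) auto
    also have "\<dots> = (real n ^ 14 * Y ^ 3 * \<theta>) ^ 2" by (simp add: power_mult_distrib flip: power_mult)
    also have "\<dots> \<le> 1" using mono1[of 14 3] \<kappa>0 nr Y8 \<theta> by (intro power_le_one) auto
    finally show ?thesis .
  qed
  \<comment> \<open>A light coordinate has of order n^2 / \<theta>^2 offsets and a balance of
    probability at most 2 n \<theta>^2: both \<theta> and \<sigma> cancel.\<close>
  have A2: "(2 * real_of_int Z2 + 1) * (2 * real n * w / \<sigma>) \<le> real n ^ 8"
  proof -
    have e: "real n * (w + 4 * real n * \<sigma>) / w = real n + 4 * real n ^ 2 / \<theta>\<^sup>2"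
    proof -
      have "real n * (w + 4 * real n * \<sigma>) / w = real n + 4 * real n ^ 2 * (\<sigma> / w)"
        using wpos by (simp add: field_simps power2_eq_square)
      also have "\<sigma> / w = 1 / \<theta>\<^sup>2" unfolding w_def using \<sigma> by simp
      finally show ?thesis by simp
    qed
    have "2 * real_of_int Z2 + 1 \<le> 2 * (real n + 4 * real n ^ 2 / \<theta>\<^sup>2) + 5"
      unfolding Z2_def e by (rule ceil_le)
    also have "\<dots> \<le> (8 * real n ^ 2 + 2 * real n + 5) * (1 / \<theta>\<^sup>2)"
    proof -
      have "2 * real n + 5 \<le> (2 * real n + 5) * (1 / \<theta>\<^sup>2)" using mult_left_mono[OF \<theta>\<theta>(1), of "2 * real n + 5"] by simp
      then show ?thesis by (simp add: algebra_simps)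
    qed
    also have "\<dots> \<le> (16 * real n ^ 2) * (1 / \<theta>\<^sup>2)"
    proof (rule mult_right_mono)
      have "2 * real n + 5 \<le> 8 * real n ^ 2" using n1sq nr by linarith
      then show "8 * real n ^ 2 + 2 * real n + 5 \<le> 16 * real n ^ 2" by simp
    qed (use \<theta>\<theta> in auto)
    finally have "2 * real_of_int Z2 + 1 \<le> (16 * real n ^ 2) * (1 / \<theta>\<^sup>2)" .
    then have "(2 * real_of_int Z2 + 1) * (2 * real n * w / \<sigma>) \<le> (16 * real n ^ 2) * (1 / \<theta>\<^sup>2) * (2 * real n * w / \<sigma>)"
      using wpos \<sigma> by (intro mult_right_mono) auto
    also have "\<dots> = 32 * real n ^ 3 * ((w / \<sigma>) / \<theta>\<^sup>2)" by (simp add: power3_eq_cube power2_eq_square mult_ac)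
    also have "(w / \<sigma>) / \<theta>\<^sup>2 = 1" unfolding w\<sigma> using \<theta>\<theta> by simp
    also have "32 * real n ^ 3 * 1 \<le> real n ^ 5 * real n ^ 3" unfolding mult_1_right using num_le[of 32 5] by (intro mult_right_mono) auto
    also have "\<dots> = real n ^ 8" by (simp flip: power_add)
    finally show ?thesis .
  qed
  let ?m = "16 * k * d"
  \<comment> \<open>With m = 16 k d the counts amount to n^(5 m + 2 k), at most n^(82 k d); the
    factor n^8 per light coordinate raises 82 to 90.\<close>
  have N0: "real ((n + 1) ^ ?m * ((k ^ ?m) ^ 2 * (2 ^ ?m * (2 ^ k * 2 ^ k)))) * (real n ^ 8) ^ (k * d) \<le> (real n ^ 90) ^ (k * d)"
  proof -
    have "real ((n + 1) ^ ?m * ((k ^ ?m) ^ 2 * (2 ^ ?m * (2 ^ k * 2 ^ k)))) = (real n + 1) ^ ?m * ((real k ^ ?m) ^ 2 * (2 ^ ?m * (2 ^ k * 2 ^ k)))" by (simp add: add.commute)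
    also have "\<dots> \<le> (real n ^ 2) ^ ?m * ((real n ^ ?m) ^ 2 * (real n ^ ?m * (real n ^ k * real n ^ k)))"
      using n1sq kn by (intro mult_mono power_mono two_pow) auto
    also have "\<dots> = real n ^ (5 * ?m + 2 * k)" by (simp add: mult_ac flip: power_mult power_add)
    also have "\<dots> \<le> real n ^ (82 * (k * d))"
    proof (rule pow_n)
      have "k \<le> k * d" using d0 by simp
      then show "5 * ?m + 2 * k \<le> 82 * (k * d)" by (simp add: mult.assoc)
    qed
    finally have "real ((n + 1) ^ ?m * ((k ^ ?m) ^ 2 * (2 ^ ?m * (2 ^ k * 2 ^ k)))) * (real n ^ 8) ^ (k * d) \<le> real n ^ (82 * (k * d)) * (real n ^ 8) ^ (k * d)"
      by (intro mult_right_mono) auto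
    also have "\<dots> = (real n ^ 90) ^ (k * d)" unfolding power_mult[symmetric] power_add[symmetric] by (simp add: algebra_simps)
    finally show ?thesis .
  qed
  have fq: "(real n ^ 90) ^ (2 * \<kappa>) * ?q \<le> real n ^ (186 * \<kappa>) * Y ^ 1 * \<theta>"
  proof -
    have "(real n ^ 90) ^ (2 * \<kappa>) * ?q \<le> (real n ^ 90) ^ (2 * \<kappa>) * (real n ^ 6 * Y * \<theta>)" using qle by (intro mult_left_mono) auto
    also have "\<dots> = real n ^ (180 * \<kappa> + 6) * Y * \<theta>" by (simp add: power_add flip: power_mult)
    also have "\<dots> \<le> real n ^ (186 * \<kappa>) * Y * \<theta>" using \<kappa>0 Y8 \<theta> by (intro mult_right_mono pow_n) auto
    finally show ?thesis by simp
  qed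
  show ?thesis
  proof (rule small_event_mono[OF small_blueprint_bad[OF \<sigma> \<delta>pos less_imp_le[OF Dpos] less_imp_le[OF wpos] d0 k0 _ Z0 A2 _ bq _ N0]])
    show "(real n ^ 90) ^ (2 * \<kappa>) * ?q \<le> 1" using fq mono1[of "186 * \<kappa>" 1] by simp
    have "((real n ^ 90) ^ (2 * \<kappa>) * ?q) ^ 4 \<le> (real n ^ (186 * \<kappa>) * Y ^ 1 * \<theta>) ^ 4" 
      by (rule power_mono[OF fq]) (intro mult_nonneg_nonneg q0, simp)
    then show "((real n ^ 90) ^ (2 * \<kappa>) * ?q) ^ 4 \<le> (A * \<theta>) ^ 4" by (rule final_pow[rotated 3]) auto
  qed (use n2 nr in auto)
qed

end
end

section \<open>Expected number of iterations\<close>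

definition noise_box :: "nat \<Rightarrow> nat \<Rightarrow> real \<Rightarrow> (nat \<times> nat \<Rightarrow> real) \<Rightarrow> bool" where
  "noise_box n d \<nu> g \<longleftrightarrow> (\<forall>p<n. \<forall>l<d. \<bar>g (p, l)\<bar> \<le> \<nu>)"

text \<open>Half of the exponent v^2 / (2 \<sigma>^2) is bounded by its value at the threshold; the
  other half is the exponent of a normal density of twice the variance, which integrates to 1. The
  change of normalization costs sqrt 2 \<le> 2.\<close>

lemma normal_tail:
  fixes \<sigma> \<rho> :: real
  assumes \<sigma>: "0 < \<sigma>" and \<rho>: "0 \<le> \<rho>"
  shows "emeasure (density lborel (normal_density 0 \<sigma>)) {v. \<rho> * \<sigma> < \<bar>v\<bar>} \<le> ennreal (2 * exp (- \<rho>\<^sup>2 / 4))"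
proof -
  let ?s = "sqrt 2 * \<sigma>"
  have s: "0 < ?s" using \<sigma> by simp
  have "emeasure (density lborel (normal_density 0 \<sigma>)) {v. \<rho> * \<sigma> < \<bar>v\<bar>}
     = (\<integral>\<^sup>+ v. ennreal (normal_density 0 \<sigma> v) * indicator {v. \<rho> * \<sigma> < \<bar>v\<bar>} v \<partial>lborel)"
    by (subst emeasure_density) auto
  also have "\<dots> \<le> (\<integral>\<^sup>+ v. ennreal (2 * exp (- \<rho>\<^sup>2 / 4)) * ennreal (normal_density 0 ?s v) \<partial>lborel)"
  proof (rule nn_integral_mono)
    fix v :: real
    show "ennreal (normal_density 0 \<sigma> v) * indicator {v. \<rho> * \<sigma> < \<bar>v\<bar>} v \<le> ennreal (2 * exp (- \<rho>\<^sup>2 / 4)) * ennreal (normal_density 0 ?s v)"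
    proof (cases "\<rho> * \<sigma> < \<bar>v\<bar>")
      case False then show ?thesis by simp
    next
      case True
      have "(\<rho> * \<sigma>)\<^sup>2 \<le> v\<^sup>2" using True \<rho> \<sigma> by (metis abs_le_square_iff abs_of_nonneg less_imp_le mult_nonneg_nonneg)
      then have r: "\<rho>\<^sup>2 \<le> v\<^sup>2 / \<sigma>\<^sup>2" using \<sigma> by (simp add: pos_le_divide_eq power_mult_distrib)
      have e: "exp (- v\<^sup>2 / (2 * \<sigma>\<^sup>2)) \<le> exp (- \<rho>\<^sup>2 / 4) * exp (- v\<^sup>2 / (2 * ?s\<^sup>2))"
      proof -
        have "- v\<^sup>2 / (2 * \<sigma>\<^sup>2) = - (v\<^sup>2 / \<sigma>\<^sup>2) / 4 + - (v\<^sup>2 / \<sigma>\<^sup>2) / 4" by simp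
        also have "\<dots> \<le> - \<rho>\<^sup>2 / 4 + - (v\<^sup>2 / \<sigma>\<^sup>2) / 4" using r by simp
        also have "- (v\<^sup>2 / \<sigma>\<^sup>2) / 4 = - v\<^sup>2 / (2 * ?s\<^sup>2)" by (simp add: power_mult_distrib)
        finally show ?thesis by (simp flip: exp_add)
      qed
      have sq: "sqrt (2 * pi * ?s\<^sup>2) = sqrt 2 * sqrt (2 * pi * \<sigma>\<^sup>2)"
        by (simp add: real_sqrt_mult power_mult_distrib)
      have p0: "0 < sqrt (2 * pi * \<sigma>\<^sup>2)" using \<sigma> by simp
      have c: "1 / sqrt (2 * pi * \<sigma>\<^sup>2) \<le> 2 * (1 / sqrt (2 * pi * ?s\<^sup>2))"
      proof -
        have "sqrt 2 \<le> 2" by (simp add: real_le_lsqrt)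
        then have "sqrt 2 * (1 / (sqrt 2 * sqrt (2 * pi * \<sigma>\<^sup>2))) \<le> 2 * (1 / (sqrt 2 * sqrt (2 * pi * \<sigma>\<^sup>2)))"
          using p0 by (intro mult_right_mono) auto
        then show ?thesis unfolding sq by simp
      qed
      have "normal_density 0 \<sigma> v \<le> 2 * (1 / sqrt (2 * pi * ?s\<^sup>2)) * (exp (- \<rho>\<^sup>2 / 4) * exp (- v\<^sup>2 / (2 * ?s\<^sup>2)))"
        unfolding normal_density_def using mult_mono[OF c e] p0 s by simp
      also have "\<dots> = 2 * exp (- \<rho>\<^sup>2 / 4) * normal_density 0 ?s v" unfolding normal_density_def by simp
      finally show ?thesis using True by (simp add: ennreal_leI flip: ennreal_mult)
    qed
  qed
  also have "\<dots> = ennreal (2 * exp (- \<rho>\<^sup>2 / 4)) * (\<integral>\<^sup>+ v. ennreal (normal_density 0 ?s v) \<partial>lborel)"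
    by (intro nn_integral_cmult) auto
  also have "(\<integral>\<^sup>+ v. ennreal (normal_density 0 ?s v) \<partial>lborel) = 1"
    using prob_space.emeasure_space_1[OF prob_space_normal_density[OF s, of 0]] by (simp add: emeasure_density)
  finally show ?thesis by simp
qed

lemma small_box:
  assumes \<sigma>: "0 < \<sigma>" and \<rho>: "0 \<le> \<rho>"
  shows "small_event (gaussm n d \<sigma>) (\<lambda>g. \<not> noise_box n d (\<rho> * \<sigma>) g) (real (n * d) * (2 * exp (- \<rho>\<^sup>2 / 4)))"
proof -
  let ?N = "density lborel (normal_density 0 \<sigma>)"
  have "small_event (gaussm n d \<sigma>) (\<lambda>g. \<exists>x\<in>{..<n} \<times> {..<d}. \<rho> * \<sigma> < \<bar>g x\<bar>) (real (n * d) * (2 * exp (- \<rho>\<^sup>2 / 4)))"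
  proof (rule small_event_Union)
    fix x assume x: "x \<in> {..<n} \<times> {..<d}"
    have m: "(\<lambda>g. g x) \<in> measurable (gaussm n d \<sigma>) ?N"
      unfolding gauss_def using x by (intro measurable_component_singleton)
    have "distr (gaussm n d \<sigma>) ?N (\<lambda>g. g x) = ?N"
      unfolding gauss_def using x prob_space_normal_density[OF \<sigma>] by (intro distr_PiM_component) auto
    then have "emeasure (gaussm n d \<sigma>) ((\<lambda>g. g x) -` {v. \<rho> * \<sigma> < \<bar>v\<bar>} \<inter> space (gaussm n d \<sigma>)) = emeasure ?N {v. \<rho> * \<sigma> < \<bar>v\<bar>}"
      using emeasure_distr[OF m, of "{v. \<rho> * \<sigma> < \<bar>v\<bar>}"] by simp
    moreover have "(\<lambda>g. g x) -` {v. \<rho> * \<sigma> < \<bar>v\<bar>} \<inter> space (gaussm n d \<sigma>) \<in> sets (gaussm n d \<sigma>)"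
      using m by (rule measurable_sets) auto
    ultimately show "small_event (gaussm n d \<sigma>) (\<lambda>g. \<rho> * \<sigma> < \<bar>g x\<bar>) (2 * exp (- \<rho>\<^sup>2 / 4))"
      unfolding small_event_def using normal_tail[OF assms]
      by (intro bexI[of _ "(\<lambda>g. g x) -` {v. \<rho> * \<sigma> < \<bar>v\<bar>} \<inter> space (gaussm n d \<sigma>)"]) auto
  qed auto
  then show ?thesis by (rule small_event_mono) (auto simp: noise_box_def not_le)
qed

context scales begin

text \<open>The noise box is kept apart from the bad event, because its failure probability does not
  depend on \<theta> and is charged only once for all scales.\<close>

lemma iterations_small:
  assumes A\<theta>: "A * \<theta> \<le> 1" and \<mu>: "\<And>p l. p < n \<Longrightarrow> l < d \<Longrightarrow> 0 \<le> \<mu> p l \<and> \<mu> p l \<le> 1"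
  shows "\<exists>Bad. small_event (gaussm n d \<sigma>) Bad (4 * (A * \<theta>) ^ 4) \<and>
    (\<forall>g T. noise_box n d (4 * real n * \<sigma>) g \<longrightarrow> \<not> Bad g \<longrightarrow> kmeans_iterations n d k (pts \<mu> g) C0 = enat T \<longrightarrow>
       real T \<le> 70 * real n ^ 3 * Y ^ 2 / \<theta> ^ 4)"
proof -
  let ?M = "gaussm n d \<sigma>"
  have w2: "w\<^sup>2 = \<sigma>\<^sup>2 * \<theta> ^ 4" unfolding w_def by (simp add: power_mult_distrib flip: power_mult)
  have box: "\<bar>pts \<mu> g p l\<bar> \<le> D" "\<bar>pts \<mu> g p l - \<mu> p l\<bar> \<le> 4 * real n * \<sigma>"
    if "noise_box n d (4 * real n * \<sigma>) g" "p < n" "l < d" for g p l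
  proof -
    have "\<bar>g (p, l)\<bar> \<le> 4 * real n * \<sigma>" using that unfolding noise_box_def by auto
    then show "\<bar>pts \<mu> g p l\<bar> \<le> D" "\<bar>pts \<mu> g p l - \<mu> p l\<bar> \<le> 4 * real n * \<sigma>"
      using \<mu>[OF that(2,3)] unfolding D_def pts_def by auto
  qed
  \<comment> \<open>Here P / \<epsilon> is 4 n d Y^2 / \<theta>^4, as D = \<sigma> Y and w =
    \<sigma> \<theta>^2; the window lengths 3 and 5 k + 6 are at most 11 n.\<close>
  have count: "real T \<le> 70 * real n ^ 3 * Y ^ 2 / \<theta> ^ 4"
    if T: "real T \<le> real L * (real k + 2 + 4 * real n * real d * D\<^sup>2 / w\<^sup>2) + 2" and L: "L \<le> 11 * n" for T L :: nat
  proof -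
    have Dw: "D\<^sup>2 / w\<^sup>2 = Y ^ 2 / \<theta> ^ 4" unfolding w2 DY using \<sigma> by (simp add: power_mult_distrib)
    let ?x = "Y ^ 2 / \<theta> ^ 4"
    have x1: "1 \<le> ?x"
    proof -
      have "\<theta> ^ 4 \<le> 1" using \<theta>1(2)[OF A\<theta>] \<theta> by (intro power_le_one) auto
      moreover have "1 \<le> Y ^ 2" using Y8 by (intro one_le_power) auto
      ultimately show ?thesis using \<theta> by (simp add: le_divide_eq)
    qed
    have n3: "real n ^ 2 \<le> real n ^ 3" "8 \<le> real n ^ 3" using pow_n[of 2 3] num_le[of 8 3] by auto
    have "real k + 2 \<le> 2 * real n" using kn n2 by simp
    moreover have "4 * real n * real d * ?x \<le> 4 * real n * real n * ?x" using dn x1 by (intro mult_right_mono mult_left_mono) auto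
    ultimately have "real k + 2 + 4 * real n * real d * ?x \<le> 2 * real n + 4 * real n ^ 2 * ?x" by (simp add: power2_eq_square)
    moreover have "4 * real n * real d * D\<^sup>2 / w\<^sup>2 = 4 * real n * real d * ?x" unfolding Dw[symmetric] by simp
    ultimately have "real L * (real k + 2 + 4 * real n * real d * D\<^sup>2 / w\<^sup>2) \<le> (11 * real n) * (2 * real n + 4 * real n ^ 2 * ?x)"
      using L x1 by (intro mult_mono) auto
    also have "\<dots> = 22 * real n ^ 2 + 44 * (real n ^ 3 * ?x)" by (simp add: power2_eq_square power3_eq_cube algebra_simps)
    finally have "real T \<le> 22 * real n ^ 2 + 44 * (real n ^ 3 * ?x) + 2" using T by simp
    moreover have "real n ^ 3 * 1 \<le> real n ^ 3 * ?x" using x1 by (intro mult_left_mono) auto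
    ultimately have "real T \<le> 70 * (real n ^ 3 * ?x)" using n3 by linarith
    then show ?thesis by simp
  qed
  have np: "0 < n" using n2 by simp
  have loc: "kmeans n d k" using np d0 k0 kn dn by unfold_locales
  have A4: "0 \<le> (A * \<theta>) ^ 4" by simp
  show ?thesis
  proof (cases "d = 1")
    case True
    let ?Bad = "\<lambda>g. \<not> null_free n k (pts \<mu> g) C0 \<or> two_relations n 1 1 (10 * real n ^ 2 * w) (pts \<mu> g)"
    have "small_event ?M ?Bad (0 + (A * \<theta>) ^ 4)"
      using small_null[OF \<sigma> d0] two_relations_small_1d[OF A\<theta>] A4 unfolding True by (intro small_event_or) auto
    then have "small_event ?M ?Bad (4 * (A * \<theta>) ^ 4)" by (rule small_event_mono) (use A4 in auto)
    moreover have "real T \<le> 70 * real n ^ 3 * Y ^ 2 / \<theta> ^ 4"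
      if g: "noise_box n d (4 * real n * \<sigma>) g" "\<not> ?Bad g" "kmeans_iterations n d k (pts \<mu> g) C0 = enat T" for g T
    proof -
      interpret K: kmeans n d k "pts \<mu> g" C0 by (rule loc)
      have ns: "\<And>t. t + 2 < T \<Longrightarrow> \<not> K.same_centers (Suc t) t" using K.iterations_enat g(3) by auto
      have "real T \<le> real 3 * (real k + 2 + 4 * real n * real d * D\<^sup>2 / w\<^sup>2) + 2"
      proof (rule K.iterations_le[OF _ _ K.pot_1_le[OF box(1)[OF g(1)]] ns])
        show "0 < w\<^sup>2" using wpos by simp
        fix s assume act: "\<And>i. i < k \<Longrightarrow> K.last_cl (s + 3) i \<noteq> {} \<Longrightarrow> K.last_cl s i \<noteq> {}"
          and sc: "\<And>t. s < t \<Longrightarrow> t < s + 3 \<Longrightarrow> \<not> K.same_centers (Suc t) t"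
        show "w\<^sup>2 < K.pot (s + 1) - K.pot (s + 3)"
          using g(2) act sc[of "s + 1"] sc[of "s + 2"] by (intro K.window_1d[OF True _ wpos]) (auto simp: numeral_3_eq_3)
      qed auto
      then show ?thesis by (rule count) (use n2 in auto)
    qed
    ultimately show ?thesis by blast
  next
    case False
    then have d2: "2 \<le> d" using d0 by simp
    let ?Bad = "\<lambda>g. \<not> null_free n k (pts \<mu> g) C0 \<or> (one_relation n d R (20 * real n ^ 2 * w) (pts \<mu> g) \<or>
       (two_relations n d R (2 * \<delta>) (pts \<mu> g) \<or> ((in_box n d D (pts \<mu> g) \<and> crowded_slab n d (8 * d) (real n * real d * \<delta>) (pts \<mu> g)) \<or>
        blueprint_bad n d k \<kappa> D w \<delta> Z1 Z2 \<mu> (pts \<mu> g))))"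
    have "small_event ?M ?Bad (0 + ((A * \<theta>) ^ 4 + ((A * \<theta>) ^ 4 + ((A * \<theta>) ^ 4 + (A * \<theta>) ^ 4))))"
      by (intro small_event_or small_null[OF \<sigma> d0] one_relation_small[OF A\<theta> d2] two_relations_small[OF A\<theta> d2] slab_small[OF A\<theta>] blueprint_small[OF A\<theta>])
        (use A4 in auto)
    then have "small_event ?M ?Bad (4 * (A * \<theta>) ^ 4)" by (rule small_event_mono) auto
    moreover have "real T \<le> 70 * real n ^ 3 * Y ^ 2 / \<theta> ^ 4"
      if g: "noise_box n d (4 * real n * \<sigma>) g" "\<not> ?Bad g" "kmeans_iterations n d k (pts \<mu> g) C0 = enat T" for g T
    proof -
      interpret K: kmeans n d k "pts \<mu> g" C0 by (rule loc)
      have ns: "\<And>t. t + 2 < T \<Longrightarrow> \<not> K.same_centers (Suc t) t" using K.iterations_enat g(3) by auto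
      let ?L = "1 + 5 * (k + 1)"
      have ib: "in_box n d D (pts \<mu> g)" unfolding in_box_def using box(1)[OF g(1)] by auto
      have w\<delta>: "4 * real n ^ 2 * w \<le> \<delta>"
      proof -
        have "4 * real n ^ 2 * \<theta> \<le> real n ^ 2 * real n ^ 2 * \<theta>" using num_le[of 4 2] \<theta> by (intro mult_right_mono) auto
        also have "\<dots> = real n ^ 4 * \<theta>" by (simp flip: power_add)
        also have "\<dots> \<le> 1" using mono1[OF A\<theta>, of 4 0] \<kappa>0 by simp
        finally have "(4 * real n ^ 2 * \<theta>) * (\<sigma> * \<theta>) \<le> 1 * (\<sigma> * \<theta>)" using \<sigma> \<theta> by (intro mult_right_mono) auto
        then show ?thesis unfolding w_def \<delta>_def by (simp add: power2_eq_square mult_ac)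
      qed
      have wD: "w \<le> D"
      proof -
        have "\<theta>\<^sup>2 \<le> 1" using \<theta>1(2)[OF A\<theta>] \<theta> by (simp add: power_le_one)
        then have "\<sigma> * \<theta>\<^sup>2 \<le> \<sigma> * Y" using \<sigma> Y8 by (intro mult_left_mono) auto
        then show ?thesis unfolding w_def DY .
      qed
      have "real T \<le> real ?L * (real k + 2 + 4 * real n * real d * D\<^sup>2 / w\<^sup>2) + 2"
      proof (rule K.iterations_le[OF _ _ K.pot_1_le[OF box(1)[OF g(1)]] ns])
        show "0 < w\<^sup>2" using wpos by simp
        fix s assume act: "\<And>i. i < k \<Longrightarrow> K.last_cl (s + ?L) i \<noteq> {} \<Longrightarrow> K.last_cl s i \<noteq> {}"
          and sc: "\<And>t. s < t \<Longrightarrow> t < s + ?L \<Longrightarrow> \<not> K.same_centers (Suc t) t"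
        have "w\<^sup>2 < K.pot (s + 1) - K.pot (s + 1 + 5 * (k + 1))"
        proof (rule K.window_drop[OF _ wpos _ _ _ _ R_def \<kappa>0 k\<kappa> w\<delta> wD box[OF g(1)] Z1_net[OF A\<theta>] Z2_net[OF A\<theta>]])
          have e: "s + 1 + 5 * (k + 1) = s + ?L" by simp
          show "K.last_cl s i \<noteq> {}" if "i < k" "K.last_cl (s + 1 + 5 * (k + 1)) i \<noteq> {}" for i
            using act[OF that(1)] that(2) unfolding e .
          show "\<not> K.same_centers (Suc t) t" if "s < t" "t < s + 1 + 5 * (k + 1)" for t
            using sc[OF that(1)] that(2) unfolding e .
        qed (use g(2) ib in blast)+
        then show "w\<^sup>2 < K.pot (s + 1) - K.pot (s + ?L)" by (simp only: add.assoc)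
      qed auto
      then show ?thesis by (rule count) (use kn n2 in auto)
    qed
    ultimately show ?thesis by blast
  qed
qed

end

text \<open>From one scale to the next the bound on T grows by 16 while the failure probability
  shrinks by 16, so every scale contributes the same 64 K. After I scales, and outside the tame set,
  the cap W takes over.\<close>

lemma nn_integral_multiscale:
  fixes M :: "'a measure" and T :: "'a \<Rightarrow> nat" and K q W :: real and I :: nat
  assumes M: "prob_space M" and K: "0 \<le> K" and q: "0 \<le> q" and W: "0 \<le> W"
    and tame: "small_event M (\<lambda>g. \<not> tame g) q"
    and bad: "\<And>i. i \<le> I \<Longrightarrow> small_event M (bad i) (4 * (1 / 16) ^ i)"
    and T: "\<And>g i. g \<in> space M \<Longrightarrow> i \<le> I \<Longrightarrow> tame g \<Longrightarrow> \<not> bad i g \<Longrightarrow> real (T g) \<le> K * 16 ^ i"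
    and TW: "\<And>g. g \<in> space M \<Longrightarrow> real (T g) \<le> W"
  shows "(\<integral>\<^sup>+ g. ennreal (real (T g)) \<partial>M) \<le> ennreal (K * (1 + 64 * real I) + 4 * W * (1 / 16) ^ I + W * q)"
proof -
  interpret prob_space M by fact
  obtain B where B: "B \<in> sets M" "\<And>g. g \<in> space M \<Longrightarrow> \<not> tame g \<Longrightarrow> g \<in> B" "emeasure M B \<le> ennreal q"
    using tame unfolding small_event_def by blast
  have "\<forall>i\<in>{..I}. \<exists>S. S \<in> sets M \<and> (\<forall>g\<in>space M. bad i g \<longrightarrow> g \<in> S) \<and> emeasure M S \<le> ennreal (4 * (1 / 16) ^ i)"
    using bad unfolding small_event_def by (metis atMost_iff)
  then obtain S where S: "\<And>i. i \<le> I \<Longrightarrow> S i \<in> sets M" "\<And>i g. i \<le> I \<Longrightarrow> g \<in> space M \<Longrightarrow> bad i g \<Longrightarrow> g \<in> S i"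
    "\<And>i. i \<le> I \<Longrightarrow> emeasure M (S i) \<le> ennreal (4 * (1 / 16) ^ i)"
    unfolding Ball_def atMost_iff by metis
  \<comment> \<open>If i is the first scale whose bad set misses g, then T is at most K 16^i and g
    lies in \<open>S (i - 1)\<close>; that is the summand paying for it.\<close>
  let ?f = "\<lambda>g. ennreal K + (\<Sum>i<I. ennreal (K * 16 ^ Suc i) * indicator (S i) g) + ennreal W * indicator (S I) g + ennreal W * indicator B g"
  have "ennreal (real (T g)) \<le> ?f g" if g: "g \<in> space M" for g
  proof (cases "g \<in> B \<or> g \<in> S I")
    case True
    have "ennreal (real (T g)) \<le> ennreal W" using TW[OF g] by (rule ennreal_leI)
    also have "\<dots> \<le> ennreal W * indicator (S I) g + ennreal W * indicator B g" using True by (auto simp: indicator_def)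
    also have "\<dots> \<le> ?f g" by (simp add: add.assoc add_increasing)
    finally show ?thesis .
  next
    case False
    then have b: "tame g" using B(2)[OF g] by auto
    have ex: "\<exists>i. i \<le> I \<and> g \<notin> S i" using False by auto
    define i where "i = (LEAST i. i \<le> I \<and> g \<notin> S i)"
    have i: "i \<le> I" "g \<notin> S i" using LeastI_ex[OF ex] unfolding i_def by auto
    have Ti: "real (T g) \<le> K * 16 ^ i" using T[OF g i(1) b] S(2)[OF i(1) g] i(2) by blast
    show ?thesis
    proof (cases i)
      case 0
      then have "ennreal (real (T g)) \<le> ennreal K" using Ti by (simp add: ennreal_leI)
      also have "\<dots> \<le> ?f g" by (simp add: add.assoc add_increasing2)
      finally show ?thesis .
    next
      case (Suc j)
      have jS: "g \<in> S j" using not_less_Least[of j "\<lambda>i. i \<le> I \<and> g \<notin> S i"] Suc i unfolding i_def by auto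
      have "ennreal (real (T g)) \<le> ennreal (K * 16 ^ Suc j) * indicator (S j) g" using Ti jS unfolding Suc by (simp add: ennreal_leI)
      also have "\<dots> \<le> (\<Sum>i<I. ennreal (K * 16 ^ Suc i) * indicator (S i) g)" using Suc i by (intro member_le_sum) auto
      also have "\<dots> \<le> ?f g" by (simp add: add.assoc add_increasing add_increasing2)
      finally show ?thesis .
    qed
  qed
  then have "(\<integral>\<^sup>+ g. ennreal (real (T g)) \<partial>M) \<le> (\<integral>\<^sup>+ g. ?f g \<partial>M)" by (rule nn_integral_mono)
  also have "\<dots> = ennreal K + (\<Sum>i<I. ennreal (K * 16 ^ Suc i) * emeasure M (S i)) + ennreal W * emeasure M (S I) + ennreal W * emeasure M B"
  proof -
    have mS: "(\<lambda>g. c * indicator (S i) g) \<in> borel_measurable M" if "i \<le> I" for i and c :: ennreal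
      using S(1)[OF that] by (intro borel_measurable_times_ennreal borel_measurable_indicator) auto
    have mB: "(\<lambda>g. c * indicator B g) \<in> borel_measurable M" for c :: ennreal
      using B(1) by (intro borel_measurable_times_ennreal borel_measurable_indicator) auto
    have msum: "(\<lambda>g. \<Sum>i<I. ennreal (K * 16 ^ Suc i) * indicator (S i) g) \<in> borel_measurable M"
      using mS by (intro borel_measurable_sum) auto
    have "(\<integral>\<^sup>+ g. ?f g \<partial>M) = (\<integral>\<^sup>+ g. ennreal K \<partial>M) + (\<integral>\<^sup>+ g. (\<Sum>i<I. ennreal (K * 16 ^ Suc i) * indicator (S i) g) \<partial>M)
      + (\<integral>\<^sup>+ g. ennreal W * indicator (S I) g \<partial>M) + (\<integral>\<^sup>+ g. ennreal W * indicator B g \<partial>M)"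
      using mS[of I] mB msum by (simp only: nn_integral_add borel_measurable_add borel_measurable_const order_refl)
    also have "(\<integral>\<^sup>+ g. (\<Sum>i<I. ennreal (K * 16 ^ Suc i) * indicator (S i) g) \<partial>M) = (\<Sum>i<I. \<integral>\<^sup>+ g. ennreal (K * 16 ^ Suc i) * indicator (S i) g \<partial>M)"
      using mS by (intro nn_integral_sum) auto
    also have "\<dots> = (\<Sum>i<I. ennreal (K * 16 ^ Suc i) * emeasure M (S i))"
      using S(1) by (intro sum.cong nn_integral_cmult_indicator) auto
    also have "(\<integral>\<^sup>+ g. ennreal W * indicator (S I) g \<partial>M) = ennreal W * emeasure M (S I)" using S(1) by (intro nn_integral_cmult_indicator) auto
    also have "(\<integral>\<^sup>+ g. ennreal W * indicator B g \<partial>M) = ennreal W * emeasure M B" using B(1) by (rule nn_integral_cmult_indicator)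
    also have "(\<integral>\<^sup>+ g. ennreal K \<partial>M) = ennreal K" by (simp add: emeasure_space_1)
    finally show ?thesis .
  qed
  also have "\<dots> \<le> ennreal K + (\<Sum>i<I. ennreal (64 * K)) + ennreal (4 * W * (1 / 16) ^ I) + ennreal (W * q)"
  proof (intro add_mono sum_mono order_refl)
    fix i assume "i \<in> {..<I}"
    then have "ennreal (K * 16 ^ Suc i) * emeasure M (S i) \<le> ennreal (K * 16 ^ Suc i) * ennreal (4 * (1 / 16) ^ i)"
      using S(3)[of i] by (intro mult_left_mono) auto
    also have "\<dots> = ennreal (K * 16 ^ Suc i * (4 * (1 / 16) ^ i))" using K by (intro ennreal_mult[symmetric]) auto
    also have "K * 16 ^ Suc i * (4 * (1 / 16) ^ i) = 64 * K * (16 * (1 / 16)) ^ i" unfolding power_mult_distrib by simp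
    finally show "ennreal (K * 16 ^ Suc i) * emeasure M (S i) \<le> ennreal (64 * K)" by simp
  next
    have "ennreal W * emeasure M (S I) \<le> ennreal W * ennreal (4 * (1 / 16) ^ I)" using S(3)[of I] by (intro mult_left_mono) auto
    also have "\<dots> = ennreal (4 * W * (1 / 16) ^ I)" using W by (simp add: mult_ac flip: ennreal_mult)
    finally show "ennreal W * emeasure M (S I) \<le> ennreal (4 * W * (1 / 16) ^ I)" .
    have "ennreal W * emeasure M B \<le> ennreal W * ennreal q" using B(3) by (intro mult_left_mono) auto
    also have "\<dots> = ennreal (W * q)" using W q by (simp flip: ennreal_mult)
    finally show "ennreal W * emeasure M B \<le> ennreal (W * q)" .
  qed
  also have "(\<Sum>i<I. ennreal (64 * K)) = ennreal (real I * (64 * K))" using K by (simp add: ennreal_of_nat_eq_real_of_nat ennreal_mult)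
  also have "ennreal K + ennreal (real I * (64 * K)) + ennreal (4 * W * (1 / 16) ^ I) + ennreal (W * q)
     = ennreal (K * (1 + 64 * real I) + 4 * W * (1 / 16) ^ I + W * q)"
    using K W q by (simp add: algebra_simps flip: ennreal_plus)
  finally show ?thesis .
qed

text \<open>The scales are \<theta> = 2^-i / A for i up to n^2: the cap is at most 3 * 2^(n^2),
  which 16^(-n^2) outweighs. The noise box of radius 4 n \<sigma> is chosen so that its failure, of
  order n d e^(-4 n^2), outweighs the cap as well. In the result 2640 = 4 * 660 and 14 = 2 + 4 * 3,
  from Y^2 A^4.\<close>

lemma expected_iterations:
  fixes n d k \<kappa> :: nat and \<sigma> :: real and \<mu> C0 :: "nat \<Rightarrow> nat \<Rightarrow> real"
  defines "Y \<equiv> 1 / \<sigma> + 4 * real n"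
  assumes n2: "2 \<le> n" and k0: "0 < k" and d0: "0 < d" and kn: "k \<le> n" and dn: "d \<le> n" and \<sigma>: "0 < \<sigma>"
    and \<kappa>0: "0 < \<kappa>" and k\<kappa>: "k \<le> \<kappa> * \<kappa>" and \<mu>: "\<And>p l. p < n \<Longrightarrow> l < d \<Longrightarrow> 0 \<le> \<mu> p l \<and> \<mu> p l \<le> 1"
  shows "(\<integral>\<^sup>+ g. ennreal_of_enat (kmeans_iterations n d k (pts \<mu> g) C0) \<partial>gaussm n d \<sigma>)
    \<le> ennreal (5000 * real n ^ 5 * real n ^ (2640 * \<kappa>) * Y ^ 14)"
proof -
  define A where "A = real n ^ (660 * \<kappa>) * Y ^ 3"
  define K where "K = 70 * real n ^ 3 * Y ^ 2 * A ^ 4"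
  define W :: real where "W = 2 ^ (n * k) + 2"
  define q where "q = real (n * d) * (2 * exp (- (4 * real n)\<^sup>2 / 4))"
  define I where "I = n * n"
  have nr: "2 \<le> real n" using n2 by simp
  have Y1: "1 \<le> Y" unfolding Y_def using nr \<sigma> by (simp add: add_increasing)
  have A1: "1 \<le> A"
  proof -
    have "1 * 1 \<le> A" unfolding A_def using nr Y1 by (intro mult_mono one_le_power) auto
    then show ?thesis by simp
  qed
  have loc: "kmeans n d k" using n2 d0 k0 kn dn by unfold_locales auto
  define T where "T g = (THE t. kmeans_iterations n d k (pts \<mu> g) C0 = enat t)" for g
  have T: "kmeans_iterations n d k (pts \<mu> g) C0 = enat (T g)" "real (T g) \<le> W" for g
  proof -
    obtain t where t: "kmeans_iterations n d k (pts \<mu> g) C0 = enat t" "t \<le> 2 ^ (n * k) + 2"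
      using kmeans.iterations_enat[OF loc] by blast
    then have "T g = t" unfolding T_def by simp
    moreover have "real t \<le> real (2 ^ (n * k) + 2)" using t(2) by (rule of_nat_mono)
    ultimately show "kmeans_iterations n d k (pts \<mu> g) C0 = enat (T g)" "real (T g) \<le> W" using t(1) unfolding W_def by auto
  qed
  have sc: "scales n d k \<kappa> \<sigma> ((1 / 2) ^ i / A)" for i
    using n2 k0 d0 kn dn \<sigma> \<kappa>0 k\<kappa> A1 by unfold_locales auto
  have pw: "(A * ((1 / 2) ^ i / A)) ^ 4 = (1 / 16) ^ i" for i
  proof -
    have "A * ((1 / 2) ^ i / A) = (1 / 2) ^ i" using A1 by simp
    also have "((1 / 2 :: real) ^ i) ^ 4 = ((1 / 2) ^ 4) ^ i" unfolding power_mult[symmetric] by (simp only: mult.commute)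
    finally show ?thesis by (simp add: power4_eq_xxxx)
  qed
  have KK: "70 * real n ^ 3 * Y ^ 2 / ((1 / 2) ^ i / A) ^ 4 = K * 16 ^ i" for i
  proof -
    have "((1 / 2 :: real) ^ i) ^ 4 = (1 / 16) ^ i" using pw[of i] A1 by simp
    then have "((1 / 2) ^ i / A) ^ 4 = (1 / 16) ^ i / A ^ 4" unfolding power_divide[of _ A] by simp
    then show ?thesis unfolding K_def using A1 by (simp add: power_divide)
  qed
  have "\<exists>Bad. small_event (gaussm n d \<sigma>) Bad (4 * (1 / 16) ^ i) \<and>
    (\<forall>g t. noise_box n d (4 * real n * \<sigma>) g \<longrightarrow> \<not> Bad g \<longrightarrow> kmeans_iterations n d k (pts \<mu> g) C0 = enat t \<longrightarrow> real t \<le> K * 16 ^ i)" for i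
  proof -
    interpret S: scales n d k \<kappa> \<sigma> "(1 / 2) ^ i / A" by (rule sc)
    have e: "S.Y = Y" "S.A = A" unfolding S.A_def S.Y_def A_def Y_def by auto
    have "(1 / 2 :: real) ^ i \<le> 1" by (simp add: power_le_one)
    then have "S.A * ((1 / 2) ^ i / A) \<le> 1" unfolding e using A1 by simp
    from S.iterations_small[where \<mu> = \<mu> and ?C0.0 = C0, OF this \<mu>] show ?thesis unfolding e pw KK .
  qed
  then obtain bad where bad: "\<And>i. small_event (gaussm n d \<sigma>) (bad i) (4 * (1 / 16) ^ i)"
    "\<And>i g t. noise_box n d (4 * real n * \<sigma>) g \<Longrightarrow> \<not> bad i g \<Longrightarrow> kmeans_iterations n d k (pts \<mu> g) C0 = enat t \<Longrightarrow> real t \<le> K * 16 ^ i"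
    by metis
  have K0: "0 \<le> K" unfolding K_def using Y1 A1 by simp
  have "(\<integral>\<^sup>+ g. ennreal_of_enat (kmeans_iterations n d k (pts \<mu> g) C0) \<partial>gaussm n d \<sigma>) = (\<integral>\<^sup>+ g. ennreal (real (T g)) \<partial>gaussm n d \<sigma>)"
    unfolding T(1) by (simp add: ennreal_of_nat_eq_real_of_nat)
  also have "\<dots> \<le> ennreal (K * (1 + 64 * real I) + 4 * W * (1 / 16) ^ I + W * q)"
  proof (rule nn_integral_multiscale[OF prob_space_gauss[OF \<sigma>] K0])
    show "small_event (gaussm n d \<sigma>) (\<lambda>g. \<not> noise_box n d (4 * real n * \<sigma>) g) q"
      unfolding q_def by (rule small_box[OF \<sigma>]) simp
    show "0 \<le> q" "0 \<le> W" unfolding q_def W_def by auto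
  qed (use bad T in auto)
  also have "\<dots> \<le> ennreal (5000 * real n ^ 5 * real n ^ (2640 * \<kappa>) * Y ^ 14)"
  proof (rule ennreal_leI)
    have nk: "n * k \<le> n * n" using kn by simp
    have W3: "W \<le> 3 * 2 ^ (n * n)"
    proof -
      have "(2::real) ^ (n * k) \<le> 2 ^ (n * n)" using nk by (intro power_increasing) auto
      moreover have "(1::real) \<le> 2 ^ (n * n)" by (simp add: one_le_power)
      ultimately show ?thesis unfolding W_def by linarith
    qed
    have 1: "4 * W * (1 / 16) ^ I \<le> 12"
    proof -
      have "4 * W * (1 / 16) ^ I \<le> 4 * (3 * 2 ^ (n * n)) * (1 / 16) ^ I" using W3 by (intro mult_right_mono) auto
      also have "\<dots> = 12 * (2 * (1 / 16)) ^ (n * n)" unfolding I_def power_mult_distrib by simp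
      also have "\<dots> \<le> 12 * 1" by (intro mult_left_mono power_le_one) auto
      finally show ?thesis by simp
    qed
    have 2: "W * q \<le> 6"
    proof -
      let ?E = "exp (real (n * n))"
      have ex: "exp (- (4 * real n)\<^sup>2 / 4) = exp (- 4 * real (n * n))" by (simp add: power2_eq_square)
      have e1: "real (n * n) \<le> ?E" using exp_ge_add_one_self[of "real (n * n)"] by linarith
      have e2: "(2::real) ^ (n * n) \<le> ?E"
      proof -
        have "(2::real) \<le> exp 1" using exp_ge_add_one_self[of "1::real"] by linarith
        then have "(2::real) ^ (n * n) \<le> exp 1 ^ (n * n)" by (intro power_mono) auto
        also have "\<dots> = ?E" by (metis exp_of_nat_mult mult.right_neutral)
        finally show ?thesis .
      qed
      have nd: "real (n * d) \<le> ?E"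
      proof -
        have "real (n * d) \<le> real (n * n)" using dn by (intro of_nat_mono mult_left_mono) auto
        then show ?thesis using e1 by simp
      qed
      have "W * q \<le> (3 * ?E) * (?E * (2 * exp (- 4 * real (n * n))))"
        unfolding q_def ex using W3 e2 nd by (intro mult_mono) auto
      also have "\<dots> = 6 * (?E * ?E * exp (- 4 * real (n * n)))" by simp
      also have "?E * ?E * exp (- 4 * real (n * n)) = exp (- 2 * real (n * n))" by (simp flip: exp_add)
      also have "6 * exp (- 2 * real (n * n)) \<le> 6 * 1" by (intro mult_left_mono) auto
      finally show ?thesis by simp
    qed
    let ?B = "real n ^ 5 * real n ^ (2640 * \<kappa>) * Y ^ 14"
    have A4: "Y ^ 2 * A ^ 4 = real n ^ (2640 * \<kappa>) * Y ^ 14"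
    proof -
      have "Y ^ 2 * A ^ 4 = real n ^ (660 * \<kappa> * 4) * (Y ^ 2 * Y ^ 12)" unfolding A_def by (simp add: power_mult_distrib flip: power_mult)
      also have "Y ^ 2 * Y ^ 12 = Y ^ 14" unfolding power_add[symmetric] by simp
      finally show ?thesis by simp
    qed
    have "K * (1 + 64 * real I) \<le> K * (65 * real n ^ 2)"
    proof (rule mult_left_mono[OF _ K0])
      have "1 \<le> real n ^ 2" using nr by (intro one_le_power) auto
      then show "1 + 64 * real I \<le> 65 * real n ^ 2" unfolding I_def by (simp add: power2_eq_square)
    qed
    also have "\<dots> = 4550 * (real n ^ 3 * real n ^ 2 * (Y ^ 2 * A ^ 4))" unfolding K_def by simp
    also have "real n ^ 3 * real n ^ 2 = real n ^ 5" unfolding power_add[symmetric] by simp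
    also have "4550 * (real n ^ 5 * (Y ^ 2 * A ^ 4)) = 4550 * ?B" unfolding A4 by (simp only: mult.assoc)
    finally have 3: "K * (1 + 64 * real I) \<le> 4550 * ?B" .
    have "1 * 1 * 1 \<le> ?B" using nr Y1 by (intro mult_mono one_le_power mult_nonneg_nonneg) auto
    then show "K * (1 + 64 * real I) + 4 * W * (1 / 16) ^ I + W * q \<le> 5000 * real n ^ 5 * real n ^ (2640 * \<kappa>) * Y ^ 14"
      using 1 2 3 by simp
  qed
  finally show ?thesis .
qed

section \<open>The polynomial in n^(sqrt k) and 1 / \<sigma>\<close>

lemma poly2_monomial_times_binomial:
  fixes K x y :: real and a b D :: nat
  defines "c \<equiv> \<lambda>i j. if i = a then K * real (b choose j) else 0"
  assumes "a \<le> D" "b \<le> D"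
  shows "poly2 c D x y = K * x ^ a * (1 + y) ^ b"
proof -
  have "poly2 c D x y = (\<Sum>i\<le>D. if i = a then (\<Sum>j\<le>D. K * real (b choose j) * x ^ i * y ^ j) else 0)"
    unfolding poly2_def c_def by (intro sum.cong) auto
  also have "\<dots> = (\<Sum>j\<le>D. K * real (b choose j) * x ^ a * y ^ j)" using assms by simp
  also have "\<dots> = (\<Sum>j\<le>b. K * real (b choose j) * x ^ a * y ^ j)"
    using assms by (intro sum.mono_neutral_right) (auto simp: binomial_eq_0)
  also have "\<dots> = K * x ^ a * (\<Sum>j\<le>b. real (b choose j) * y ^ j)" by (simp add: sum_distrib_left mult_ac)
  also have "(\<Sum>j\<le>b. real (b choose j) * y ^ j) = (y + 1) ^ b" by (simp add: binomial_ring)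
  finally show ?thesis by (simp add: add.commute)
qed

theorem theorem1:
  shows "\<exists>(c :: nat \<Rightarrow> nat \<Rightarrow> real) (D :: nat).
    \<forall>(n :: nat) (k :: nat) (d :: nat) (\<sigma> :: real) (\<mu> :: nat \<Rightarrow> nat \<Rightarrow> real)
      (C0 :: nat \<Rightarrow> nat \<Rightarrow> real).
      0 < n \<longrightarrow> 0 < k \<longrightarrow> 0 < d \<longrightarrow> k \<le> n \<longrightarrow> d \<le> n \<longrightarrow> 0 < \<sigma> \<longrightarrow>
      (\<forall>i<n. \<forall>j<d. 0 \<le> \<mu> i j \<and> \<mu> i j \<le> 1) \<longrightarrow>
      (\<integral>\<^sup>+ g. ennreal_of_enat
          (kmeans_iterations n d k (\<lambda>p j. \<mu> p j + g (p, j)) C0)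
        \<partial>(PiM ({..<n} \<times> {..<d}) (\<lambda>_. density lborel (normal_density 0 \<sigma>))))
      \<le> ennreal (poly2 c D (real n powr sqrt (real k)) (1 / \<sigma>))"
proof -
  \<comment> \<open>With x = n^(sqrt k) and y = 1 / \<sigma>, the factor 4^14 stems from 1 /
    \<sigma> + 4 n \<le> 4 x (1 + y). The degree is 5299 = 5 + 5280 + 14, where 5280 = 2 * 2640
    because n^\<kappa> \<le> x^2.\<close>
  let ?K = "5000 * 4 ^ 14 :: real"
  let ?c = "\<lambda>i j. if i = 5299 then ?K * real (14 choose j) else 0"
  have "(\<integral>\<^sup>+ g. ennreal_of_enat (kmeans_iterations n d k (\<lambda>p j. \<mu> p j + g (p, j)) C0)
        \<partial>(PiM ({..<n} \<times> {..<d}) (\<lambda>_. density lborel (normal_density 0 \<sigma>))))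
      \<le> ennreal (poly2 ?c 5299 (real n powr sqrt (real k)) (1 / \<sigma>))"
    if n0: "0 < n" and k0: "0 < k" and d0: "0 < d" and kn: "k \<le> n" and dn: "d \<le> n" and \<sigma>: "0 < \<sigma>"
      and \<mu>: "\<forall>i<n. \<forall>j<d. 0 \<le> \<mu> i j \<and> \<mu> i j \<le> 1"
    for n k d :: nat and \<sigma> :: real and \<mu> C0 :: "nat \<Rightarrow> nat \<Rightarrow> real"
  proof -
    let ?x = "real n powr sqrt (real k)" and ?y = "1 / \<sigma>"
    have poly: "poly2 ?c 5299 ?x ?y = ?K * ?x ^ 5299 * (1 + ?y) ^ 14"
      by (rule poly2_monomial_times_binomial) auto
    have y0: "0 \<le> ?y" using \<sigma> by simp
    have sk: "1 \<le> sqrt (real k)" using k0 by simp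
    have x1: "1 \<le> ?x" using n0 sk by (intro ge_one_powr_ge_zero) auto
    have P: "(\<lambda>p j. \<mu> p j + g (p, j)) = pts \<mu> g" for g unfolding pts_def by simp
    show ?thesis unfolding P poly gauss_def[symmetric]
    proof (cases "n = 1")
      \<comment> \<open>The estimates absorb constants into powers of n and so assume n \<ge> 2. For
        n = 1 the deterministic bound 2^1 + 2 = 4 suffices.\<close>
      case True
      then have kd: "k = 1" "d = 1" using kn dn k0 d0 by auto
      interpret prob_space "gaussm n d \<sigma>" by (rule prob_space_gauss[OF \<sigma>])
      have loc: "kmeans n d k" using n0 d0 k0 kn dn by unfold_locales
      have "ennreal_of_enat (kmeans_iterations n d k (pts \<mu> g) C0) \<le> ennreal 4" for g
      proof -
        obtain t where t: "kmeans_iterations n d k (pts \<mu> g) C0 = enat t" "t \<le> 2 ^ (n * k) + 2"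
          using kmeans.iterations_enat[OF loc] by blast
        have "real t \<le> 4" using t(2) True kd by simp
        then show ?thesis unfolding t(1) by (simp add: ennreal_of_nat_eq_real_of_nat ennreal_leI del: ennreal_numeral)
      qed
      then have "(\<integral>\<^sup>+ g. ennreal_of_enat (kmeans_iterations n d k (pts \<mu> g) C0) \<partial>gaussm n d \<sigma>) \<le> (\<integral>\<^sup>+ g. ennreal 4 \<partial>gaussm n d \<sigma>)"
        by (intro nn_integral_mono)
      also have "\<dots> = ennreal 4" by (simp add: emeasure_space_1)
      also have "\<dots> \<le> ennreal (?K * ?x ^ 5299 * (1 + ?y) ^ 14)"
      proof (rule ennreal_leI)
        have "4 * 1 * 1 \<le> ?K * ?x ^ 5299 * (1 + ?y) ^ 14" using x1 y0 by (intro mult_mono one_le_power) auto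
        then show "4 \<le> ?K * ?x ^ 5299 * (1 + ?y) ^ 14" by simp
      qed
      finally show "(\<integral>\<^sup>+ g. ennreal_of_enat (kmeans_iterations n d k (pts \<mu> g) C0) \<partial>gaussm n d \<sigma>) \<le> ennreal (?K * ?x ^ 5299 * (1 + ?y) ^ 14)" .
    next
      case False
      then have n2: "2 \<le> n" using n0 by simp
      \<comment> \<open>Rounding up at most doubles the root, since sqrt k \<ge> 1.\<close>
      define \<kappa> where "\<kappa> = nat \<lceil>sqrt (real k)\<rceil>"
      have \<kappa>r: "sqrt (real k) \<le> real \<kappa>" "real \<kappa> \<le> 2 * sqrt (real k)"
      proof -
        have "real \<kappa> = real_of_int \<lceil>sqrt (real k)\<rceil>" unfolding \<kappa>_def using sk by simp
        then show "sqrt (real k) \<le> real \<kappa>" "real \<kappa> \<le> 2 * sqrt (real k)"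
          using of_int_ceiling_le_add_one[of "sqrt (real k)"] le_of_int_ceiling[of "sqrt (real k)"] sk by linarith+
      qed
      have \<kappa>0: "0 < \<kappa>" using \<kappa>r(1) sk by linarith
      have "real k = sqrt (real k) * sqrt (real k)" by simp
      also have "\<dots> \<le> real \<kappa> * real \<kappa>" using \<kappa>r(1) sk by (intro mult_mono) auto
      finally have k\<kappa>: "k \<le> \<kappa> * \<kappa>" by (metis of_nat_le_iff of_nat_mult)
      let ?Y = "1 / \<sigma> + 4 * real n"
      have nx: "real n \<le> ?x" using powr_mono[of 1 "sqrt (real k)" "real n"] sk n0 by simp
      have n\<kappa>: "real n ^ \<kappa> \<le> ?x ^ 2"
      proof -
        have "real n ^ \<kappa> = real n powr real \<kappa>" using n0 by (simp add: powr_realpow)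
        also have "\<dots> \<le> real n powr (2 * sqrt (real k))" using \<kappa>r(2) n0 by (intro powr_mono) auto
        also have "\<dots> = ?x ^ 2" using n0 by (simp add: powr_powr mult.commute flip: powr_numeral)
        finally show ?thesis .
      qed
      have Y: "?Y \<le> 4 * ?x * (1 + ?y)" "0 \<le> ?Y"
      proof -
        have "1 * ?y \<le> 4 * ?x * ?y" using x1 y0 by (intro mult_right_mono) auto
        then show "?Y \<le> 4 * ?x * (1 + ?y)" using nx by (simp add: algebra_simps)
        show "0 \<le> ?Y" using y0 by simp
      qed
      have "(\<integral>\<^sup>+ g. ennreal_of_enat (kmeans_iterations n d k (pts \<mu> g) C0) \<partial>gaussm n d \<sigma>)
        \<le> ennreal (5000 * real n ^ 5 * real n ^ (2640 * \<kappa>) * ?Y ^ 14)"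
        using n2 k0 d0 kn dn \<sigma> \<kappa>0 k\<kappa> \<mu> by (intro expected_iterations) auto
      also have "\<dots> \<le> ennreal (?K * ?x ^ 5299 * (1 + ?y) ^ 14)"
      proof (rule ennreal_leI)
        have "real n ^ (2640 * \<kappa>) = (real n ^ \<kappa>) ^ 2640" unfolding power_mult[symmetric] by (simp only: mult.commute)
        also have "\<dots> \<le> (?x ^ 2) ^ 2640" using n\<kappa> by (intro power_mono) auto
        finally have 1: "real n ^ (2640 * \<kappa>) \<le> ?x ^ 5280" unfolding power_mult[symmetric] by simp
        have "5000 * real n ^ 5 * real n ^ (2640 * \<kappa>) * ?Y ^ 14 \<le> 5000 * ?x ^ 5 * ?x ^ 5280 * (4 * ?x * (1 + ?y)) ^ 14"
          using nx 1 Y x1 by (intro mult_mono power_mono mult_nonneg_nonneg) auto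
        also have "\<dots> = ?K * (?x ^ 5 * ?x ^ 5280 * ?x ^ 14) * (1 + ?y) ^ 14" unfolding power_mult_distrib by (simp only: mult_ac)
        also have "?x ^ 5 * ?x ^ 5280 * ?x ^ 14 = ?x ^ 5299" unfolding power_add[symmetric] by simp
        finally show "5000 * real n ^ 5 * real n ^ (2640 * \<kappa>) * ?Y ^ 14 \<le> ?K * ?x ^ 5299 * (1 + ?y) ^ 14" .
      qed
      finally show "(\<integral>\<^sup>+ g. ennreal_of_enat (kmeans_iterations n d k (pts \<mu> g) C0) \<partial>gaussm n d \<sigma>) \<le> ennreal (?K * ?x ^ 5299 * (1 + ?y) ^ 14)" .
    qed
  qed
  then show ?thesis by blast
qed

end
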